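(* Let $\mathcal{G}$ be an ultragraph and $K$ a field. Then $L_K(\mathcal{G})$ is primitive if and only if the following conditions hold: (1) $\mathcal{G}$ is downward directed; (2) every cycle in $\mathcal{G}$ has an exit.
   Context: An ultragraph $\mathcal{G}=(G^0,\mathcal{G}^1,r,s)$ consists of a countable set $G^0$ of vertices, a countable set $\mathcal{G}^1$ of edges, and maps $s:\mathcal{G}^1\to G^0$, $r:\mathcal{G}^1\to\mathcal{P}(G^0)\setminus\{\varnothing\}$. A vertex $v$ is a sink if $s^{-1}(v)=\varnothing$ and regular if $0<|s^{-1}(v)|<\infty$. $\mathcal{G}^0$ denotes the smallest subset of $\mathcal{P}(G^0)$ that contains $\{v\}$ for all $v\in G^0$, contains $r(e)$ for all $e\in\mathcal{G}^1$, and is closed under relative complements, finite unions and finite intersections. A path of length $n\ge1$ is a sequence $\alpha=\alpha_1\cdots\alpha_n$ of edges with $s(\alpha_{i+1})\in r(\alpha_i)$ for $1\le i\le n-1$; $s(\alpha)=s(\alpha_1)$, $r(\alpha)=r(\alpha_n)$. Elements $A\in\mathcal{G}^0$ are paths of length $0$ with $s(A)=r(A)=A$. A cycle is a path $\alpha$ of length $\ge1$ with $s(\alpha)\in r(\alpha)$ and $s(\alpha_i)\ne s(\alpha_j)$ for $i\ne j$. An exit for a cycle $\alpha=\alpha_1\cdots\alpha_n$ is either an edge $e$ such that for some $i$, $s(e)\in r(\alpha_i)$ but $e\ne\alpha_{i+1}$ (indices cyclic, $\alpha_{n+1}=\alpha_1$), or a sink $w$ with $w\in r(\alpha_i)$ for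 some $i$. For vertices $v,w\in G^0$ write $v\ge w$ if there is a finite path $p$ with $s(p)=v$ and $w\in r(p)$ (length $0$ allowed, so $v\ge v$). $\mathcal{G}$ is downward directed if for any $v,w\in G^0$ there is $u\in G^0$ with $v\ge u$ and $w\ge u$. For a field $K$, $L_K(\mathcal{G})$ is the (associative, not necessarily unital) $K$-algebra generated by $\{s_e,s_e^*\mid e\in\mathcal{G}^1\}\cup\{p_A\mid A\in\mathcal{G}^0\}$ subject to the relations, for all $A,B\in\mathcal{G}^0$, $e,f\in\mathcal{G}^1$: (1) $p_\varnothing=0$, $p_Ap_B=p_{A\cap B}$, $p_{A\cup B}=p_A+p_B-p_{A\cap B}$; (2) $p_{s(e)}s_e=s_e=s_ep_{r(e)}$ and $p_{r(e)}s_e^*=s_e^*=s_e^*p_{s(e)}$; (3) $s_e^*s_f=\delta_{e,f}p_{r(e)}$; (4) $p_v=\sum_{s(e)=v}s_es_e^*$ for every regular vertex $v$, where $p_v:=p_{\{v\}}$. A ring is primitive if it has a faithful simple (left) module. *)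

theory Defs
  imports
    "HOL-Library.Countable_Set"
    "HOL-Library.Poly_Mapping"
    "HOL-Algebra.QuotRing"
    "HOL-Algebra.Module"
begin

section \<open>Ultragraphs\<close>

record ('v, 'e) ultragraph_data =
  verts :: "'v set"
  edges :: "'e set"
  rng :: "'e \<Rightarrow> 'v set"
  src :: "'e \<Rightarrow> 'v"

locale ultragraph =
  fixes G :: "('v, 'e) ultragraph_data"
  assumes countable_verts: "countable (verts G)"
    and countable_edges: "countable (edges G)"
    and src_in_verts: "e \<in> edges G \<Longrightarrow> src G e \<in> verts G"
    and rng_subset_verts: "e \<in> edges G \<Longrightarrow> rng G e \<subseteq> verts G"
    and rng_nonempty: "e \<in> edges G \<Longrightarrow> rng G e \<noteq> {}"

definition out_edges :: "('v, 'e) ultragraph_data \<Rightarrow> 'v \<Rightarrow> 'e set" where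
  "out_edges G v = {e \<in> edges G. src G e = v}"

definition sink :: "('v, 'e) ultragraph_data \<Rightarrow> 'v \<Rightarrow> bool" where
  "sink G v \<longleftrightarrow> v \<in> verts G \<and> out_edges G v = {}"

definition regular_vertex :: "('v, 'e) ultragraph_data \<Rightarrow> 'v \<Rightarrow> bool" where
  "regular_vertex G v \<longleftrightarrow> v \<in> verts G \<and> out_edges G v \<noteq> {} \<and> finite (out_edges G v)"

text \<open>The family \<open>\<G>\<^sup>0\<close>. The empty set is the union of the empty subfamily; listing it
  separately only matters when there are no vertices.\<close>

inductive_set gen_verts :: "('v, 'e) ultragraph_data \<Rightarrow> 'v set set"
  for G :: "('v, 'e) ultragraph_data" where
  empty: "{} \<in> gen_verts G"
| vertex: "v \<in> verts G \<Longrightarrow> {v} \<in> gen_verts G"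
| range: "e \<in> edges G \<Longrightarrow> rng G e \<in> gen_verts G"
| diff: "A \<in> gen_verts G \<Longrightarrow> B \<in> gen_verts G \<Longrightarrow> A - B \<in> gen_verts G"
| union: "A \<in> gen_verts G \<Longrightarrow> B \<in> gen_verts G \<Longrightarrow> A \<union> B \<in> gen_verts G"
| inter: "A \<in> gen_verts G \<Longrightarrow> B \<in> gen_verts G \<Longrightarrow> A \<inter> B \<in> gen_verts G"

text \<open>Paths of positive length, as nonempty lists of edges.\<close>

definition epath :: "('v, 'e) ultragraph_data \<Rightarrow> 'e list \<Rightarrow> bool" where
  "epath G p \<longleftrightarrow> p \<noteq> [] \<and> set p \<subseteq> edges G \<and>
     (\<forall>i. Suc i < length p \<longrightarrow> src G (p ! Suc i) \<in> rng G (p ! i))"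

definition cycle :: "('v, 'e) ultragraph_data \<Rightarrow> 'e list \<Rightarrow> bool" where
  "cycle G p \<longleftrightarrow> epath G p \<and> src G (hd p) \<in> rng G (last p) \<and> distinct (map (src G) p)"

definition has_exit :: "('v, 'e) ultragraph_data \<Rightarrow> 'e list \<Rightarrow> bool" where
  "has_exit G p \<longleftrightarrow>
     (\<exists>e\<in>edges G. \<exists>i<length p. src G e \<in> rng G (p ! i) \<and> e \<noteq> p ! (Suc i mod length p)) \<or>
     (\<exists>w. sink G w \<and> (\<exists>i<length p. w \<in> rng G (p ! i)))"

text \<open>The disjunct \<open>v = w\<close> is the case of length \<open>0\<close>: a path of length \<open>0\<close> with source
  \<open>v\<close> is the set \<open>{v}\<close>, whose range is \<open>{v}\<close>.\<close>

definition reaches :: "('v, 'e) ultragraph_data \<Rightarrow> 'v \<Rightarrow> 'v \<Rightarrow> bool" where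
  "reaches G v w \<longleftrightarrow> v = w \<or> (\<exists>p. epath G p \<and> src G (hd p) = v \<and> w \<in> rng G (last p))"

definition downward_directed :: "('v, 'e) ultragraph_data \<Rightarrow> bool" where
  "downward_directed G \<longleftrightarrow>
     (\<forall>v\<in>verts G. \<forall>w\<in>verts G. \<exists>u\<in>verts G. reaches G v u \<and> reaches G w u)"


section \<open>Free non-unital algebras\<close>

datatype 'x free_monoid = Word (letters: "'x list")

instantiation free_monoid :: (type) monoid_add
begin

definition zero_free_monoid :: "'a free_monoid" where
  "0 = Word []"

definition plus_free_monoid :: "'a free_monoid \<Rightarrow> 'a free_monoid \<Rightarrow> 'a free_monoid" where
  "v + w = Word (letters v @ letters w)"

instance
  by standard (simp_all add: zero_free_monoid_def plus_free_monoid_def)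

end

lemma letters_zero [simp]: "letters 0 = []"
  by (simp add: zero_free_monoid_def)

lemma letters_plus [simp]: "letters (v + w) = letters v @ letters w"
  by (simp add: plus_free_monoid_def)

text \<open>With concatenation as the monoid operation, the type \<open>'x free_monoid \<Rightarrow>\<^sub>0 'k\<close> is the free
  \<^emph>\<open>unital\<close> algebra on \<open>'x\<close>, with the convolution product of the library.\<close>

definition word_single :: "'x \<Rightarrow> ('x free_monoid \<Rightarrow>\<^sub>0 'k::field)" where
  "word_single x = Poly_Mapping.single (Word [x]) 1"

definition scale :: "'k::field \<Rightarrow> ('x free_monoid \<Rightarrow>\<^sub>0 'k) \<Rightarrow> ('x free_monoid \<Rightarrow>\<^sub>0 'k)" where
  "scale c f = Poly_Mapping.single 0 c * f"

lemma lookup_scale: "Poly_Mapping.lookup (scale c f) w = c * Poly_Mapping.lookup f w"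
proof -
  have "Poly_Mapping.map ((*) c) f = scale c f"
    unfolding scale_def by (rule mult_map_scale_conv_mult)
  then have "Poly_Mapping.lookup (scale c f) w = Poly_Mapping.lookup (Poly_Mapping.map ((*) c) f) w"
    by simp
  then show ?thesis
    by (cases "Poly_Mapping.lookup f w = 0") (simp_all add: Poly_Mapping.map.rep_eq)
qed

text \<open>The free non-unital algebra on a set \<open>X\<close> of generators: linear combinations of nonempty
  words in \<open>X\<close>. The field \<open>one\<close> of the record has to be filled, but its value is not an element
  of the carrier; nothing below depends on it.\<close>

definition free_algebra :: "'x set \<Rightarrow> ('k::field, 'x free_monoid \<Rightarrow>\<^sub>0 'k) module" where
  "free_algebra X =
     \<lparr>carrier = {f. \<forall>w\<in>Poly_Mapping.keys f. letters w \<noteq> [] \<and> set (letters w) \<subseteq> X},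
      mult = (*), one = 1, zero = 0, add = (+), smult = scale\<rparr>"

inductive_set algebra_ideal ::
    "'x set \<Rightarrow> ('x free_monoid \<Rightarrow>\<^sub>0 'k::field) set \<Rightarrow> ('x free_monoid \<Rightarrow>\<^sub>0 'k) set"
  for X :: "'x set" and S :: "('x free_monoid \<Rightarrow>\<^sub>0 'k::field) set" where
  zero: "0 \<in> algebra_ideal X S"
| gen: "f \<in> S \<Longrightarrow> f \<in> algebra_ideal X S"
| add: "f \<in> algebra_ideal X S \<Longrightarrow> g \<in> algebra_ideal X S \<Longrightarrow> f + g \<in> algebra_ideal X S"
| scale: "f \<in> algebra_ideal X S \<Longrightarrow> scale c f \<in> algebra_ideal X S"
| left: "f \<in> algebra_ideal X S \<Longrightarrow> h \<in> carrier (free_algebra X) \<Longrightarrow> h * f \<in> algebra_ideal X S"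
| right: "f \<in> algebra_ideal X S \<Longrightarrow> h \<in> carrier (free_algebra X) \<Longrightarrow> f * h \<in> algebra_ideal X S"

text \<open>The algebra presented by generators \<open>X\<close> and relators \<open>S\<close>: the quotient \<open>F Quot I\<close> of the
  library together with the induced scalar multiplication.\<close>

definition presented_algebra ::
    "'x set \<Rightarrow> ('x free_monoid \<Rightarrow>\<^sub>0 'k::field) set \<Rightarrow> ('k, ('x free_monoid \<Rightarrow>\<^sub>0 'k) set) module" where
  "presented_algebra X S =
     (let F = free_algebra X; I = algebra_ideal X S in
      ring.extend (F Quot I)
        (module.fields (\<lambda>c A. \<Union>f\<in>A. I +>\<^bsub>F\<^esub> (c \<odot>\<^bsub>F\<^esub> f))))"


section \<open>Ultragraph Leavitt path algebras\<close>

datatype ('v, 'e) leavitt_gen = Proj "'v set" | Edge 'e | Ghost 'e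

definition leavitt_gens :: "('v, 'e) ultragraph_data \<Rightarrow> ('v, 'e) leavitt_gen set" where
  "leavitt_gens G = Proj ` gen_verts G \<union> Edge ` edges G \<union> Ghost ` edges G"

type_synonym ('v, 'e, 'k) leavitt_word = "('v, 'e) leavitt_gen free_monoid \<Rightarrow>\<^sub>0 'k"

definition gP :: "'v set \<Rightarrow> ('v, 'e, 'k::field) leavitt_word" where
  "gP A = word_single (Proj A)"

definition gS :: "'e \<Rightarrow> ('v, 'e, 'k::field) leavitt_word" where
  "gS e = word_single (Edge e)"

definition gT :: "'e \<Rightarrow> ('v, 'e, 'k::field) leavitt_word" where
  "gT e = word_single (Ghost e)"

text \<open>A relation \<open>x = y\<close> is encoded by the relator \<open>x - y\<close>; \<open>gT e\<close> stands for \<open>s\<^sub>e\<^sup>*\<close>.\<close>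

inductive_set leavitt_relators ::
    "('v, 'e) ultragraph_data \<Rightarrow> ('v, 'e, 'k::field) leavitt_word set"
  for G :: "('v, 'e) ultragraph_data" where
  P_empty: "gP {} \<in> leavitt_relators G"
| P_inter: "A \<in> gen_verts G \<Longrightarrow> B \<in> gen_verts G \<Longrightarrow>
    gP A * gP B - gP (A \<inter> B) \<in> leavitt_relators G"
| P_union: "A \<in> gen_verts G \<Longrightarrow> B \<in> gen_verts G \<Longrightarrow>
    gP (A \<union> B) - (gP A + gP B - gP (A \<inter> B)) \<in> leavitt_relators G"
| S_source: "e \<in> edges G \<Longrightarrow> gP {src G e} * gS e - gS e \<in> leavitt_relators G"
| S_range: "e \<in> edges G \<Longrightarrow> gS e * gP (rng G e) - gS e \<in> leavitt_relators G"
| T_range: "e \<in> edges G \<Longrightarrow> gP (rng G e) * gT e - gT e \<in> leavitt_relators G"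
| T_source: "e \<in> edges G \<Longrightarrow> gT e * gP {src G e} - gT e \<in> leavitt_relators G"
| CK1: "e \<in> edges G \<Longrightarrow> f \<in> edges G \<Longrightarrow>
    gT e * gS f - (if e = f then gP (rng G e) else 0) \<in> leavitt_relators G"
| CK2: "regular_vertex G v \<Longrightarrow>
    gP {v} - (\<Sum>e\<in>out_edges G v. gS e * gT e) \<in> leavitt_relators G"

definition leavitt_path_algebra ::
    "('v, 'e) ultragraph_data \<Rightarrow> ('k::field, ('v, 'e, 'k) leavitt_word set) module" where
  "leavitt_path_algebra G = presented_algebra (leavitt_gens G) (leavitt_relators G)"


section \<open>Primitive rings\<close>

text \<open>The locales \<open>ring\<close> and \<open>module\<close> of the library require a multiplicative identity (and
  \<open>module\<close> also commutativity), so non-unital versions are introduced. The field \<open>one\<close> of a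
  record is ignored.\<close>

locale nonunital_ring = abelian_group R for R (structure) +
  assumes m_closed: "\<lbrakk>a \<in> carrier R; b \<in> carrier R\<rbrakk> \<Longrightarrow> a \<otimes> b \<in> carrier R"
    and m_assoc: "\<lbrakk>a \<in> carrier R; b \<in> carrier R; c \<in> carrier R\<rbrakk> \<Longrightarrow> (a \<otimes> b) \<otimes> c = a \<otimes> (b \<otimes> c)"
    and l_distr: "\<lbrakk>a \<in> carrier R; b \<in> carrier R; c \<in> carrier R\<rbrakk> \<Longrightarrow> (a \<oplus> b) \<otimes> c = a \<otimes> c \<oplus> b \<otimes> c"
    and r_distr: "\<lbrakk>a \<in> carrier R; b \<in> carrier R; c \<in> carrier R\<rbrakk> \<Longrightarrow> c \<otimes> (a \<oplus> b) = c \<otimes> a \<oplus> c \<otimes> b"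

locale left_module = R?: nonunital_ring R + M?: abelian_group M for R (structure) and M (structure) +
  assumes smult_closed: "\<lbrakk>a \<in> carrier R; x \<in> carrier M\<rbrakk> \<Longrightarrow> a \<odot>\<^bsub>M\<^esub> x \<in> carrier M"
    and smult_l_distr: "\<lbrakk>a \<in> carrier R; b \<in> carrier R; x \<in> carrier M\<rbrakk> \<Longrightarrow>
      (a \<oplus>\<^bsub>R\<^esub> b) \<odot>\<^bsub>M\<^esub> x = a \<odot>\<^bsub>M\<^esub> x \<oplus>\<^bsub>M\<^esub> b \<odot>\<^bsub>M\<^esub> x"
    and smult_r_distr: "\<lbrakk>a \<in> carrier R; x \<in> carrier M; y \<in> carrier M\<rbrakk> \<Longrightarrow>
      a \<odot>\<^bsub>M\<^esub> (x \<oplus>\<^bsub>M\<^esub> y) = a \<odot>\<^bsub>M\<^esub> x \<oplus>\<^bsub>M\<^esub> a \<odot>\<^bsub>M\<^esub> y"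
    and smult_assoc: "\<lbrakk>a \<in> carrier R; b \<in> carrier R; x \<in> carrier M\<rbrakk> \<Longrightarrow>
      (a \<otimes>\<^bsub>R\<^esub> b) \<odot>\<^bsub>M\<^esub> x = a \<odot>\<^bsub>M\<^esub> (b \<odot>\<^bsub>M\<^esub> x)"

text \<open>The convention \<open>R M \<noteq> 0\<close> that is sometimes included in the definition of a simple module
  over a non-unital ring is automatic for a faithful module over a nonzero ring. Over the zero
  ring (which is the algebra of the ultragraph without vertices) the definition
  below makes every simple abelian group a faithful simple module.\<close>

definition simple_module ::
    "('r, 'a) ring_scheme \<Rightarrow> ('r, 'm, 'b) module_scheme \<Rightarrow> bool" where
  "simple_module R M \<longleftrightarrow> left_module R M \<and> carrier M \<noteq> {\<zero>\<^bsub>M\<^esub>} \<and>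
     (\<forall>N. submodule N R M \<longrightarrow> N = {\<zero>\<^bsub>M\<^esub>} \<or> N = carrier M)"

definition faithful_module ::
    "('r, 'a) ring_scheme \<Rightarrow> ('r, 'm, 'b) module_scheme \<Rightarrow> bool" where
  "faithful_module R M \<longleftrightarrow> left_module R M \<and>
     (\<forall>a\<in>carrier R. (\<forall>x\<in>carrier M. a \<odot>\<^bsub>M\<^esub> x = \<zero>\<^bsub>M\<^esub>) \<longrightarrow> a = \<zero>\<^bsub>R\<^esub>)"

text \<open>HOL cannot quantify over the type of the elements of a module. The type \<open>'r set\<close> loses
  nothing: a simple module on which a nonzero ring \<open>R\<close> acts faithfully is isomorphic to the
  quotient of the left regular module by the annihilator of an element. See
  \<open>primitive_ringI\<close> below.\<close>

definition primitive_ring :: "('r, 'a) ring_scheme \<Rightarrow> bool" where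
  "primitive_ring R \<longleftrightarrow>
     (\<exists>M :: ('r, 'r set) module. simple_module R M \<and> faithful_module R M)"

text \<open>Adequacy of the choice of \<open>'r set\<close>: a faithful simple module over elements of any type
  suffices.\<close>

lemma primitive_ringI:
  fixes R :: "('r, 'a) ring_scheme" and M :: "('r, 'm, 'b) module_scheme"
  assumes simp: "simple_module R M" and faith: "faithful_module R M"
    and nonzero: "carrier R \<noteq> {\<zero>\<^bsub>R\<^esub>}"
  shows "primitive_ring R"
proof -
  interpret left_module R M using simp by (simp add: simple_module_def)
  obtain a m where am: "a \<in> carrier R" "m \<in> carrier M" "a \<odot>\<^bsub>M\<^esub> m \<noteq> \<zero>\<^bsub>M\<^esub>"
  proof -
    from nonzero obtain a where "a \<in> carrier R" "a \<noteq> \<zero>\<^bsub>R\<^esub>"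
      using R.zero_closed by blast
    then have "\<not> (\<forall>x\<in>carrier M. a \<odot>\<^bsub>M\<^esub> x = \<zero>\<^bsub>M\<^esub>)"
      using faith unfolding faithful_module_def by blast
    with \<open>a \<in> carrier R\<close> that show ?thesis by blast
  qed
  have zero_act: "\<zero>\<^bsub>R\<^esub> \<odot>\<^bsub>M\<^esub> x = \<zero>\<^bsub>M\<^esub>" if "x \<in> carrier M" for x
    using smult_l_distr[of "\<zero>\<^bsub>R\<^esub>" "\<zero>\<^bsub>R\<^esub>" x] that smult_closed[of "\<zero>\<^bsub>R\<^esub>" x]
    by (metis M.add.r_cancel_one R.l_zero R.zero_closed)
  have minus_act: "\<ominus>\<^bsub>M\<^esub> (b \<odot>\<^bsub>M\<^esub> x) = (\<ominus>\<^bsub>R\<^esub> b) \<odot>\<^bsub>M\<^esub> x" if "b \<in> carrier R" "x \<in> carrier M" for b x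
    using that smult_l_distr[of "\<ominus>\<^bsub>R\<^esub> b" b x]
    by (intro M.minus_equality) (auto simp: smult_closed R.l_neg zero_act)
  define N where "N = (\<lambda>b. b \<odot>\<^bsub>M\<^esub> m) ` carrier R"
  have "submodule N R M"
  proof (intro submodule.intro submodule_axioms.intro M.add.subgroupI)
    show "N \<subseteq> carrier M" "N \<noteq> {}" using am smult_closed by (auto simp: N_def)
    show "\<ominus>\<^bsub>M\<^esub> x \<in> N" if "x \<in> N" for x
      using that am by (auto simp: N_def minus_act)
    show "x \<oplus>\<^bsub>M\<^esub> y \<in> N" if "x \<in> N" "y \<in> N" for x y
      using that am smult_l_distr[symmetric] by (auto simp: N_def)
    show "b \<odot>\<^bsub>M\<^esub> x \<in> N" if "b \<in> carrier R" "x \<in> N" for b x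
      using that am smult_assoc[symmetric] R.m_closed by (auto simp: N_def m_closed)
  qed
  moreover have "N \<noteq> {\<zero>\<^bsub>M\<^esub>}" using am by (auto simp: N_def)
  ultimately have surj: "carrier M = N"
    using simp by (auto simp: simple_module_def)
  define h where "h x = {b \<in> carrier R. b \<odot>\<^bsub>M\<^esub> m = x}" for x
  have inj: "inj_on h (carrier M)"
    by (rule inj_onI) (auto simp: h_def surj N_def)
  define k where "k = the_inv_into (carrier M) h"
  have kh [simp]: "k (h x) = x" if "x \<in> carrier M" for x
    using inj that by (simp add: k_def the_inv_into_f_f)
  define Q :: "('r, 'r set) module" where
    "Q = \<lparr>carrier = h ` carrier M, mult = undefined, one = undefined, zero = h \<zero>\<^bsub>M\<^esub>,
          add = (\<lambda>x y. h (k x \<oplus>\<^bsub>M\<^esub> k y)), smult = (\<lambda>b x. h (b \<odot>\<^bsub>M\<^esub> k x))\<rparr>"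
  have Q: "carrier Q = h ` carrier M" "zero Q = h \<zero>\<^bsub>M\<^esub>"
    "add Q = (\<lambda>x y. h (k x \<oplus>\<^bsub>M\<^esub> k y))" "smult Q = (\<lambda>b x. h (b \<odot>\<^bsub>M\<^esub> k x))"
    by (simp_all add: Q_def)
  interpret Q: abelian_group Q
  proof (rule abelian_groupI)
    fix x assume "x \<in> carrier Q"
    then obtain y where "y \<in> carrier M" "x = h y" by (auto simp: Q)
    then show "\<exists>y\<in>carrier Q. y \<oplus>\<^bsub>Q\<^esub> x = \<zero>\<^bsub>Q\<^esub>"
      by (intro bexI[of _ "h (\<ominus>\<^bsub>M\<^esub> y)"]) (auto simp: Q M.l_neg)
  qed (auto simp: Q M.a_ac)
  have left: "left_module R Q"
    by (intro left_module.intro left_module_axioms.intro R.nonunital_ring_axioms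
        Q.abelian_group_axioms)
      (auto simp: Q smult_closed smult_l_distr smult_r_distr smult_assoc m_closed)
  have faithful: "faithful_module R Q"
    unfolding faithful_module_def
  proof (intro conjI ballI impI left)
    fix b assume b: "b \<in> carrier R" and "\<forall>x\<in>carrier Q. b \<odot>\<^bsub>Q\<^esub> x = \<zero>\<^bsub>Q\<^esub>"
    then have "h (b \<odot>\<^bsub>M\<^esub> x) = h \<zero>\<^bsub>M\<^esub>" if "x \<in> carrier M" for x
      using that by (auto simp: Q)
    then have "b \<odot>\<^bsub>M\<^esub> x = \<zero>\<^bsub>M\<^esub>" if "x \<in> carrier M" for x
      using inj that b by (metis M.zero_closed inj_on_contraD smult_closed)
    then show "b = \<zero>\<^bsub>R\<^esub>" using faith b by (auto simp: faithful_module_def)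
  qed
  have simple: "simple_module R Q"
    unfolding simple_module_def
  proof (intro conjI allI impI left)
    show "carrier Q \<noteq> {\<zero>\<^bsub>Q\<^esub>}"
    proof
      assume "carrier Q = {\<zero>\<^bsub>Q\<^esub>}"
      then have "h (a \<odot>\<^bsub>M\<^esub> m) = h \<zero>\<^bsub>M\<^esub>" using am smult_closed by (auto simp: Q)
      then show False using am inj by (metis M.zero_closed inj_on_contraD smult_closed)
    qed
    fix P assume "submodule P R Q"
    then interpret P: submodule P R Q .
    have sub: "P \<subseteq> h ` carrier M" using P.subset by (simp add: Q)
    have hk: "h (k x) = x" "k x \<in> carrier M" if "x \<in> P" for x
      using that sub by auto
    have "submodule (k ` P) R M"
    proof (intro submodule.intro submodule_axioms.intro M.add.subgroupI)
      show "k ` P \<subseteq> carrier M" using hk by auto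
      show "k ` P \<noteq> {}" using P.one_closed by auto
      show plus: "x \<oplus>\<^bsub>M\<^esub> y \<in> k ` P" if xy: "x \<in> k ` P" "y \<in> k ` P" for x y
      proof -
        obtain u v where uv: "u \<in> P" "v \<in> P" "x = k u" "y = k v" using xy by auto
        then have "u \<oplus>\<^bsub>Q\<^esub> v \<in> P" using P.m_closed[of u v] by simp
        then have "k (u \<oplus>\<^bsub>Q\<^esub> v) \<in> k ` P" by simp
        then show ?thesis using uv hk by (simp add: Q)
      qed
      show "\<ominus>\<^bsub>M\<^esub> x \<in> k ` P" if x: "x \<in> k ` P" for x
      proof -
        obtain u where u: "u \<in> P" "x = k u" using x by auto
        have "h (\<ominus>\<^bsub>M\<^esub> x) = \<ominus>\<^bsub>Q\<^esub> u"
          using u hk sub by (intro Q.minus_equality[symmetric]) (auto simp: Q M.l_neg)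
        moreover have "\<ominus>\<^bsub>Q\<^esub> u \<in> P"
          using P.m_inv_closed[OF u(1)] by (simp add: a_inv_def)
        ultimately have "k (h (\<ominus>\<^bsub>M\<^esub> x)) \<in> k ` P" by simp
        then show ?thesis using u hk by simp
      qed
      show "b \<odot>\<^bsub>M\<^esub> x \<in> k ` P" if b: "b \<in> carrier R" and x: "x \<in> k ` P" for b x
      proof -
        obtain u where u: "u \<in> P" "x = k u" using x by auto
        then have "k (b \<odot>\<^bsub>Q\<^esub> u) \<in> k ` P" using P.smult_closed[OF b] by simp
        then show ?thesis using u hk b smult_closed by (simp add: Q)
      qed
    qed
    then have "k ` P = {\<zero>\<^bsub>M\<^esub>} \<or> k ` P = carrier M"
      using simp by (auto simp: simple_module_def)
    moreover have "P = h ` k ` P"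
      using hk by (force simp: image_iff)
    ultimately show "P = {\<zero>\<^bsub>Q\<^esub>} \<or> P = carrier Q"
      by (auto simp: Q)
  qed
  show ?thesis
    using simple faithful by (auto simp: primitive_ring_def)
qed


section \<open>The presented algebras are rings\<close>

lemma free_algebra_simps [simp]:
  "mult (free_algebra X) = (*)" "add (free_algebra X) = (+)" "zero (free_algebra X) = 0"
  "smult (free_algebra X) = scale"
  by (simp_all add: free_algebra_def)

lemma in_free_algebra:
  "f \<in> carrier (free_algebra X) \<longleftrightarrow>
     (\<forall>w\<in>Poly_Mapping.keys f. letters w \<noteq> [] \<and> set (letters w) \<subseteq> X)"
  by (simp add: free_algebra_def)

lemma free_algebra_closed:
  assumes "f \<in> carrier (free_algebra X)" "g \<in> carrier (free_algebra X)"
  shows "f + g \<in> carrier (free_algebra X)" "f - g \<in> carrier (free_algebra X)"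
    "- f \<in> carrier (free_algebra X)"
    "f * g \<in> carrier (free_algebra X)" "scale c f \<in> carrier (free_algebra X)"
proof -
  show "f + g \<in> carrier (free_algebra X)"
    using assms Poly_Mapping.keys_add[of f g] by (auto simp: in_free_algebra)
  show "f - g \<in> carrier (free_algebra X)"
    using assms Poly_Mapping.keys_diff[of f g] by (auto simp: in_free_algebra)
  show "- f \<in> carrier (free_algebra X)"
    using assms by (auto simp: in_free_algebra)
  show "f * g \<in> carrier (free_algebra X)"
    using assms Poly_Mapping.keys_mult[of f g] by (fastforce simp: in_free_algebra)
  show "scale c f \<in> carrier (free_algebra X)"
    using assms by (auto simp: in_free_algebra Poly_Mapping.in_keys_iff lookup_scale)
qed

lemma zero_in_free_algebra: "0 \<in> carrier (free_algebra X)"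
  by (simp add: in_free_algebra)

lemma word_single_in_free_algebra: "x \<in> X \<Longrightarrow> word_single x \<in> carrier (free_algebra X)"
  by (simp add: in_free_algebra word_single_def)

lemma scale_minus_one: "scale (- 1) f = - f"
  by (rule poly_mapping_eqI) (simp add: lookup_scale)

lemma nonunital_ring_free_algebra:
  fixes X :: "'x set"
  shows "nonunital_ring (free_algebra X :: ('k::field, 'x free_monoid \<Rightarrow>\<^sub>0 'k) module)"
    (is "nonunital_ring ?F")
proof -
  have "abelian_group ?F"
  proof (rule abelian_groupI)
    fix f assume "f \<in> carrier ?F"
    then show "\<exists>g\<in>carrier ?F. g \<oplus>\<^bsub>?F\<^esub> f = \<zero>\<^bsub>?F\<^esub>"
      by (intro bexI[of _ "- f"]) (simp_all add: free_algebra_closed)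
  qed (simp_all add: free_algebra_closed zero_in_free_algebra add_ac)
  then show ?thesis
    by (simp add: nonunital_ring_def nonunital_ring_axioms_def free_algebra_closed mult.assoc
        distrib_left distrib_right)
qed

lemma algebra_ideal_subset:
  assumes "S \<subseteq> carrier (free_algebra X)"
  shows "algebra_ideal X S \<subseteq> carrier (free_algebra X)"
proof
  fix f assume "f \<in> algebra_ideal X S"
  then show "f \<in> carrier (free_algebra X)"
    by induction (use assms in \<open>auto simp: free_algebra_closed zero_in_free_algebra\<close>)
qed

lemma abelian_subgroup_algebra_ideal:
  assumes "S \<subseteq> carrier (free_algebra X)"
  shows "abelian_subgroup (algebra_ideal X S) (free_algebra X)"
proof -
  interpret F: nonunital_ring "free_algebra X :: ('b, 'a free_monoid \<Rightarrow>\<^sub>0 'b) module"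
    by (rule nonunital_ring_free_algebra)
  have minus: "\<ominus>\<^bsub>free_algebra X\<^esub> f = - f" if "f \<in> carrier (free_algebra X)" 
    for f :: "'a free_monoid \<Rightarrow>\<^sub>0 'b"
    using F.minus_equality[of "- f" f] that by (simp add: free_algebra_closed)
  have "subgroup (algebra_ideal X S) (add_monoid (free_algebra X))"
  proof (rule F.add.subgroupI)
    show "algebra_ideal X S \<noteq> {}" using algebra_ideal.zero by blast
  next
    fix f assume "f \<in> algebra_ideal X S"
    then show "\<ominus>\<^bsub>free_algebra X\<^esub> f \<in> algebra_ideal X S"
      using algebra_ideal.scale[of f X S "- 1"] algebra_ideal_subset[OF assms]
      by (auto simp: scale_minus_one minus)
  qed (use algebra_ideal_subset[OF assms] in \<open>auto intro: algebra_ideal.add\<close>)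
  then show ?thesis
    by (intro abelian_subgroupI3 additive_subgroup.intro F.abelian_group_axioms)
qed

lemma presented_algebra_sel:
  "carrier (presented_algebra X S) = a_rcosets\<^bsub>free_algebra X\<^esub> (algebra_ideal X S)"
  "mult (presented_algebra X S) = rcoset_mult (free_algebra X) (algebra_ideal X S)"
  "zero (presented_algebra X S) = algebra_ideal X S"
  "add (presented_algebra X S) = set_add (free_algebra X)"
  "smult (presented_algebra X S) =
     (\<lambda>c A. \<Union>f\<in>A. algebra_ideal X S +>\<^bsub>free_algebra X\<^esub> scale c f)"
  by (simp_all add: presented_algebra_def Let_def ring.extend_def module.fields_def FactRing_def)

lemma presented_algebra_ops:
  fixes X :: "'x set" and S :: "('x free_monoid \<Rightarrow>\<^sub>0 'k::field) set"
  defines "F \<equiv> free_algebra X" and "I \<equiv> algebra_ideal X S" and "L \<equiv> presented_algebra X S"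
  assumes S: "S \<subseteq> carrier (free_algebra X)"
    and f: "f \<in> carrier F" and g: "g \<in> carrier F"
  shows "(I +>\<^bsub>F\<^esub> f) \<oplus>\<^bsub>L\<^esub> (I +>\<^bsub>F\<^esub> g) = I +>\<^bsub>F\<^esub> (f + g)"
    and "(I +>\<^bsub>F\<^esub> f) \<otimes>\<^bsub>L\<^esub> (I +>\<^bsub>F\<^esub> g) = I +>\<^bsub>F\<^esub> (f * g)"
    and "c \<odot>\<^bsub>L\<^esub> (I +>\<^bsub>F\<^esub> f) = I +>\<^bsub>F\<^esub> scale c f"
    and "\<zero>\<^bsub>L\<^esub> = I +>\<^bsub>F\<^esub> 0"
proof -
  interpret I: abelian_subgroup I F
    unfolding F_def I_def by (rule abelian_subgroup_algebra_ideal[OF S])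
  have sub: "I \<subseteq> carrier F"
    unfolding F_def I_def by (rule algebra_ideal_subset[OF S])
  have coset: "I +>\<^bsub>F\<^esub> h = (\<lambda>i. i + h) ` I" for h
    by (auto simp: a_r_coset_def' F_def)
  have le: "I +>\<^bsub>F\<^esub> h \<subseteq> I +>\<^bsub>F\<^esub> h'" if "h - h' \<in> I" for h h'
  proof
    fix x assume "x \<in> I +>\<^bsub>F\<^esub> h"
    then obtain i where i: "i \<in> I" "x = i + h" by (auto simp: coset)
    then have "i + (h - h') \<in> I" "x = (i + (h - h')) + h'"
      using that by (simp_all add: I_def algebra_ideal.add)
    then show "x \<in> I +>\<^bsub>F\<^esub> h'" unfolding coset by (rule rev_image_eqI)
  qed
  have eq: "I +>\<^bsub>F\<^esub> h = I +>\<^bsub>F\<^esub> h'" if "h - h' \<in> I" for h h'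
  proof -
    have "h' - h \<in> I"
      using algebra_ideal.scale[of "h - h'" X S "- 1"] that by (simp add: I_def scale_minus_one)
    with that show ?thesis
      by (intro equalityI le)
  qed
  have self: "h \<in> I +>\<^bsub>F\<^esub> h" for h
    unfolding coset using algebra_ideal.zero[of X S] by (intro rev_image_eqI[of 0]) (simp_all add: I_def)
  show "(I +>\<^bsub>F\<^esub> f) \<oplus>\<^bsub>L\<^esub> (I +>\<^bsub>F\<^esub> g) = I +>\<^bsub>F\<^esub> (f + g)"
    using I.a_rcos_sum[OF f g] by (simp add: L_def presented_algebra_sel F_def)
  show "\<zero>\<^bsub>L\<^esub> = I +>\<^bsub>F\<^esub> 0"
    by (simp add: L_def presented_algebra_sel I_def coset[unfolded I_def])
  have "I +>\<^bsub>F\<^esub> (f' * g') = I +>\<^bsub>F\<^esub> (f * g)" if "f' \<in> I +>\<^bsub>F\<^esub> f" "g' \<in> I +>\<^bsub>F\<^esub> g" for f' g'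
  proof (rule eq)
    from that obtain i j where i: "i \<in> I" "f' = i + f" and j: "j \<in> I" "g' = j + g"
      by (auto simp: coset)
    have "i * (j + g) + f * j \<in> I"
      using i j f g sub unfolding I_def F_def
      by (intro algebra_ideal.add algebra_ideal.right algebra_ideal.left free_algebra_closed) auto
    then show "f' * g' - f * g \<in> I"
      by (simp add: i j algebra_simps)
  qed
  then have "(\<Union>f'\<in>I +>\<^bsub>F\<^esub> f. \<Union>g'\<in>I +>\<^bsub>F\<^esub> g. I +>\<^bsub>F\<^esub> (f' * g')) = I +>\<^bsub>F\<^esub> (f * g)"
    using self[of f] self[of g] by blast
  then show "(I +>\<^bsub>F\<^esub> f) \<otimes>\<^bsub>L\<^esub> (I +>\<^bsub>F\<^esub> g) = I +>\<^bsub>F\<^esub> (f * g)"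
    by (simp add: L_def presented_algebra_sel rcoset_mult_def F_def I_def)
  have "I +>\<^bsub>F\<^esub> scale c f' = I +>\<^bsub>F\<^esub> scale c f" if "f' \<in> I +>\<^bsub>F\<^esub> f" for f'
  proof (rule eq)
    from that obtain i where i: "i \<in> I" "f' = i + f"
      by (auto simp: coset)
    then have "scale c i \<in> I"
      by (simp add: I_def algebra_ideal.scale)
    then show "scale c f' - scale c f \<in> I"
      by (simp add: i scale_def algebra_simps)
  qed
  then have "(\<Union>f'\<in>I +>\<^bsub>F\<^esub> f. I +>\<^bsub>F\<^esub> scale c f') = I +>\<^bsub>F\<^esub> scale c f"
    using self[of f] by blast
  then show "c \<odot>\<^bsub>L\<^esub> (I +>\<^bsub>F\<^esub> f) = I +>\<^bsub>F\<^esub> scale c f"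
    by (simp add: L_def presented_algebra_sel F_def I_def)
qed

lemma carrier_presented_algebra:
  "carrier (presented_algebra X S) =
     (\<lambda>f. algebra_ideal X S +>\<^bsub>free_algebra X\<^esub> f) ` carrier (free_algebra X)"
  by (auto simp: presented_algebra_sel A_RCOSETS_def' )

lemma nonunital_ring_presented_algebra:
  assumes S: "S \<subseteq> carrier (free_algebra X)"
  shows "nonunital_ring (presented_algebra X S)"
proof -
  note ops = presented_algebra_ops(1-3)[OF S]
    presented_algebra_ops(4)[OF S zero_in_free_algebra zero_in_free_algebra]
  have "abelian_group (presented_algebra X S)"
  proof (rule abelian_groupI)
    fix A assume "A \<in> carrier (presented_algebra X S)"
    then obtain f where f: "f \<in> carrier (free_algebra X)"
      "A = algebra_ideal X S +>\<^bsub>free_algebra X\<^esub> f" by (auto simp: carrier_presented_algebra)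
    then show "\<exists>B\<in>carrier (presented_algebra X S).
        B \<oplus>\<^bsub>presented_algebra X S\<^esub> A = \<zero>\<^bsub>presented_algebra X S\<^esub>"
      by (intro bexI[of _ "algebra_ideal X S +>\<^bsub>free_algebra X\<^esub> (- f)"])
        (auto simp: ops free_algebra_closed carrier_presented_algebra)
  qed (auto simp: carrier_presented_algebra ops free_algebra_closed zero_in_free_algebra add_ac)
  then show ?thesis
    unfolding nonunital_ring_def nonunital_ring_axioms_def
    by (auto simp: carrier_presented_algebra ops free_algebra_closed mult.assoc
        distrib_left distrib_right)
qed

lemma leavitt_relators_subset:
  assumes "ultragraph G"
  shows "leavitt_relators G \<subseteq> carrier (free_algebra (leavitt_gens G))"
proof
  interpret ultragraph G by fact
  let ?F = "carrier (free_algebra (leavitt_gens G)) :: ('a, 'b, 'c) leavitt_word set"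
  have P: "gP A \<in> ?F" if "A \<in> gen_verts G" for A
    using that by (simp add: gP_def leavitt_gens_def word_single_in_free_algebra)
  have ST: "gS e \<in> ?F" "gT e \<in> ?F" if "e \<in> edges G" for e
    using that by (simp_all add: gS_def gT_def leavitt_gens_def word_single_in_free_algebra)
  have src: "{src G e} \<in> gen_verts G" if "e \<in> edges G" for e
    using that by (intro gen_verts.vertex src_in_verts)
  have sum: "(\<Sum>e\<in>E. gS e * gT e) \<in> ?F" if "finite E" "E \<subseteq> edges G" for E
    using that by (induction) (auto simp: zero_in_free_algebra ST free_algebra_closed)
  fix f :: "('a, 'b, 'c) leavitt_word" assume "f \<in> leavitt_relators G"
  then show "f \<in> ?F"
  proof induction
    case (CK2 v)
    then have "{v} \<in> gen_verts G" "(\<Sum>e\<in>out_edges G v. gS e * gT e) \<in> ?F"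
      by (auto simp: regular_vertex_def out_edges_def intro!: sum gen_verts.vertex)
    then show ?case by (intro free_algebra_closed P)
  next
    case (CK1 e e')
    then show ?case
      by (cases "e = e'") (simp_all add: free_algebra_closed P ST gen_verts.range)
  qed (simp_all add: free_algebra_closed P ST src gen_verts.intros)
qed

lemma nonunital_ring_leavitt_path_algebra:
  "ultragraph G \<Longrightarrow> nonunital_ring (leavitt_path_algebra G)"
  unfolding leavitt_path_algebra_def
  by (intro nonunital_ring_presented_algebra leavitt_relators_subset)

end

theory Submission
  imports Defs
begin

text \<open>A set \<open>X\<close> of boundary paths that is closed under removing and adding a first edge gives a
  representation of the Leavitt path algebra on the functions on \<open>X\<close>. Such a representation is
  faithful as soon as every edge starts, and every sink is, some \<open>x \<in> X\<close> whose extensions \<open>p x\<close>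
  by the words \<open>p\<close> of a given finite set are distinct. For the proof write an element as
  \<open>r + \<Sum>\<^sub>F b\<^sub>e s\<^sub>e\<^sup>*\<close> with \<open>r\<close> free of ghost edges; by induction on the length of the ghost paths it is
  \<open>r (1 - \<Sum>\<^sub>F s\<^sub>e s\<^sub>e\<^sup>*)\<close>, and the values on delta functions determine the coefficients of \<open>r\<close>.

  All boundary paths together with an integer degree form a faithful representation. A primitive
  ring is prime, and \<open>p\<^sub>v a p\<^sub>w \<noteq> 0\<close> yields tail equivalent paths from \<open>v\<close> and \<open>w\<close>, hence downward
  directedness. If a cycle \<open>c\<close> based at \<open>v\<close> has no exit, then \<open>p\<^sub>v L p\<^sub>v\<close> acts by translations on
  \<open>{c\<^sup>\<infinity>} \<times> \<int>\<close>; it is commutative, so primitivity would make it a field, but \<open>p\<^sub>v - s\<^sub>c\<close> is not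
  invertible in it because it kills the constant functions.

  Conversely, downward directedness and countability give a boundary path \<open>q\<close> that every vertex
  reaches. The finitely supported functions on the tail equivalence class of \<open>q\<close> form a simple
  module, which is faithful because exits provide aperiodic paths from every vertex.\<close>


section \<open>Congruence modulo the ideal of relations\<close>

text \<open>The obstacle is that \<open>gen_verts G\<close> contains infinite sets, so a projection
  need not be a sum of vertex projections, and no basis of the algebra is constructed. Combinations
  of projections are compared through their coefficient at each vertex, and a finite set of vertices
  is split off only when the remaining coefficients vanish. Faithfulness is used twice, with
  different means of telling prefixes apart. A degree does it for every ultragraph and serves
  necessity. The module for sufficiency is one tail class without a degree, where separation has to
  be earned from the exits. An element of the algebra involves only finitely many prefixes, so it is
  enough to break the periods up to some bound N, all of which divide N!.\<close>

lemma poly_mapping_expand: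
  fixes f :: "'a \<Rightarrow>\<^sub>0 'b::comm_monoid_add"
  shows "f = (\<Sum>w\<in>Poly_Mapping.keys f. Poly_Mapping.single w (Poly_Mapping.lookup f w))"
proof (rule poly_mapping_eqI)
  fix k
  have "(\<Sum>w\<in>Poly_Mapping.keys f. Poly_Mapping.lookup (Poly_Mapping.single w (Poly_Mapping.lookup f w)) k)
      = (\<Sum>w\<in>Poly_Mapping.keys f. if w = k then Poly_Mapping.lookup f w else 0)"
    by (intro sum.cong) (auto simp: lookup_single when_def)
  then show "Poly_Mapping.lookup f k = Poly_Mapping.lookup
      (\<Sum>w\<in>Poly_Mapping.keys f. Poly_Mapping.single w (Poly_Mapping.lookup f w)) k"
    by (simp add: lookup_sum in_keys_iff)
qed

lemma poly_mapping_induct [case_names zero single add]: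
  fixes f :: "'a \<Rightarrow>\<^sub>0 'b::comm_monoid_add"
  assumes "P 0" "\<And>w c. P (Poly_Mapping.single w c)" "\<And>f g. P f \<Longrightarrow> P g \<Longrightarrow> P (f + g)"
  shows "P f"
proof -
  have "P (\<Sum>w\<in>W. Poly_Mapping.single w (Poly_Mapping.lookup f w))" if "finite W" for W
    using that by induction (use assms in auto)
  then show ?thesis
    by (subst poly_mapping_expand) simp
qed

lemma scale_one [simp]: "scale 1 f = f"
  by (simp add: scale_def)

lemma scale_zero [simp]: "scale 0 f = 0" "scale c 0 = 0"
  by (simp_all add: scale_def)

lemma scale_scale: "scale c (scale d f) = scale (c * d) f"
  by (simp add: scale_def mult.assoc[symmetric] mult_single)

lemma scale_add_right: "scale c (f + g) = scale c f + scale c g"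
  by (simp add: scale_def distrib_left)

lemma scale_add_left: "scale (c + d) f = scale c f + scale d f"
  by (simp add: scale_def single_add distrib_right)

lemma scale_mult_left: "scale c f * g = scale c (f * g)"
  by (simp add: scale_def mult.assoc)

text \<open>Scalars are central although words do not commute: a constant sits on the empty
  word.\<close>

lemma scale_mult_right: "f * scale c g = scale c (f * g)"
proof -
  have "f * Poly_Mapping.single 0 c = Poly_Mapping.single 0 c * f"
    by (induction f rule: poly_mapping_induct)
      (simp_all add: mult_single mult.commute distrib_left distrib_right)
  then show ?thesis
    unfolding scale_def by (metis mult.assoc)
qed

lemma scale_single: "scale c (Poly_Mapping.single w d) = Poly_Mapping.single w (c * d)"
  by (simp add: scale_def mult_single)

text \<open>The unital free algebra on \<open>X\<close>; closing the ideal under multiplication by its elements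
  costs nothing, and it contains the constants and the empty products.\<close>

definition unital_words :: "'x set \<Rightarrow> ('x free_monoid \<Rightarrow>\<^sub>0 'k::field) set" where
  "unital_words X = {f. \<forall>w\<in>Poly_Mapping.keys f. set (letters w) \<subseteq> X}"

lemma unital_words_closed:
  "0 \<in> unital_words X" "1 \<in> unital_words X"
  "f \<in> unital_words X \<Longrightarrow> g \<in> unital_words X \<Longrightarrow> f + g \<in> unital_words X"
  "f \<in> unital_words X \<Longrightarrow> g \<in> unital_words X \<Longrightarrow> f - g \<in> unital_words X"
  "f \<in> unital_words X \<Longrightarrow> g \<in> unital_words X \<Longrightarrow> f * g \<in> unital_words X"
  "f \<in> unital_words X \<Longrightarrow> scale c f \<in> unital_words X"
proof -
  show "f + g \<in> unital_words X" if "f \<in> unital_words X" "g \<in> unital_words X"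
    using that Poly_Mapping.keys_add[of f g] by (auto simp: unital_words_def)
  show "f - g \<in> unital_words X" if "f \<in> unital_words X" "g \<in> unital_words X"
    using that Poly_Mapping.keys_diff[of f g] by (auto simp: unital_words_def)
  show "f * g \<in> unital_words X" if "f \<in> unital_words X" "g \<in> unital_words X"
    using that Poly_Mapping.keys_mult[of f g] by (fastforce simp: unital_words_def)
  show "scale c f \<in> unital_words X" if "f \<in> unital_words X"
    using that by (auto simp: unital_words_def in_keys_iff lookup_scale)
qed (auto simp: unital_words_def)

lemma sum_unital_words: "(\<And>i. i \<in> A \<Longrightarrow> f i \<in> unital_words X) \<Longrightarrow> sum f A \<in> unital_words X"
  by (induction A rule: infinite_finite_induct) (auto simp: unital_words_closed)

lemma free_algebra_unital: "f \<in> carrier (free_algebra X) \<Longrightarrow> f \<in> unital_words X"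
  by (simp add: in_free_algebra unital_words_def)

lemma unital_words_split:
  assumes "h \<in> unital_words X"
  obtains c h' where "h = Poly_Mapping.single 0 c + h'" "h' \<in> carrier (free_algebra X)"
proof
  let ?h = "h - Poly_Mapping.single 0 (Poly_Mapping.lookup h 0)"
  show "h = Poly_Mapping.single 0 (Poly_Mapping.lookup h 0) + ?h"
    by simp
  have "w \<in> Poly_Mapping.keys h \<and> w \<noteq> 0" if "w \<in> Poly_Mapping.keys ?h" for w
    using that by (auto simp: in_keys_iff lookup_minus lookup_single when_def split: if_splits)
  then show "?h \<in> carrier (free_algebra X)"
    using assms unfolding unital_words_def in_free_algebra
    by (metis (mono_tags, lifting) free_monoid.expand letters_zero mem_Collect_eq)
qed

lemma algebra_ideal_mult_unital:
  assumes "f \<in> algebra_ideal X S" "h \<in> unital_words X"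
  shows "h * f \<in> algebra_ideal X S" "f * h \<in> algebra_ideal X S"
proof -
  obtain c h' where h: "h = Poly_Mapping.single 0 c + h'" "h' \<in> carrier (free_algebra X)"
    using unital_words_split[OF assms(2)] .
  have "h * f = scale c f + h' * f" "f * h = scale c f + f * h'"
    using scale_mult_right[of f c 1] by (simp_all add: h distrib_left distrib_right scale_def)
  then show "h * f \<in> algebra_ideal X S" "f * h \<in> algebra_ideal X S"
    using assms h by (auto intro: algebra_ideal.intros)
qed

section \<open>The Leavitt relations as congruences\<close>

context ultragraph
begin

definition cong (infix "\<approx>" 50) where
  "f \<approx> g \<longleftrightarrow> f - g \<in> algebra_ideal (leavitt_gens G) (leavitt_relators G)"

abbreviation U where "U \<equiv> unital_words (leavitt_gens G)"

lemma cong_refl [simp, intro]: "f \<approx> f"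
  by (simp add: cong_def algebra_ideal.zero)

lemma cong_sym: "f \<approx> g \<Longrightarrow> g \<approx> f"
  using algebra_ideal.scale[of "f - g" _ _ "- 1"] by (simp add: cong_def scale_minus_one)

lemma cong_add: "f \<approx> f' \<Longrightarrow> g \<approx> g' \<Longrightarrow> f + g \<approx> f' + g'"
  using algebra_ideal.add[of "f - f'" _ _ "g - g'"] by (simp add: cong_def algebra_simps)

lemma cong_trans [trans]: "f \<approx> g \<Longrightarrow> g \<approx> h \<Longrightarrow> f \<approx> h"
  using algebra_ideal.add[of "f - g" _ _ "g - h"] by (simp add: cong_def)

lemma cong_eq_trans [trans]: "f \<approx> g \<Longrightarrow> g = h \<Longrightarrow> f \<approx> h" "f = g \<Longrightarrow> g \<approx> h \<Longrightarrow> f \<approx> h"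
  by simp_all

lemma cong_scale: "f \<approx> g \<Longrightarrow> scale c f \<approx> scale c g"
  using algebra_ideal.scale[of "f - g" _ _ c] by (simp add: cong_def scale_def right_diff_distrib)

lemma cong_diff: "f \<approx> f' \<Longrightarrow> g \<approx> g' \<Longrightarrow> f - g \<approx> f' - g'"
  using cong_add[OF _ cong_scale[of g g' "- 1"]] by (fastforce simp: scale_minus_one)

lemma cong_mult_left: "f \<approx> g \<Longrightarrow> h \<in> U \<Longrightarrow> h * f \<approx> h * g"
  using algebra_ideal_mult_unital(1)[of "f - g" _ _ h] by (simp add: cong_def right_diff_distrib)

lemma cong_mult_right: "f \<approx> g \<Longrightarrow> h \<in> U \<Longrightarrow> f * h \<approx> g * h"
  using algebra_ideal_mult_unital(2)[of "f - g" _ _ h] by (simp add: cong_def left_diff_distrib)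

lemma cong_sum: "(\<And>i. i \<in> A \<Longrightarrow> f i \<approx> g i) \<Longrightarrow> sum f A \<approx> sum g A"
  by (induction A rule: infinite_finite_induct) (auto intro: cong_add)

lemma gens_in_U [simp]:
  "A \<in> gen_verts G \<Longrightarrow> gP A \<in> U" "e \<in> edges G \<Longrightarrow> gS e \<in> U" "e \<in> edges G \<Longrightarrow> gT e \<in> U"
  by (auto simp: gP_def gS_def gT_def leavitt_gens_def
      intro!: free_algebra_unital word_single_in_free_algebra)

lemma src_gen_verts [simp]: "e \<in> edges G \<Longrightarrow> {src G e} \<in> gen_verts G"
  by (intro gen_verts.vertex src_in_verts)

lemma gen_verts_subset: "A \<in> gen_verts G \<Longrightarrow> A \<subseteq> verts G"
  by (induction rule: gen_verts.induct) (use rng_subset_verts in auto)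

lemma cong_relator: "f - g \<in> leavitt_relators G \<Longrightarrow> f \<approx> g"
  by (simp add: cong_def algebra_ideal.gen)

lemma P_empty: "gP {} \<approx> 0"
  by (rule cong_relator) (simp add: leavitt_relators.P_empty)

lemma P_inter: "A \<in> gen_verts G \<Longrightarrow> B \<in> gen_verts G \<Longrightarrow> gP A * gP B \<approx> gP (A \<inter> B)"
  by (rule cong_relator) (rule leavitt_relators.P_inter)

lemma P_disjoint_union:
  assumes "A \<in> gen_verts G" "B \<in> gen_verts G" "A \<inter> B = {}"
  shows "gP (A \<union> B) \<approx> gP A + gP B"
proof -
  have "gP (A \<union> B) \<approx> gP A + gP B - gP (A \<inter> B)"
    using assms by (intro cong_relator leavitt_relators.P_union)
  also have "gP A + gP B - gP (A \<inter> B) \<approx> gP A + gP B - 0"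
    using P_empty by (intro cong_diff) (simp_all add: assms)
  finally show ?thesis by simp
qed

lemma S_source: "e \<in> edges G \<Longrightarrow> gP {src G e} * gS e \<approx> gS e"
  and S_range: "e \<in> edges G \<Longrightarrow> gS e * gP (rng G e) \<approx> gS e"
  and T_range: "e \<in> edges G \<Longrightarrow> gP (rng G e) * gT e \<approx> gT e"
  and T_source: "e \<in> edges G \<Longrightarrow> gT e * gP {src G e} \<approx> gT e"
  and CK1: "e \<in> edges G \<Longrightarrow> f \<in> edges G \<Longrightarrow> gT e * gS f \<approx> (if e = f then gP (rng G e) else 0)"
  and CK2: "regular_vertex G v \<Longrightarrow> gP {v} \<approx> (\<Sum>e\<in>out_edges G v. gS e * gT e)"
  by (intro cong_relator leavitt_relators.intros; assumption)+

lemma P_mult_S: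
  assumes "A \<in> gen_verts G" "e \<in> edges G"
  shows "gP A * gS e \<approx> (if src G e \<in> A then gS e else 0)"
proof -
  have "gP A * gS e \<approx> gP A * (gP {src G e} * gS e)"
    using assms by (intro cong_mult_left cong_sym[OF S_source]) auto
  also have "\<dots> = gP A * gP {src G e} * gS e"
    by (simp add: mult.assoc)
  also have "\<dots> \<approx> gP (A \<inter> {src G e}) * gS e"
    using assms by (intro cong_mult_right P_inter) auto
  also have "\<dots> \<approx> (if src G e \<in> A then gS e else 0)"
  proof (cases "src G e \<in> A")
    case True
    then show ?thesis using S_source[OF assms(2)] by (simp add: Int_absorb1)
  next
    case False
    then show ?thesis using cong_mult_right[OF P_empty, of "gS e"] assms by simp
  qed
  finally show ?thesis .
qed

lemma T_mult_P:
  assumes "A \<in> gen_verts G" "e \<in> edges G"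
  shows "gT e * gP A \<approx> (if src G e \<in> A then gT e else 0)"
proof -
  have "gT e * gP A \<approx> gT e * gP {src G e} * gP A"
    using assms by (intro cong_mult_right cong_sym[OF T_source]) auto
  also have "\<dots> = gT e * (gP {src G e} * gP A)"
    by (simp add: mult.assoc)
  also have "\<dots> \<approx> gT e * gP ({src G e} \<inter> A)"
    using assms by (intro cong_mult_left P_inter) auto
  also have "\<dots> \<approx> (if src G e \<in> A then gT e else 0)"
  proof (cases "src G e \<in> A")
    case True
    then show ?thesis using T_source[OF assms(2)] by (simp add: Int_absorb1 Int_absorb2)
  next
    case False
    then show ?thesis using cong_mult_left[OF P_empty, of "gT e"] assms by simp
  qed
  finally show ?thesis .
qed


subsection \<open>Combinations of the projections\<close>

text \<open>Lists allow overlapping and repeated sets, so addition is concatenation and no disjoint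
  refinement has to be chosen in advance.\<close>

definition proj_comb :: "('k \<times> 'v set) list \<Rightarrow> ('v, 'e, 'k::field) leavitt_word" where
  "proj_comb l = (\<Sum>(k, A)\<leftarrow>l. scale k (gP A))"

text \<open>With overlapping sets the listed scalars are not invariants of the element; this
  function on vertices is what its action sees (\<open>act_proj_comb\<close>).\<close>

definition proj_val :: "('k \<times> 'v set) list \<Rightarrow> 'v \<Rightarrow> 'k::field" where
  "proj_val l v = (\<Sum>(k, A)\<leftarrow>l. if v \<in> A then k else 0)"

lemma proj_comb_simps [simp]:
  "proj_comb [] = 0" "proj_comb (x # l) = scale (fst x) (gP (snd x)) + proj_comb l"
  "proj_comb (l @ l') = proj_comb l + proj_comb l'"
  by (simp_all add: proj_comb_def split: prod.split)

lemma proj_val_simps [simp]: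
  "proj_val [] v = 0" "proj_val (x # l) v = (if v \<in> snd x then fst x else 0) + proj_val l v"
  by (simp_all add: proj_val_def split: prod.split)

lemma proj_comb_U: "\<forall>x\<in>set l. snd x \<in> gen_verts G \<Longrightarrow> proj_comb l \<in> U"
  by (induction l) (auto simp: unital_words_closed)

text \<open>Split \<open>B\<close> along the first set \<open>A\<close> of the list: the rest is
  constant on \<open>B \<inter> A\<close> with value \<open>c - k\<close> and on
  \<open>B - A\<close> with value \<open>c\<close>. Hence the induction ranges over all
  \<open>B\<close> and \<open>c\<close>.\<close>

lemma proj_comb_mult_P:
  fixes l :: "('k::field \<times> 'v set) list"
  assumes "\<forall>x\<in>set l. snd x \<in> gen_verts G" "B \<in> gen_verts G" "\<And>v. v \<in> B \<Longrightarrow> proj_val l v = c"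
  shows "proj_comb l * gP B \<approx> scale c (gP B)"
  using assms
proof (induction l arbitrary: B c)
  case Nil
  \<comment> \<open>Either \<open>c = 0\<close>, being the empty sum at some vertex of
    \<open>B\<close>, or \<open>B\<close> is empty, where \<open>c\<close> is arbitrary but the
    projection is congruent to 0.\<close>
  then show ?case
    using cong_sym[OF cong_scale[OF P_empty, of c]] by (cases "B = {}") auto
next
  case (Cons x l)
  obtain k A where x: "x = (k, A)" by (cases x)
  have A: "A \<in> gen_verts G" and l: "\<forall>x\<in>set l. snd x \<in> gen_verts G"
    using Cons.prems x by auto
  let ?C = "B \<inter> A" and ?D = "B - A"
  have CD: "?C \<in> gen_verts G" "?D \<in> gen_verts G"
    using Cons.prems A by (auto intro: gen_verts.intros)
  have split: "(gP B :: ('v, 'e, 'k) leavitt_word) \<approx> gP ?C + gP ?D"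
    using P_disjoint_union[OF CD] by (simp add: Int_Diff Diff_Int_distrib Int_Diff_Un)
  have "proj_comb l * gP B \<approx> proj_comb l * (gP ?C + gP ?D)"
    by (intro cong_mult_left split proj_comb_U l)
  also have "\<dots> = proj_comb l * gP ?C + proj_comb l * gP ?D"
    by (rule distrib_left)
  also have "\<dots> \<approx> scale (c - k) (gP ?C) + scale c (gP ?D)"
  proof (rule cong_add)
    show "proj_comb l * gP ?C \<approx> scale (c - k) (gP ?C)"
      using Cons.prems(3) x by (intro Cons.IH l CD) (force simp: algebra_simps)
    show "proj_comb l * gP ?D \<approx> scale c (gP ?D)"
      using Cons.prems(3) x by (intro Cons.IH l CD) force
  qed
  finally have rest: "proj_comb l * gP B \<approx> scale (c - k) (gP ?C) + scale c (gP ?D)" .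
  have "scale k (gP A) * gP B \<approx> scale k (gP ?C)"
    using cong_scale[OF P_inter[OF A Cons.prems(2)], of k] by (simp add: scale_mult_left Int_commute)
  from cong_add[OF this rest] have "proj_comb (x # l) * gP B
      \<approx> scale k (gP ?C) + (scale (c - k) (gP ?C) + scale c (gP ?D))"
    by (simp add: x distrib_right)
  also have "\<dots> = scale c (gP ?C + gP ?D)"
    by (simp add: scale_add_right add.assoc[symmetric] flip: scale_add_left)
  also have "\<dots> \<approx> scale c (gP B)"
    by (intro cong_scale cong_sym[OF split])
  finally show ?case .
qed

lemma finite_gen_verts: "finite W \<Longrightarrow> W \<subseteq> verts G \<Longrightarrow> W \<in> gen_verts G"
proof (induction W rule: finite_induct)
  case (insert w W)
  then have "{w} \<union> W \<in> gen_verts G" by (intro gen_verts.union gen_verts.vertex) auto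
  then show ?case by simp
qed (rule gen_verts.empty)

lemma P_finite:
  "finite W \<Longrightarrow> W \<subseteq> verts G \<Longrightarrow> (gP W :: ('v, 'e, 'k::field) leavitt_word) \<approx> (\<Sum>w\<in>W. gP {w})"
proof (induction W rule: finite_induct)
  case (insert w W)
  have "(gP ({w} \<union> W) :: ('v, 'e, 'k) leavitt_word) \<approx> gP {w} + gP W"
    using insert by (intro P_disjoint_union finite_gen_verts gen_verts.vertex) auto
  also have "\<dots> \<approx> gP {w} + (\<Sum>w\<in>W. gP {w})"
    using insert by (intro cong_add) auto
  finally show ?case using insert by simp
qed (simp add: P_empty)

text \<open>There is no identity to decompose, so the union \<open>A\<close> of all sets involved
  serves as a local unit: \<open>gP A\<close> fixes the combination, and \<open>A - W\<close>
  contributes nothing because the coefficients vanish there.\<close>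

lemma proj_comb_finite_support:
  fixes l :: "('k::field \<times> 'v set) list"
  assumes l: "\<forall>x\<in>set l. snd x \<in> gen_verts G" and W: "finite W" "W \<subseteq> verts G"
    and zero: "\<And>v. v \<in> verts G \<Longrightarrow> v \<notin> W \<Longrightarrow> proj_val l v = 0"
  shows "proj_comb l \<approx> (\<Sum>w\<in>W. scale (proj_val l w) (gP {w}))"
proof -
  have fold: "foldr (\<union>) As {} \<in> gen_verts G" if "set As \<subseteq> gen_verts G" for As
    using that by (induction As) (auto intro: gen_verts.intros)
  define A where "A = \<Union> (snd ` set l) \<union> W"
  have "\<Union> (snd ` set l) = foldr (\<union>) (map snd l) {}"
    by (induction l) auto
  then have "\<Union> (snd ` set l) \<in> gen_verts G"
    using fold[of "map snd l"] l by auto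
  then have A: "A \<in> gen_verts G" "A - W \<in> gen_verts G" "W \<in> gen_verts G" "(A - W) \<union> W = A"
    unfolding A_def using W by (auto intro: gen_verts.intros finite_gen_verts)
  have sub: "\<forall>x\<in>set l. snd x \<in> gen_verts G \<and> snd x \<subseteq> A"
    using l by (auto simp: A_def)
  then have "proj_comb l * gP A \<approx> proj_comb l"
  proof (induction l)
    case (Cons x l)
    have "(gP (snd x) * gP A :: ('v, 'e, 'k) leavitt_word) \<approx> gP (snd x)"
      using P_inter[of "snd x" A] Cons.prems A by (simp add: Int_absorb2)
    then show ?case
      using Cons by (simp add: distrib_right scale_mult_left cong_add cong_scale)
  qed simp
  then have "proj_comb l \<approx> proj_comb l * gP A"
    by (rule cong_sym)
  also have "proj_comb l * gP A \<approx> proj_comb l * (gP (A - W) + gP W)"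
    using P_disjoint_union[OF A(2,3)] A(4) l by (intro cong_mult_left proj_comb_U) auto
  also have "\<dots> = proj_comb l * gP (A - W) + proj_comb l * gP W"
    by (simp add: distrib_left)
  also have "\<dots> \<approx> scale 0 (gP (A - W)) + proj_comb l * (\<Sum>w\<in>W. gP {w})"
    using zero A l W gen_verts_subset[OF A(1)]
    by (intro cong_add proj_comb_mult_P cong_mult_left P_finite proj_comb_U) auto
  also have "\<dots> = (\<Sum>w\<in>W. proj_comb l * gP {w})"
    by (simp add: sum_distrib_left)
  also have "\<dots> \<approx> (\<Sum>w\<in>W. scale (proj_val l w) (gP {w}))"
    using W l by (intro cong_sum proj_comb_mult_P gen_verts.vertex) auto
  finally show ?thesis .
qed

end


section \<open>Normal forms\<close>

lemma epath_Cons: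
  "epath G (e # p) \<longleftrightarrow> e \<in> edges G \<and> (p = [] \<or> epath G p \<and> src G (hd p) \<in> rng G e)"
proof (cases p)
  case (Cons f q)
  have all_split: "(\<forall>i. Q i) \<longleftrightarrow> Q 0 \<and> (\<forall>i. Q (Suc i))" for Q
    by (metis nat.exhaust)
  have "(\<forall>i. Suc i < length (e # p) \<longrightarrow> src G ((e # p) ! Suc i) \<in> rng G ((e # p) ! i)) \<longleftrightarrow>
      src G f \<in> rng G e \<and> (\<forall>i. Suc i < length p \<longrightarrow> src G (p ! Suc i) \<in> rng G (p ! i))"
    using Cons by (subst all_split) simp
  then show ?thesis
    using Cons by (auto simp: epath_def)
qed (simp add: epath_def)

lemma epath_append:
  "p \<noteq> [] \<Longrightarrow> q \<noteq> [] \<Longrightarrow>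
    epath G (p @ q) \<longleftrightarrow> epath G p \<and> epath G q \<and> src G (hd q) \<in> rng G (last p)"
  by (induction p) (auto simp: epath_Cons)

context ultragraph
begin

section \<open>Elements without ghost edges\<close>

definition walk :: "'e list \<Rightarrow> bool" where
  "walk p \<longleftrightarrow> p = [] \<or> epath G p"

text \<open>The value at the empty list makes \<open>A \<subseteq> target p\<close> automatic for
  \<open>A\<close> in \<open>gen_verts G\<close>, so paths of length 0 need no separate
  treatment.\<close>

definition target :: "'e list \<Rightarrow> 'v set" where
  "target p = (if p = [] then verts G else rng G (last p))"

lemma walk_Nil [simp]: "walk []"
  by (simp add: walk_def)

lemma walk_snoc: "walk (p @ [e]) \<longleftrightarrow> walk p \<and> e \<in> edges G \<and> src G e \<in> target p"
  using src_in_verts by (cases "p = []") (auto simp: walk_def epath_append target_def epath_Cons)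

lemma walk_Cons: "walk (e # p) \<Longrightarrow> e \<in> edges G \<and> walk p"
  by (auto simp: walk_def epath_Cons)

text \<open>The empty product is the 1 of the unital free algebra, which is not a word of positive
  length; this is why products are taken in \<open>U\<close>.\<close>

definition edge_prod :: "'e list \<Rightarrow> ('v, 'e, 'k::field) leavitt_word" where
  "edge_prod p = prod_list (map gS p)"

lemma edge_prod_simps [simp]:
  "edge_prod [] = 1" "edge_prod (e # p) = gS e * edge_prod p"
  "edge_prod (p @ q) = edge_prod p * edge_prod q"
  by (simp_all add: edge_prod_def)

lemma edge_prod_U: "walk p \<Longrightarrow> edge_prod p \<in> U"
  by (induction p) (auto simp: unital_words_closed dest: walk_Cons)

text \<open>Saturation under \<open>\<approx>\<close> lets relations be applied inside the span.
  Staying in \<open>U\<close> is what the multiplication rules for \<open>\<approx>\<close>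
  require.\<close>

inductive_set real_elems :: "('v, 'e, 'k::field) leavitt_word set" where
  zero: "0 \<in> real_elems"
| mono: "walk p \<Longrightarrow> A \<in> gen_verts G \<Longrightarrow> A \<subseteq> target p \<Longrightarrow>
    scale k (edge_prod p * gP A) \<in> real_elems"
| add: "f \<in> real_elems \<Longrightarrow> g \<in> real_elems \<Longrightarrow> f + g \<in> real_elems"
| congr: "f \<in> real_elems \<Longrightarrow> f \<approx> g \<Longrightarrow> g \<in> U \<Longrightarrow> g \<in> real_elems"

lemma real_elems_U: "f \<in> real_elems \<Longrightarrow> f \<in> U"
  by (induction rule: real_elems.induct)
    (auto intro!: unital_words_closed edge_prod_U gens_in_U)

lemma real_elems_mult_P:
  fixes f :: "('v, 'e, 'k::field) leavitt_word"
  assumes "f \<in> real_elems" "B \<in> gen_verts G"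
  shows "f * gP B \<in> real_elems"
  using assms(1)
proof induction
  case (mono p A k)
  have "scale k (edge_prod p * gP (A \<inter> B)) \<approx> scale k (edge_prod p * (gP A * gP B))"
    using mono assms by (intro cong_scale cong_mult_left cong_sym[OF P_inter] edge_prod_U)
  then have "scale k (edge_prod p * gP (A \<inter> B)) \<approx> scale k (edge_prod p * gP A) * gP B"
    by (simp add: scale_mult_left mult.assoc)
  moreover have "scale k (edge_prod p * gP (A \<inter> B)) \<in> real_elems"
    using mono assms by (intro real_elems.mono gen_verts.inter) auto
  moreover have "scale k (edge_prod p * gP A) * gP B \<in> U"
    using mono assms by (intro unital_words_closed edge_prod_U gens_in_U)
  ultimately show ?case
    by (blast intro: real_elems.congr)
next
  case (congr f g)
  show ?case
    by (rule real_elems.congr[OF congr.IH cong_mult_right[OF congr.hyps(2)]])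
      (use congr assms in \<open>auto intro: unital_words_closed\<close>)
qed (auto simp: distrib_right intro: real_elems.intros)

text \<open>The product p_A s_e is 0 or s_e p_{r(e)}. In the second case the path grows by
  \<open>e\<close>, and \<open>A \<subseteq> target p\<close> guarantees that it stays a
  walk.\<close>

lemma real_elems_mult_S:
  fixes f :: "('v, 'e, 'k::field) leavitt_word"
  assumes "f \<in> real_elems" and e: "e \<in> edges G"
  shows "f * gS e \<in> real_elems"
  using assms(1)
proof induction
  case (mono p A k)
  let ?g = "if src G e \<in> A then scale k (edge_prod (p @ [e]) * gP (rng G e)) else 0"
  have "gP A * gS e \<approx> (if src G e \<in> A then gS e * gP (rng G e) else 0 :: ('v, 'e, 'k) leavitt_word)"
    by (rule cong_trans[OF P_mult_S[OF mono(2) e]]) (simp add: cong_sym[OF S_range[OF e]])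
  then have "scale k (edge_prod p * (gP A * gS e))
      \<approx> scale k (edge_prod p * (if src G e \<in> A then gS e * gP (rng G e) else 0))"
    using mono by (intro cong_scale cong_mult_left edge_prod_U)
  then have "scale k (edge_prod p * gP A) * gS e \<approx> ?g"
    by (simp add: scale_mult_left mult.assoc split: if_splits)
  moreover have "?g \<in> real_elems"
  proof (cases "src G e \<in> A")
    case True
    then have "walk (p @ [e])"
      using mono e by (auto simp: walk_snoc)
    then have "scale k (edge_prod (p @ [e]) * gP (rng G e)) \<in> real_elems"
      by (rule real_elems.mono) (simp_all add: target_def gen_verts.range e)
    then show ?thesis
      using True by simp
  qed (simp add: real_elems.zero)
  moreover have "scale k (edge_prod p * gP A) * gS e \<in> U"
    using mono e by (intro unital_words_closed edge_prod_U gens_in_U)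
  ultimately show ?case
    by (blast intro: real_elems.congr cong_sym)
next
  case (congr f g)
  show ?case
    by (rule real_elems.congr[OF congr.IH cong_mult_right[OF congr.hyps(2)]])
      (use congr assms in \<open>auto intro: unital_words_closed\<close>)
qed (auto simp: distrib_right intro: real_elems.intros)

lemma real_elems_scale: "f \<in> real_elems \<Longrightarrow> scale c f \<in> real_elems"
proof (induction rule: real_elems.induct)
  case (congr f g)
  then show ?case
    by (blast intro: real_elems.congr cong_scale unital_words_closed)
qed (auto simp: scale_scale scale_add_right intro: real_elems.intros)

definition real_form :: "'e list set \<Rightarrow> ('e list \<Rightarrow> ('k::field \<times> 'v set) list) \<Rightarrow> bool" where
  "real_form \<Lambda> l \<longleftrightarrow> finite \<Lambda> \<and>
     (\<forall>p\<in>\<Lambda>. walk p \<and> (\<forall>x\<in>set (l p). snd x \<in> gen_verts G \<and> snd x \<subseteq> target p))"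

text \<open>Terms are collected so that each path occurs once: distinct paths are what evaluation at
  delta functions can tell apart.\<close>

lemma real_elems_form:
  fixes f :: "('v, 'e, 'k::field) leavitt_word"
  assumes "f \<in> real_elems"
  obtains \<Lambda> l where "real_form \<Lambda> l" "f \<approx> (\<Sum>p\<in>\<Lambda>. edge_prod p * proj_comb (l p))"
proof -
  have "\<exists>\<Lambda> l. real_form \<Lambda> l \<and> f \<approx> (\<Sum>p\<in>\<Lambda>. edge_prod p * proj_comb (l p))"
    using assms
  proof induction
    case zero
    show ?case by (rule exI[of _ "{}"]) (simp add: real_form_def)
  next
    case (mono p A k)
    then show ?case
      by (intro exI[of _ "{p}"] exI[of _ "\<lambda>_. [(k, A)]"]) (simp add: real_form_def scale_mult_right)
  next
    case (add f g)
    then obtain \<Lambda> l \<Gamma> m where f: "real_form \<Lambda> l" "f \<approx> (\<Sum>p\<in>\<Lambda>. edge_prod p * proj_comb (l p))"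
      and g: "real_form \<Gamma> m" "g \<approx> (\<Sum>p\<in>\<Gamma>. edge_prod p * proj_comb (m p))"
      by blast
    \<comment> \<open>Lists over a common path are concatenated; outside its own index set a list is
      replaced by \<open>[]\<close>, since nothing is known of it there.\<close>
    define n where "n p = (if p \<in> \<Lambda> then l p else []) @ (if p \<in> \<Gamma> then m p else [])" for p
    have fin: "finite (\<Lambda> \<union> \<Gamma>)"
      using f g by (auto simp: real_form_def)
    have "(\<Sum>p\<in>\<Lambda>. edge_prod p * proj_comb (l p))
        = (\<Sum>p\<in>\<Lambda> \<union> \<Gamma>. edge_prod p * proj_comb (if p \<in> \<Lambda> then l p else []))"
      "(\<Sum>p\<in>\<Gamma>. edge_prod p * proj_comb (m p))
        = (\<Sum>p\<in>\<Lambda> \<union> \<Gamma>. edge_prod p * proj_comb (if p \<in> \<Gamma> then m p else []))"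
      by (rule sum.mono_neutral_cong_left; use fin in auto)+
    then have "(\<Sum>p\<in>\<Lambda>. edge_prod p * proj_comb (l p)) + (\<Sum>p\<in>\<Gamma>. edge_prod p * proj_comb (m p))
        = (\<Sum>p\<in>\<Lambda> \<union> \<Gamma>. edge_prod p * proj_comb (n p))"
      by (simp add: n_def distrib_left sum.distrib)
    then have "f + g \<approx> (\<Sum>p\<in>\<Lambda> \<union> \<Gamma>. edge_prod p * proj_comb (n p))"
      using cong_add[OF f(2) g(2)] by simp
    moreover have "real_form (\<Lambda> \<union> \<Gamma>) n"
    proof -
      define good where "good p x \<longleftrightarrow> snd x \<in> gen_verts G \<and> snd x \<subseteq> target p"
        for p and x :: "'k \<times> 'v set"
      show ?thesis
        using f(1) g(1) unfolding real_form_def n_def good_def[symmetric]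
        by (auto split: if_splits)
    qed
    ultimately show ?case by blast
  next
    case (congr f g)
    then show ?case by (blast intro: cong_trans cong_sym)
  qed
  then show ?thesis using that by blast
qed

section \<open>Filtration by the length of the ghost part\<close>

text \<open>The span of the monomials \<open>s\<^sub>p p\<^sub>A s\<^sub>q\<^sup>*\<close> with \<open>q\<close> of length at most \<open>n\<close>.\<close>

inductive ghost_filt :: "nat \<Rightarrow> ('v, 'e, 'k::field) leavitt_word \<Rightarrow> bool" where
  real: "f \<in> real_elems \<Longrightarrow> ghost_filt n f"
| ghost: "ghost_filt n f \<Longrightarrow> e \<in> edges G \<Longrightarrow> ghost_filt (Suc n) (f * gT e)"
| add: "ghost_filt n f \<Longrightarrow> ghost_filt n g \<Longrightarrow> ghost_filt n (f + g)"
| congr: "ghost_filt n f \<Longrightarrow> f \<approx> g \<Longrightarrow> g \<in> U \<Longrightarrow> ghost_filt n g"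

lemma ghost_filt_U: "ghost_filt n f \<Longrightarrow> f \<in> U"
  by (induction rule: ghost_filt.induct)
    (auto intro: unital_words_closed gens_in_U real_elems_U)

lemma ghost_filt_Suc: "ghost_filt n f \<Longrightarrow> ghost_filt (Suc n) f"
  by (induction rule: ghost_filt.induct) (auto intro: ghost_filt.intros)

lemma ghost_filt_mono: "n \<le> m \<Longrightarrow> ghost_filt n f \<Longrightarrow> ghost_filt m f"
  by (induction m rule: dec_induct) (auto intro: ghost_filt_Suc)

lemma ghost_filt_zero: "ghost_filt n 0"
  by (intro ghost_filt.real real_elems.zero)

lemma ghost_filt_scale: "ghost_filt n f \<Longrightarrow> ghost_filt n (scale c f)"
proof (induction rule: ghost_filt.induct)
  case (congr n f g)
  then show ?case
    by (blast intro: ghost_filt.congr cong_scale unital_words_closed)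
qed (auto simp: scale_mult_left[symmetric] scale_add_right
    intro: ghost_filt.intros real_elems_scale)

lemma ghost_filt_mult_P:
  assumes "ghost_filt n f" "A \<in> gen_verts G"
  shows "ghost_filt n (f * gP A)"
  using assms(1)
proof induction
  case (ghost n f e)
  have "f * (gT e * gP A) \<approx> f * (if src G e \<in> A then gT e else 0)"
    using ghost assms by (intro cong_mult_left T_mult_P ghost_filt_U)
  moreover have "ghost_filt (Suc n) (f * (if src G e \<in> A then gT e else 0))"
    using ghost ghost_filt_zero by (auto intro: ghost_filt.ghost)
  ultimately show ?case
    using ghost assms unfolding mult.assoc
    by (blast intro: ghost_filt.congr[OF _ cong_sym] unital_words_closed gens_in_U ghost_filt_U)
next
  case (congr n f g)
  show ?case
    by (rule ghost_filt.congr[OF congr.IH cong_mult_right[OF congr.hyps(2)]])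
      (use congr assms in \<open>auto intro: unital_words_closed\<close>)
qed (auto simp: distrib_right intro: ghost_filt.intros real_elems_mult_P assms)

text \<open>A final ghost edge meets the new edge and is cancelled by (3), so the bound on the ghost
  length is not raised.\<close>

lemma ghost_filt_mult_S:
  assumes "ghost_filt n f" and e: "e \<in> edges G"
  shows "ghost_filt n (f * gS e)"
  using assms(1)
proof induction
  case (ghost n f e')
  have "f * (gT e' * gS e) \<approx> f * (if e' = e then gP (rng G e') else 0)"
    using ghost e by (intro cong_mult_left CK1 ghost_filt_U)
  moreover have "ghost_filt (Suc n) (f * (if e' = e then gP (rng G e') else 0))"
    using ghost ghost_filt_zero
    by (auto intro: ghost_filt_Suc ghost_filt_mult_P gen_verts.range)
  ultimately show ?case
    using ghost e unfolding mult.assoc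
    by (blast intro: ghost_filt.congr[OF _ cong_sym] unital_words_closed gens_in_U ghost_filt_U)
next
  case (congr n f g)
  show ?case
    by (rule ghost_filt.congr[OF congr.IH cong_mult_right[OF congr.hyps(2)]])
      (use congr assms in \<open>auto intro: unital_words_closed\<close>)
qed (auto simp: distrib_right intro: ghost_filt.intros real_elems_mult_S e)

text \<open>Letters are appended on the right because the filtration is controlled under right
  multiplication; only a ghost letter raises the level.\<close>

lemma ghost_filt_word:
  assumes "xs \<noteq> []" "set xs \<subseteq> leavitt_gens G"
  shows "\<exists>n. ghost_filt n (Poly_Mapping.single (Word xs) (1::'k::field))"
  using assms
proof (induction xs rule: rev_nonempty_induct)
  case (single x)
  consider A where "x = Proj A" "A \<in> gen_verts G" | e where "x = Edge e" "e \<in> edges G"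
    | e where "x = Ghost e" "e \<in> edges G"
    using single by (auto simp: leavitt_gens_def)
  then show ?case
  proof cases
    case 1
    have "gP A \<in> real_elems"
      using real_elems.mono[of "[]" A 1] gen_verts_subset 1 by (simp add: target_def)
    then show ?thesis using 1 by (auto simp: gP_def word_single_def intro: ghost_filt.real)
  next
    case 2
    have "scale 1 (edge_prod [e] * gP (rng G e)) \<in> real_elems"
      using 2 src_in_verts
      by (intro real_elems.mono) (auto simp: walk_def epath_Cons target_def gen_verts.range)
    then have "gS e * gP (rng G e) \<in> real_elems"
      by simp
    then have "gS e \<in> real_elems"
      by (rule real_elems.congr[OF _ S_range]) (use 2 in auto)
    then show ?thesis using 2 by (auto simp: gS_def word_single_def intro: ghost_filt.real)
  next
    case 3
    have "gP (rng G e) \<in> real_elems"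
      using real_elems.mono[of "[]" "rng G e" 1] 3 rng_subset_verts
      by (simp add: target_def gen_verts.range)
    then have "ghost_filt (Suc 0) (gT e)"
      using 3 by (intro ghost_filt.congr[OF ghost_filt.ghost[OF ghost_filt.real] T_range]) auto
    then show ?thesis using 3 by (auto simp: gT_def word_single_def)
  qed
next
  case (snoc x xs)
  then obtain n where n: "ghost_filt n (Poly_Mapping.single (Word xs) (1::'k))"
    by auto
  have eq: "Poly_Mapping.single (Word (xs @ [x])) (1::'k)
      = Poly_Mapping.single (Word xs) 1 * Poly_Mapping.single (Word [x]) 1"
    by (simp add: mult_single plus_free_monoid_def)
  consider A where "x = Proj A" "A \<in> gen_verts G" | e where "x = Edge e" "e \<in> edges G"
    | e where "x = Ghost e" "e \<in> edges G"
    using snoc by (auto simp: leavitt_gens_def)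
  then show ?case
  proof cases
    case 1
    then show ?thesis
      using ghost_filt_mult_P[OF n, of A] unfolding eq by (auto simp: gP_def word_single_def)
  next
    case 2
    then show ?thesis
      using ghost_filt_mult_S[OF n, of e] unfolding eq by (auto simp: gS_def word_single_def)
  next
    case 3
    then show ?thesis
      using ghost_filt.ghost[OF n, of e] unfolding eq by (auto simp: gT_def word_single_def)
  qed
qed

lemma ghost_filt_exhausts:
  fixes f :: "('v, 'e, 'k::field) leavitt_word"
  assumes "f \<in> carrier (free_algebra (leavitt_gens G))"
  shows "\<exists>n. ghost_filt n f"
proof -
  have "\<exists>n. ghost_filt n (\<Sum>w\<in>W. Poly_Mapping.single w (Poly_Mapping.lookup f w))"
    if "finite W" "W \<subseteq> Poly_Mapping.keys f" for W
    using that
  proof (induction W rule: finite_induct)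
    case empty
    then show ?case using ghost_filt_zero by auto
  next
    case (insert w W)
    then obtain n where n: "ghost_filt n (\<Sum>w\<in>W. Poly_Mapping.single w (Poly_Mapping.lookup f w))"
      by auto
    have "letters w \<noteq> [] \<and> set (letters w) \<subseteq> leavitt_gens G"
      using assms insert.prems by (auto simp: in_free_algebra)
    then obtain m where "ghost_filt m (Poly_Mapping.single (Word (letters w)) (1::'k))"
      using ghost_filt_word by blast
    then have "ghost_filt m (Poly_Mapping.single w (Poly_Mapping.lookup f w))"
      using ghost_filt_scale[of m "Poly_Mapping.single w (1::'k)" "Poly_Mapping.lookup f w"]
      by (simp add: scale_single)
    then have "ghost_filt (max m n) (Poly_Mapping.single w (Poly_Mapping.lookup f w)
        + (\<Sum>w\<in>W. Poly_Mapping.single w (Poly_Mapping.lookup f w)))"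
      using n by (intro ghost_filt.add) (auto intro: ghost_filt_mono[rotated])
    then show ?case using insert.hyps by auto
  qed
  then show ?thesis
    using poly_mapping_expand[of f] by (metis finite_keys order_refl)
qed

lemma ghost_filt_0: "ghost_filt 0 f \<Longrightarrow> f \<in> real_elems"
  by (induction "0::nat" f rule: ghost_filt.induct) (auto intro: real_elems.intros)

text \<open>Terms are sorted by their last ghost edge, the one that right multiplication by an edge
  can remove.\<close>

lemma ghost_filt_SucE:
  fixes f :: "('v, 'e, 'k::field) leavitt_word"
  assumes "ghost_filt (Suc n) f"
  obtains r F b where "r \<in> real_elems" "finite F" "F \<subseteq> edges G" "\<And>e. ghost_filt n (b e)"
    "f \<approx> r + (\<Sum>e\<in>F. b e * gT e)"
proof -
  have "\<exists>r\<in>real_elems. \<exists>F b. finite F \<and> F \<subseteq> edges G \<and> (\<forall>e. ghost_filt n (b e)) \<and>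
      f \<approx> r + (\<Sum>e\<in>F. b e * gT e)"
    using assms
  proof (induction "Suc n" f rule: ghost_filt.induct)
    case (real f)
    then show ?case
      by (intro bexI[of _ f] exI[of _ "{}"] exI[of _ "\<lambda>_. 0"]) (auto intro: ghost_filt_zero)
  next
    case (ghost f e)
    then show ?case
      by (intro bexI[of _ 0] exI[of _ "{e}"] exI[of _ "\<lambda>_. f"]) (auto intro: real_elems.zero)
  next
    case (add f g)
    then obtain r F b r' F' b' where f: "r \<in> real_elems" "finite F" "F \<subseteq> edges G"
      "\<forall>e. ghost_filt n (b e)" "f \<approx> r + (\<Sum>e\<in>F. b e * gT e)"
      and g: "r' \<in> real_elems" "finite F'" "F' \<subseteq> edges G"
      "\<forall>e. ghost_filt n (b' e)" "g \<approx> r' + (\<Sum>e\<in>F'. b' e * gT e)"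
      by blast
    define d where "d e = (if e \<in> F then b e else 0) + (if e \<in> F' then b' e else 0)" for e
    have eqs: "(\<Sum>e\<in>F. b e * gT e) = (\<Sum>e\<in>F \<union> F'. (if e \<in> F then b e else 0) * gT e)"
      "(\<Sum>e\<in>F'. b' e * gT e) = (\<Sum>e\<in>F \<union> F'. (if e \<in> F' then b' e else 0) * gT e)"
      by (rule sum.mono_neutral_cong_left; use f g in auto)+
    have "f + g \<approx> r + (\<Sum>e\<in>F. b e * gT e) + (r' + (\<Sum>e\<in>F'. b' e * gT e))"
      by (rule cong_add[OF f(5) g(5)])
    also have "r + (\<Sum>e\<in>F. b e * gT e) + (r' + (\<Sum>e\<in>F'. b' e * gT e))
        = r + r' + (\<Sum>e\<in>F \<union> F'. d e * gT e)"
      unfolding eqs d_def distrib_right sum.distrib by (simp add: add_ac)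
    finally have "f + g \<approx> r + r' + (\<Sum>e\<in>F \<union> F'. d e * gT e)" .
    moreover have "ghost_filt n (d e)" for e
      using f g by (auto simp: d_def intro!: ghost_filt.add ghost_filt_zero)
    ultimately show ?case
      using f g by (intro bexI[of _ "r + r'"] exI[of _ "F \<union> F'"] exI[of _ d])
        (auto intro: real_elems.add)
  next
    case (congr f g)
    then obtain r F b where f: "r \<in> real_elems" "finite F" "F \<subseteq> edges G"
      "\<forall>e. ghost_filt n (b e)" "f \<approx> r + (\<Sum>e\<in>F. b e * gT e)"
      by blast
    have "g \<approx> r + (\<Sum>e\<in>F. b e * gT e)"
      by (rule cong_trans[OF cong_sym[OF congr(3)] f(5)])
    with f show ?case by blast
  qed
  then show ?thesis using that by blast
qed

end


section \<open>Branching systems\<close>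

text \<open>A sink \<open>w\<close> is treated as a letter \<open>Inr w\<close> that repeats forever, so that the finite paths
  ending in a sink become infinite sequences as well.\<close>

fun letter_src :: "('v, 'e) ultragraph_data \<Rightarrow> 'e + 'v \<Rightarrow> 'v" where
  "letter_src G (Inl e) = src G e"
| "letter_src G (Inr w) = w"

definition path_letters :: "('v, 'e) ultragraph_data \<Rightarrow> ('e + 'v) set" where
  "path_letters G = Inl ` edges G \<union> Inr ` {w. sink G w}"

lemma path_letters_simps [simp]:
  "Inl e \<in> path_letters G \<longleftrightarrow> e \<in> edges G" "Inr w \<in> path_letters G \<longleftrightarrow> sink G w"
  by (auto simp: path_letters_def)

text \<open>An algebraic branching system: \<open>cons e\<close> is a bijection from the points
  based in \<open>rng G e\<close> onto those with first letter \<open>Inl e\<close>, with inverse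
  \<open>rest\<close>.\<close>

locale branching = ultragraph G for G :: "('v, 'e) ultragraph_data" +
  fixes X :: "'z set" and first :: "'z \<Rightarrow> 'e + 'v" and rest :: "'z \<Rightarrow> 'z"
    and cons :: "'e \<Rightarrow> 'z \<Rightarrow> 'z"
  assumes first_in: "x \<in> X \<Longrightarrow> first x \<in> path_letters G"
    and rest: "x \<in> X \<Longrightarrow> first x = Inl e \<Longrightarrow>
      rest x \<in> X \<and> letter_src G (first (rest x)) \<in> rng G e \<and> cons e (rest x) = x"
    and cons: "e \<in> edges G \<Longrightarrow> x \<in> X \<Longrightarrow> letter_src G (first x) \<in> rng G e \<Longrightarrow>
      cons e x \<in> X \<and> first (cons e x) = Inl e \<and> rest (cons e x) = x"
begin

definition base :: "'z \<Rightarrow> 'v" where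
  "base x = letter_src G (first x)"

lemma base_in: "x \<in> X \<Longrightarrow> base x \<in> verts G"
  using first_in[of x] by (auto simp: base_def path_letters_def sink_def src_in_verts)

lemma edge_in: "x \<in> X \<Longrightarrow> first x = Inl e \<Longrightarrow> e \<in> edges G"
  using first_in[of x] by simp

text \<open>Functions are pulled back along points: s_e sends \<phi> to its composite with
  \<open>rest\<close> on the points starting with \<open>e\<close>. Hence an edge letter removes an
  edge and a ghost letter adds one, and \<open>run\<close> applies the leftmost letter first to make
  \<open>act\<close> multiplicative.\<close>

fun step :: "('v, 'e) leavitt_gen \<Rightarrow> 'z \<Rightarrow> 'z option" where
  "step (Proj A) x = (if base x \<in> A then Some x else None)"
| "step (Edge e) x = (if first x = Inl e then Some (rest x) else None)"
| "step (Ghost e) x = (if e \<in> edges G \<and> base x \<in> rng G e then Some (cons e x) else None)"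

fun run :: "('v, 'e) leavitt_gen list \<Rightarrow> 'z \<Rightarrow> 'z option" where
  "run [] x = Some x"
| "run (a # w) x = Option.bind (step a x) (run w)"

lemma run_append: "run (v @ w) x = Option.bind (run v x) (run w)"
  by (induction v arbitrary: x) (auto split: option.split bind_splits)

lemma step_in: "x \<in> X \<Longrightarrow> step a x = Some y \<Longrightarrow> y \<in> X"
  using rest cons by (cases a) (auto simp: base_def split: if_splits)

lemma run_in: "x \<in> X \<Longrightarrow> run w x = Some y \<Longrightarrow> y \<in> X"
  by (induction w arbitrary: x) (auto simp: Option.bind_eq_Some_conv dest: step_in)

lemma step_inj: "x \<in> X \<Longrightarrow> x' \<in> X \<Longrightarrow> step a x = Some y \<Longrightarrow> step a x' = Some y \<Longrightarrow> x = x'"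
  using rest cons by (cases a) (metis base_def option.inject option.distinct(1) step.simps)+

text \<open>Injectivity is what makes the action preserve finite supports.\<close>

lemma run_inj: "x \<in> X \<Longrightarrow> x' \<in> X \<Longrightarrow> run w x = Some y \<Longrightarrow> run w x' = Some y \<Longrightarrow> x = x'"
proof (induction w arbitrary: x x')
  case (Cons a w)
  then obtain z z' where "step a x = Some z" "run w z = Some y" "step a x' = Some z'" "run w z' = Some y"
    by (auto simp: Option.bind_eq_Some_conv)
  then show ?case
    using Cons by (metis step_in step_inj)
qed simp

definition ext :: "('z \<Rightarrow> 'k::field) \<Rightarrow> 'z option \<Rightarrow> 'k" where
  "ext \<phi> u = (case u of None \<Rightarrow> 0 | Some y \<Rightarrow> \<phi> y)"

lemma ext_simps [simp]: "ext \<phi> None = 0" "ext \<phi> (Some y) = \<phi> y"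
  by (simp_all add: ext_def)

text \<open>The values of \<open>act f \<phi>\<close> outside \<open>X\<close> are junk.\<close>

definition act :: "('v, 'e, 'k::field) leavitt_word \<Rightarrow> ('z \<Rightarrow> 'k) \<Rightarrow> 'z \<Rightarrow> 'k" where
  "act f \<phi> y = (\<Sum>w\<in>Poly_Mapping.keys f. Poly_Mapping.lookup f w * ext \<phi> (run (letters w) y))"

lemma act_superset:
  "finite W \<Longrightarrow> Poly_Mapping.keys f \<subseteq> W \<Longrightarrow>
    act f \<phi> y = (\<Sum>w\<in>W. Poly_Mapping.lookup f w * ext \<phi> (run (letters w) y))"
  unfolding act_def by (rule sum.mono_neutral_left) (auto simp: in_keys_iff)

lemma act_zero [simp]: "act 0 \<phi> y = 0"
  by (simp add: act_def)

lemma act_add [simp]: "act (f + g) \<phi> y = act f \<phi> y + act g \<phi> y"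
  using act_superset[of "Poly_Mapping.keys f \<union> Poly_Mapping.keys g" "f + g"]
    act_superset[of "Poly_Mapping.keys f \<union> Poly_Mapping.keys g" f]
    act_superset[of "Poly_Mapping.keys f \<union> Poly_Mapping.keys g" g] Poly_Mapping.keys_add[of f g]
  by (simp add: lookup_add distrib_right sum.distrib)

lemma act_single: "act (Poly_Mapping.single w c) \<phi> y = c * ext \<phi> (run (letters w) y)"
  by (simp add: act_def)

lemma act_one [simp]: "act 1 \<phi> y = \<phi> y"
  using act_single[of 0 1 \<phi> y] by simp

lemma act_fun_add: "act f (\<lambda>x. \<phi> x + \<psi> x) y = act f \<phi> y + act f \<psi> y"
proof -
  have "ext (\<lambda>x. \<phi> x + \<psi> x) u = ext \<phi> u + ext \<psi> u" for u
    by (cases u) auto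
  then show ?thesis by (simp add: act_def distrib_left sum.distrib)
qed

lemma act_fun_scale: "act f (\<lambda>x. c * \<phi> x) y = c * act f \<phi> y"
proof -
  have "ext (\<lambda>x. c * \<phi> x) u = c * ext \<phi> u" for u
    by (cases u) auto
  then show ?thesis by (simp add: act_def sum_distrib_left mult.left_commute)
qed

lemma act_fun_zero [simp]: "act f (\<lambda>x. 0) y = 0"
  using act_fun_scale[of f 0 "\<lambda>_. 0"] by simp

lemma act_mult: "act (f * g) \<phi> y = act f (act g \<phi>) y"
proof (induction f arbitrary: y rule: poly_mapping_induct)
  case (single w c)
  show ?case
  proof (induction g rule: poly_mapping_induct)
    case zero
    then show ?case using act_fun_scale[of _ 0 "\<lambda>_. 0"] by (simp add: act_zero[abs_def])
  next
    case (single v d)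
    then show ?case
      by (cases "run (letters w) y") (auto simp: mult_single act_single run_append)
  next
    case (add f g)
    then show ?case
      by (simp add: distrib_left act_fun_add act_add[abs_def])
  qed
qed (simp_all add: distrib_right)

lemma act_uminus [simp]: "act (- f) \<phi> y = - act f \<phi> y"
  using act_add[of f "- f" \<phi> y] by (simp add: add_eq_0_iff)

lemma act_diff [simp]: "act (f - g) \<phi> y = act f \<phi> y - act g \<phi> y"
  using act_add[of f "- g" \<phi> y] by simp

lemma act_sum: "act (sum f A) \<phi> y = (\<Sum>i\<in>A. act (f i) \<phi> y)"
  by (induction A rule: infinite_finite_induct) auto

lemma act_scale [simp]: "act (scale c f) \<phi> y = c * act f \<phi> y"
  by (simp add: scale_def act_mult act_single)

lemma act_gens [simp]:
  "act (gP A) \<phi> y = (if base y \<in> A then \<phi> y else 0)"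
  "act (gS e) \<phi> y = (if first y = Inl e then \<phi> (rest y) else 0)"
  "act (gT e) \<phi> y = (if e \<in> edges G \<and> base y \<in> rng G e then \<phi> (cons e y) else 0)"
  by (simp_all add: gP_def gS_def gT_def word_single_def act_single)

lemma act_cong_fun: "y \<in> X \<Longrightarrow> (\<And>x. x \<in> X \<Longrightarrow> \<phi> x = \<psi> x) \<Longrightarrow> act f \<phi> y = act f \<psi> y"
  unfolding act_def by (rule sum.cong) (auto simp: ext_def split: option.split dest: run_in)

lemma act_gS_gT:
  assumes "y \<in> X"
  shows "act (gS e * gT e) \<phi> y = (if first y = Inl e then \<phi> y else 0)"
  using rest[OF assms, of e] edge_in[OF assms, of e] by (auto simp: act_mult base_def)

lemma act_relator:
  assumes "f \<in> leavitt_relators G" "y \<in> X"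
  shows "act f \<phi> y = 0"
  using assms(1)
proof cases
  case (CK2 v)
  have fin: "finite (out_edges G v)"
    using CK2 by (simp add: regular_vertex_def)
  have "act (\<Sum>e\<in>out_edges G v. gS e * gT e) \<phi> y
      = (\<Sum>e\<in>out_edges G v. if first y = Inl e then \<phi> y else 0)"
    by (simp add: act_sum act_gS_gT assms)
  also have "\<dots> = (if base y = v then \<phi> y else 0)"
  proof (cases "first y")
    case (Inl e)
    then show ?thesis
      using fin edge_in[OF assms(2)] by (auto simp: base_def out_edges_def)
  next
    \<comment> \<open>A sink letter matches no edge, and its base is not the regular vertex
      \<open>v\<close>, so both sides vanish.\<close>
    case (Inr w)
    then show ?thesis
      using first_in[OF assms(2)] CK2 by (auto simp: base_def sink_def regular_vertex_def)
  qed
  finally show ?thesis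
    by (simp add: CK2)
next
  case (S_source e)
  then show ?thesis by (auto simp: act_mult base_def)
next
  case (S_range e)
  then show ?thesis using rest[OF assms(2), of e] by (auto simp: act_mult base_def)
next
  case (T_range e)
  then show ?thesis by (auto simp: act_mult)
next
  case (T_source e)
  then show ?thesis using cons[OF _ assms(2), of e] by (auto simp: act_mult base_def)
next
  case (CK1 e e')
  then show ?thesis using cons[OF _ assms(2), of e] by (auto simp: act_mult base_def)
qed (auto simp: act_mult)

lemma act_ideal:
  assumes "f \<in> algebra_ideal (leavitt_gens G) (leavitt_relators G)" "y \<in> X"
  shows "act f \<phi> y = 0"
  using assms
proof (induction arbitrary: \<phi> y)
  case (left f h)
  then show ?case
    using act_cong_fun[of y "act f \<phi>" "\<lambda>_. 0" h] by (simp add: act_mult)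
qed (auto simp: act_relator act_mult)

lemma act_cong: "f \<approx> g \<Longrightarrow> y \<in> X \<Longrightarrow> act f \<phi> y = act g \<phi> y"
  using act_ideal[of "f - g" y \<phi>] by (simp add: cong_def)

definition delta :: "'z \<Rightarrow> 'z \<Rightarrow> 'k::field" where
  "delta x y = (if y = x then 1 else 0)"

lemma act_proj_comb: "act (proj_comb l) \<phi> y = proj_val l (base y) * \<phi> y"
  by (induction l) (auto simp: distrib_right)

definition prepend :: "'e list \<Rightarrow> 'z \<Rightarrow> 'z" where
  "prepend p x = foldr cons p x"

lemma prepend_simps [simp]: "prepend [] x = x" "prepend (e # p) x = cons e (prepend p x)"
  by (simp_all add: prepend_def)

text \<open>With \<open>act_edge_prod_prepend\<close> this says that s_p sends the delta function at
  \<open>x\<close> to the one at \<open>prepend p x\<close>, when \<open>p\<close> is a walk and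
  \<open>x\<close> is based in its target.\<close>

lemma act_edge_prod_delta_nonzero:
  "y \<in> X \<Longrightarrow> act (edge_prod p) (delta x) y \<noteq> (0::'k::field) \<Longrightarrow> y = prepend p x"
proof (induction p arbitrary: y)
  case Nil
  then show ?case by (simp add: delta_def split: if_splits)
next
  case (Cons e p)
  then have "first y = Inl e" "act (edge_prod p) (delta x) (rest y) \<noteq> (0::'k)"
    by (auto simp: act_mult split: if_splits)
  then show ?case
    using Cons.IH[of "rest y"] rest[OF Cons.prems(1), of e] by simp
qed

lemma act_edge_prod_prepend:
  "walk p \<Longrightarrow> x \<in> X \<Longrightarrow> base x \<in> target p \<Longrightarrow>
    prepend p x \<in> X \<and> (p \<noteq> [] \<longrightarrow> base (prepend p x) = src G (hd p)) \<and>
    act (edge_prod p) \<phi> (prepend p x) = \<phi> x"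
proof (induction p)
  case (Cons e p)
  have e: "e \<in> edges G" "walk p" using Cons.prems walk_Cons by auto
  have "base x \<in> target p" using Cons.prems base_in by (auto simp: target_def split: if_splits)
  then have IH: "prepend p x \<in> X" "p \<noteq> [] \<Longrightarrow> base (prepend p x) = src G (hd p)"
      "act (edge_prod p) \<phi> (prepend p x) = \<phi> x"
    using Cons.IH Cons.prems e by auto
  have "base (prepend p x) \<in> rng G e"
    using IH(2) Cons.prems by (cases "p = []") (auto simp: walk_def epath_Cons target_def)
  then show ?case
    using cons[OF e(1) IH(1)] IH(3) by (simp add: base_def act_mult)
qed simp

end

lemma (in ultragraph) proj_val_outside: "\<forall>x\<in>set l. v \<notin> snd x \<Longrightarrow> proj_val l v = 0"
  by (induction l) auto

section \<open>Faithfulness of separated branching systems\<close>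

text \<open>Separation by the prefixes from a finite set stands in for the aperiodicity of \<open>x\<close>.\<close>

locale separated_branching = branching +
  assumes separated: "b \<in> path_letters G \<Longrightarrow> finite \<Lambda> \<Longrightarrow>
    \<exists>x\<in>X. first x = b \<and> inj_on (\<lambda>p. prepend p x) \<Lambda>"
begin

text \<open>Evaluate at \<open>prepend p x\<close> for a point \<open>x\<close> with first letter
  \<open>b\<close> and separated prefixes: the terms of the other paths are supported elsewhere, and
  the term of \<open>p\<close> leaves its coefficient at the base of \<open>x\<close>. If that base
  is outside the target of \<open>p\<close>, no set in \<open>l p\<close> contains it.\<close>

lemma real_form_val_zero:
  fixes l :: "'b list \<Rightarrow> ('k::field \<times> 'a set) list"
  assumes form: "real_form \<Lambda> l" and b: "b \<in> path_letters G" and p: "p \<in> \<Lambda>"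
    and zero: "\<And>x y. x \<in> X \<Longrightarrow> y \<in> X \<Longrightarrow> first x = b \<Longrightarrow>
      act (\<Sum>p\<in>\<Lambda>. edge_prod p * proj_comb (l p)) (delta x) y = 0"
  shows "proj_val (l p) (letter_src G b) = 0"
proof (cases "letter_src G b \<in> target p")
  case False
  then have "\<forall>x\<in>set (l p). letter_src G b \<notin> snd x"
    using form p by (auto simp: real_form_def)
  then show ?thesis
    by (rule proj_val_outside)
next
  case True
  have fin: "finite \<Lambda>" and walk: "walk p"
    using form p by (auto simp: real_form_def)
  obtain x where x: "x \<in> X" "first x = b" and inj: "inj_on (\<lambda>p. prepend p x) \<Lambda>"
    using separated[OF b fin] by blast
  have base: "base x = letter_src G b"
    by (simp add: base_def x)
  have y: "prepend p x \<in> X" "act (edge_prod p) (delta x) (prepend p x) = (1 :: 'k)"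
    using act_edge_prod_prepend[of p x "delta x"] walk x True by (auto simp: base delta_def)
  have "act (proj_comb (l q)) (delta x) = (\<lambda>u. proj_val (l q) (base x) * delta x u)" for q
    by (auto simp: act_proj_comb delta_def)
  then have "act (\<Sum>p\<in>\<Lambda>. edge_prod p * proj_comb (l p)) (delta x) (prepend p x)
      = (\<Sum>q\<in>\<Lambda>. proj_val (l q) (base x) * act (edge_prod q) (delta x) (prepend p x))"
    by (simp add: act_sum act_mult act_fun_scale)
  also have "\<dots> = (\<Sum>q\<in>\<Lambda>. if q = p then proj_val (l p) (base x) else 0)"
  proof (rule sum.cong[OF refl])
    fix q assume q: "q \<in> \<Lambda>"
    have "act (edge_prod q) (delta x) (prepend p x) = (0 :: 'k)" if "q \<noteq> p"
      using act_edge_prod_delta_nonzero[OF y(1), of q x] inj q p that by (auto dest: inj_onD)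
    then show "proj_val (l q) (base x) * act (edge_prod q) (delta x) (prepend p x)
        = (if q = p then proj_val (l p) (base x) else 0)"
      using y(2) by simp
  qed
  also have "\<dots> = proj_val (l p) (base x)"
    using fin p by simp
  finally show ?thesis
    using zero[OF x(1) y(1) x(2)] by (simp add: base)
qed

text \<open>An element \<open>q\<close> of the span of the projections that vanishes on every vertex emitting an
  edge outside \<open>F\<close> and on every sink is a combination of regular vertices, on which (4)
  turns \<open>1 - \<Sum>\<^sub>F s\<^sub>e s\<^sub>e\<^sup>*\<close> into \<open>0\<close>.\<close>

lemma proj_comb_mult_CK2:
  fixes l :: "('k::field \<times> 'a set) list"
  assumes l: "\<forall>x\<in>set l. snd x \<in> gen_verts G" and F: "finite F" "F \<subseteq> edges G"
    and zero: "\<And>b. b \<in> path_letters G \<Longrightarrow> b \<notin> Inl ` F \<Longrightarrow> proj_val l (letter_src G b) = 0"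
  shows "proj_comb l * (1 - (\<Sum>e\<in>F. gS e * gT e)) \<approx> 0"
proof -
  let ?D = "\<Sum>e\<in>F. gS e * gT e :: ('a, 'b, 'k) leavitt_word"
  have ST: "gS e * gT e \<in> U" if "e \<in> edges G" for e
    using that by (intro unital_words_closed gens_in_U)
  have D: "1 - ?D \<in> U"
    using F by (intro unital_words_closed sum_unital_words gens_in_U) auto
  have W: "finite (src G ` F)" "src G ` F \<subseteq> verts G"
    using F src_in_verts by auto
  \<comment> \<open>Such a vertex is a sink or emits an edge, and none of its edges lies in
    \<open>F\<close>.\<close>
  have "proj_val l v = 0" if v: "v \<in> verts G" "v \<notin> src G ` F" for v
  proof (cases "sink G v")
    case True
    then show ?thesis using zero[of "Inr v"] by auto
  next
    case False
    then obtain e where "e \<in> edges G" "src G e = v"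
      using v by (auto simp: sink_def out_edges_def)
    then show ?thesis using zero[of "Inl e"] v by auto
  qed
  then have "proj_comb l \<approx> (\<Sum>w\<in>src G ` F. scale (proj_val l w) (gP {w}))"
    by (intro proj_comb_finite_support l W)
  then have "proj_comb l * (1 - ?D) \<approx> (\<Sum>w\<in>src G ` F. scale (proj_val l w) (gP {w})) * (1 - ?D)"
    by (rule cong_mult_right) (rule D)
  also have "\<dots> = (\<Sum>w\<in>src G ` F. scale (proj_val l w) (gP {w} * (1 - ?D)))"
    by (simp add: sum_distrib_right scale_mult_left)
  also have "\<dots> \<approx> (\<Sum>w\<in>src G ` F. 0)"
  proof (rule cong_sum)
    fix w assume w: "w \<in> src G ` F"
    show "scale (proj_val l w) (gP {w} * (1 - ?D)) \<approx> 0"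
    \<comment> \<open>Either \<open>w\<close> emits an edge outside \<open>F\<close> and its
      coefficient is 0, or all its edges lie in the finite set \<open>F\<close>, so that
      \<open>w\<close> is regular and (4) applies.\<close>
    proof (cases "out_edges G w \<subseteq> F")
      case False
      then obtain e where "e \<in> edges G" "src G e = w" "e \<notin> F"
        by (auto simp: out_edges_def)
      then show ?thesis using zero[of "Inl e"] by (auto simp: image_iff)
    next
      case True
      then have reg: "regular_vertex G w"
        using w W(2) F finite_subset[OF True F(1)] by (auto simp: regular_vertex_def out_edges_def)
      have out: "{e \<in> F. src G e = w} = out_edges G w"
        using True F by (auto simp: out_edges_def)
      have "gP {w} * ?D = (\<Sum>e\<in>F. (gP {w} * gS e) * gT e)"
        by (simp add: sum_distrib_left mult.assoc)
      also have "\<dots> \<approx> (\<Sum>e\<in>F. (if src G e \<in> {w} then gS e else 0) * gT e)"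
        using F W w by (intro cong_sum cong_mult_right P_mult_S gens_in_U gen_verts.vertex) auto
      also have "\<dots> = (\<Sum>e\<in>F. if src G e = w then gS e * gT e else 0)"
        by (rule sum.cong) auto
      also have "\<dots> = (\<Sum>e\<in>out_edges G w. gS e * gT e)"
        using F by (simp add: sum.If_cases Int_def out)
      also have "\<dots> \<approx> gP {w}"
        by (rule cong_sym[OF CK2[OF reg]])
      finally have "gP {w} * ?D \<approx> gP {w}" .
      then have "gP {w} - gP {w} * ?D \<approx> gP {w} - gP {w}"
        by (intro cong_diff cong_refl)
      then have "gP {w} * (1 - ?D) \<approx> 0"
        by (simp add: right_diff_distrib)
      from cong_scale[OF this, of "proj_val l w"] show ?thesis
        by simp
    qed
  qed
  finally show ?thesis by simp
qed

lemma ghost_filt_faithful: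
  fixes f :: "('a, 'b, 'k::field) leavitt_word"
  assumes "ghost_filt n f" "\<And>\<phi> y. y \<in> X \<Longrightarrow> act f \<phi> y = 0"
  shows "f \<approx> 0"
  using assms
proof (induction n arbitrary: f)
  case 0
  have "f \<in> real_elems"
    using 0 by (intro ghost_filt_0)
  then obtain \<Lambda> l where l: "real_form \<Lambda> l" "f \<approx> (\<Sum>p\<in>\<Lambda>. edge_prod p * proj_comb (l p))"
    by (rule real_elems_form)
  have zero: "edge_prod p * proj_comb (l p) \<approx> 0" if p: "p \<in> \<Lambda>" for p
  proof -
    have lp: "\<forall>x\<in>set (l p). snd x \<in> gen_verts G" "walk p"
      using l(1) p by (auto simp: real_form_def)
    \<comment> \<open>Level 0 is the case \<open>F = {}\<close>: the coefficients vanish at every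
      letter.\<close>
    have "proj_comb (l p) * (1 - (\<Sum>e\<in>{}. gS e * gT e)) \<approx> 0"
      using act_cong[OF l(2)] 0
      by (intro proj_comb_mult_CK2 lp real_form_val_zero[OF l(1) _ p]) auto
    then show ?thesis
      using cong_mult_left[OF _ edge_prod_U[OF lp(2)], of "proj_comb (l p)" 0] by simp
  qed
  note l(2)
  also have "(\<Sum>p\<in>\<Lambda>. edge_prod p * proj_comb (l p)) \<approx> (\<Sum>p\<in>\<Lambda>. 0)"
    by (intro cong_sum zero)
  finally show ?case by simp
next
  case (Suc n)
  obtain r F b where r: "r \<in> real_elems" and F: "finite F" "F \<subseteq> edges G"
    and b: "\<And>e. ghost_filt n (b e)" and f: "f \<approx> r + (\<Sum>e\<in>F. b e * gT e)"
    by (rule ghost_filt_SucE[OF Suc.prems(1)]) blast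
  have bU: "b e \<in> U" for e
    by (rule ghost_filt_U[OF b])
  \<comment> \<open>Right multiplication by \<open>gS e\<close> turns the summand of
    \<open>e\<close> into \<open>b e * gP (rng G e)\<close> and kills the others. The result has
    level \<open>n\<close> and acts as 0, so the induction hypothesis applies; multiplying by
    \<open>gT e\<close> then expresses \<open>b e * gT e\<close> through \<open>r\<close>.\<close>
  have bT: "b e * gT e \<approx> - (r * gS e * gT e)" if e: "e \<in> F" for e
  proof -
    have eG: "e \<in> edges G" using e F by auto
    let ?g = "r * gS e + b e * gP (rng G e)"
    have "f * gS e \<approx> (r + (\<Sum>e\<in>F. b e * gT e)) * gS e"
      by (intro cong_mult_right f gens_in_U eG)
    also have "\<dots> = r * gS e + (\<Sum>e'\<in>F. b e' * (gT e' * gS e))"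
      by (simp add: distrib_right sum_distrib_right mult.assoc)
    also have "\<dots> \<approx> r * gS e + (\<Sum>e'\<in>F. b e' * (if e' = e then gP (rng G e') else 0))"
      using F eG by (intro cong_add cong_sum cong_refl cong_mult_left CK1 bU) auto
    also have "\<dots> = ?g"
    proof -
      have "(\<Sum>e'\<in>F. b e' * (if e' = e then gP (rng G e') else 0))
          = (\<Sum>e'\<in>F. if e' = e then b e * gP (rng G e) else 0)"
        by (rule sum.cong) auto
      then show ?thesis using F e by simp
    qed
    finally have fS: "f * gS e \<approx> ?g" .
    have "ghost_filt n ?g"
      by (intro ghost_filt.add ghost_filt_mult_S[OF ghost_filt.real[OF r]] ghost_filt_mult_P[OF b]
          gen_verts.range eG)
    moreover have "act ?g \<phi> y = 0" if "y \<in> X" for \<phi> y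
      using act_cong[OF fS that] Suc.prems(2)[OF that] by (metis act_mult)
    ultimately have "?g \<approx> 0"
      by (rule Suc.IH)
    then have "?g * gT e \<approx> 0 * gT e"
      by (intro cong_mult_right gens_in_U eG)
    then have g0: "r * gS e * gT e + b e * (gP (rng G e) * gT e) \<approx> 0"
      by (simp add: distrib_right mult.assoc)
    have "b e * (gP (rng G e) * gT e) \<approx> b e * gT e"
      by (intro cong_mult_left T_range eG bU)
    from cong_trans[OF cong_add[OF cong_refl cong_sym[OF this]] g0]
    have "r * gS e * gT e + b e * gT e - r * gS e * gT e \<approx> 0 - r * gS e * gT e"
      by (intro cong_diff) auto
    then show ?thesis by simp
  qed
  let ?D = "\<Sum>e\<in>F. gS e * gT e :: ('a, 'b, 'k) leavitt_word"
  have DU: "1 - ?D \<in> U"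
    using F by (intro unital_words_closed sum_unital_words gens_in_U) auto
  note f
  also have "r + (\<Sum>e\<in>F. b e * gT e) \<approx> r + (\<Sum>e\<in>F. - (r * gS e * gT e))"
    by (intro cong_add cong_sum bT cong_refl)
  also have "\<dots> = r * (1 - ?D)"
    by (simp add: right_diff_distrib sum_distrib_left mult.assoc sum_negf)
  finally have fr: "f \<approx> r * (1 - ?D)" .
  obtain \<Lambda> l where l: "real_form \<Lambda> l" "r \<approx> (\<Sum>p\<in>\<Lambda>. edge_prod p * proj_comb (l p))"
    using real_elems_form[OF r] .
  \<comment> \<open>A delta function at a point whose first letter is outside \<open>F\<close> is
    fixed by \<open>1 - ?D\<close> on \<open>X\<close>, so there \<open>r\<close> acts like
    \<open>f\<close>.\<close>
  have actr: "act r (delta x) y = 0" if x: "x \<in> X" "first x \<notin> Inl ` F" and y: "y \<in> X" for x y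
  proof -
    have "act (1 - ?D) (delta x) u = (delta x u :: 'k)" if "u \<in> X" for u
      using x that by (auto simp: act_sum act_gS_gT delta_def intro!: sum.neutral)
    then have "act r (act (1 - ?D) (delta x)) y = act r (delta x) y"
      by (intro act_cong_fun y)
    then show ?thesis
      using act_cong[OF fr y, of "delta x"] Suc.prems(2)[OF y] by (simp add: act_mult)
  qed
  have zero: "edge_prod p * (proj_comb (l p) * (1 - ?D)) \<approx> 0" if p: "p \<in> \<Lambda>" for p
  proof -
    have lp: "\<forall>x\<in>set (l p). snd x \<in> gen_verts G" "walk p"
      using l(1) p by (auto simp: real_form_def)
    have "proj_comb (l p) * (1 - ?D) \<approx> 0"
      using act_cong[OF l(2)] actr
      by (intro proj_comb_mult_CK2 lp F real_form_val_zero[OF l(1) _ p]) auto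
    then show ?thesis
      using cong_mult_left[OF _ edge_prod_U[OF lp(2)], of _ 0] by fastforce
  qed
  note fr
  also have "r * (1 - ?D) \<approx> (\<Sum>p\<in>\<Lambda>. edge_prod p * proj_comb (l p)) * (1 - ?D)"
    by (intro cong_mult_right l DU)
  also have "\<dots> = (\<Sum>p\<in>\<Lambda>. edge_prod p * (proj_comb (l p) * (1 - ?D)))"
    by (simp add: sum_distrib_right mult.assoc)
  also have "\<dots> \<approx> (\<Sum>p\<in>\<Lambda>. 0)"
    by (intro cong_sum zero)
  finally show ?case by simp
qed

theorem act_faithful:
  fixes f :: "('a, 'b, 'k::field) leavitt_word"
  assumes "f \<in> carrier (free_algebra (leavitt_gens G))" "\<And>\<phi> y. y \<in> X \<Longrightarrow> act f \<phi> y = 0"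
  shows "f \<approx> 0"
  using ghost_filt_exhausts[OF assms(1)] ghost_filt_faithful assms(2) by blast

end


section \<open>Boundary paths\<close>

context ultragraph
begin

lemma ultragraph: "ultragraph G" ..

definition follows :: "'e + 'v \<Rightarrow> 'e + 'v \<Rightarrow> bool" where
  "follows a b \<longleftrightarrow> b \<in> path_letters G \<and>
     (case a of Inl e \<Rightarrow> letter_src G b \<in> rng G e | Inr w \<Rightarrow> b = Inr w)"

definition paths :: "(nat \<Rightarrow> 'e + 'v) set" where
  "paths = {z. z 0 \<in> path_letters G \<and> (\<forall>i. follows (z i) (z (Suc i)))}"

lemma pathsD: "z \<in> paths \<Longrightarrow> z i \<in> path_letters G" "z \<in> paths \<Longrightarrow> follows (z i) (z (Suc i))"
  by (cases i; auto simp: paths_def follows_def)+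

lemma paths_shift:
  assumes "z \<in> paths"
  shows "(\<lambda>i. z (i + n)) \<in> paths"
  unfolding paths_def using pathsD[OF assms] by simp

lemma paths_Cons:
  assumes "e \<in> edges G" "z \<in> paths" "letter_src G (z 0) \<in> rng G e"
  shows "case_nat (Inl e) z \<in> paths"
proof -
  have "follows (case_nat (Inl e) z i) (case_nat (Inl e) z (Suc i))" for i
    using assms pathsD[OF assms(2)] by (cases i) (auto simp: follows_def)
  then show ?thesis
    using assms(1) by (simp add: paths_def)
qed

lemma verts_letter: "v \<in> verts G \<Longrightarrow> \<exists>b\<in>path_letters G. letter_src G b = v"
  by (cases "sink G v") (force simp: sink_def out_edges_def path_letters_def)+

lemma follows_exists: "a \<in> path_letters G \<Longrightarrow> \<exists>b. follows a b"
proof (cases a)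
  case (Inl e)
  moreover assume "a \<in> path_letters G"
  ultimately obtain v where "v \<in> rng G e" "v \<in> verts G"
    using rng_nonempty rng_subset_verts by fastforce
  then show ?thesis using verts_letter[of v] Inl by (auto simp: follows_def)
qed (auto simp: follows_def)

lemma paths_exist:
  assumes "b \<in> path_letters G"
  shows "\<exists>z\<in>paths. z 0 = b"
proof -
  have "\<exists>z. \<forall>n. (z n \<in> path_letters G \<and> (n = 0 \<longrightarrow> z n = b)) \<and> follows (z n) (z (Suc n))"
    using assms follows_exists by (intro dependent_nat_choice) (auto simp: follows_def)
  then show ?thesis by (auto simp: paths_def)
qed

lemma reaches_refl: "reaches G v v"
  by (simp add: reaches_def)

lemma reaches_trans: "reaches G u v \<Longrightarrow> reaches G v w \<Longrightarrow> reaches G u w"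
  unfolding reaches_def
proof (elim disjE exE conjE)
  fix p q assume "epath G p" "src G (hd p) = u" "v \<in> rng G (last p)"
    "epath G q" "src G (hd q) = v" "w \<in> rng G (last q)"
  then have "epath G (p @ q)" "src G (hd (p @ q)) = u" "w \<in> rng G (last (p @ q))"
    by (auto simp: epath_append epath_def[of G p] epath_def[of G q])
  then show "u = w \<or> (\<exists>p. epath G p \<and> src G (hd p) = u \<and> w \<in> rng G (last p))" by blast
qed auto

lemma reaches_edge: "e \<in> edges G \<Longrightarrow> w \<in> rng G e \<Longrightarrow> reaches G (src G e) w"
  unfolding reaches_def by (intro disjI2 exI[of _ "[e]"]) (simp add: epath_Cons)

lemma follows_reaches:
  "a \<in> path_letters G \<Longrightarrow> follows a b \<Longrightarrow> reaches G (letter_src G a) (letter_src G b)"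
  by (cases a) (auto simp: follows_def reaches_refl reaches_edge)

lemma paths_reaches: "z \<in> paths \<Longrightarrow> reaches G (letter_src G (z 0)) (letter_src G (z n))"
proof (induction n)
  case (Suc n)
  then show ?case
    using reaches_trans follows_reaches pathsD[of z n] by blast
qed (rule reaches_refl)

text \<open>The two shifts may differ, because adding or removing edges changes the lag.\<close>

definition tail_equiv :: "(nat \<Rightarrow> 'c) \<Rightarrow> (nat \<Rightarrow> 'c) \<Rightarrow> bool" where
  "tail_equiv y z \<longleftrightarrow> (\<exists>m n. \<forall>i. y (i + m) = z (i + n))"

lemma tail_equiv_refl: "tail_equiv z z"
  by (auto simp: tail_equiv_def)

lemma tail_equiv_sym: "tail_equiv y z \<Longrightarrow> tail_equiv z y"
  unfolding tail_equiv_def by metis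

lemma tail_equiv_trans:
  assumes "tail_equiv x y" "tail_equiv y z"
  shows "tail_equiv x z"
proof -
  obtain m n m' n' where h: "\<And>i. x (i + m) = y (i + n)" "\<And>i. y (i + m') = z (i + n')"
    using assms by (auto simp: tail_equiv_def)
  have "x (i + (m + m')) = z (i + (n' + n))" for i
    using h(1)[of "i + m'"] h(2)[of "i + n"] by (simp add: ac_simps)
  then show ?thesis unfolding tail_equiv_def by blast
qed

lemma tail_equiv_shift: "tail_equiv z (\<lambda>i. z (i + n))"
  unfolding tail_equiv_def by (intro exI[of _ n] exI[of _ 0]) simp

lemma tail_equiv_Cons: "tail_equiv (case_nat a z) z"
  unfolding tail_equiv_def by (intro exI[of _ 1] exI[of _ 0]) simp

text \<open>The source of a common letter is reached along both paths.\<close>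

lemma tail_equiv_reaches:
  assumes "y \<in> paths" "z \<in> paths" "tail_equiv y z"
  shows "\<exists>u\<in>verts G. reaches G (letter_src G (y 0)) u \<and> reaches G (letter_src G (z 0)) u"
proof -
  obtain m n where "y m = z n"
    using assms(3) by (auto simp: tail_equiv_def dest: spec[of _ 0])
  moreover have "letter_src G (y m) \<in> verts G"
    using pathsD(1)[OF assms(1), of m] by (auto simp: path_letters_def sink_def src_in_verts)
  ultimately show ?thesis
    using paths_reaches assms by metis
qed

section \<open>Boundary paths with an integer degree\<close>

abbreviation graded_paths :: "((nat \<Rightarrow> 'e + 'v) \<times> int) set" where
  "graded_paths \<equiv> paths \<times> UNIV"

fun graded_first :: "(nat \<Rightarrow> 'e + 'v) \<times> int \<Rightarrow> 'e + 'v" where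
  "graded_first (z, k) = z 0"

fun graded_rest :: "(nat \<Rightarrow> 'e + 'v) \<times> int \<Rightarrow> (nat \<Rightarrow> 'e + 'v) \<times> int" where
  "graded_rest (z, k) = (\<lambda>i. z (Suc i), k - 1)"

fun graded_cons :: "'e \<Rightarrow> (nat \<Rightarrow> 'e + 'v) \<times> int \<Rightarrow> (nat \<Rightarrow> 'e + 'v) \<times> int" where
  "graded_cons e (z, k) = (case_nat (Inl e) z, k + 1)"

lemma case_nat_Suc: "case_nat (z 0) (\<lambda>i. z (Suc i)) = z"
  by (rule ext) (simp split: nat.split)

lemma foldr_case_nat:
  "foldr (\<lambda>e. case_nat (Inl e)) p z = (\<lambda>i. if i < length p then Inl (p ! i) else z (i - length p))"
  by (induction p) (auto simp: fun_eq_iff split: nat.split)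

text \<open>The grading by the second component separates prefixes of different lengths, so that no
  condition on cycles is needed for faithfulness.\<close>

lemma separated_branching_graded:
  "separated_branching G graded_paths graded_first graded_rest graded_cons"
proof -
  interpret branching G graded_paths graded_first graded_rest graded_cons
  proof (intro branching.intro branching_axioms.intro ultragraph)
    fix x :: "(nat \<Rightarrow> 'e + 'v) \<times> int" and e assume x: "x \<in> graded_paths"
    show "graded_first x \<in> path_letters G"
      using x pathsD(1)[of "fst x" 0] by auto
    show "graded_rest x \<in> graded_paths \<and>
        letter_src G (graded_first (graded_rest x)) \<in> rng G e \<and> graded_cons e (graded_rest x) = x"
      if "graded_first x = Inl e"
      using that x pathsD(2)[of "fst x" 0] paths_shift[of "fst x" 1] case_nat_Suc[of "fst x"]
      by (cases x) (auto simp: follows_def)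
    show "graded_cons e x \<in> graded_paths \<and> graded_first (graded_cons e x) = Inl e \<and>
        graded_rest (graded_cons e x) = x"
      if "e \<in> edges G" "letter_src G (graded_first x) \<in> rng G e"
      using that x paths_Cons[of e "fst x"]
      by (cases x) auto
  qed
  show ?thesis
  proof
    fix b \<Lambda> assume b: "b \<in> path_letters G" and "finite (\<Lambda> :: 'e list set)"
    obtain z where z: "z \<in> paths" "z 0 = b"
      using paths_exist[OF b] by blast
    have pre: "prepend p (z, 0) = (foldr (\<lambda>e. case_nat (Inl e)) p z, int (length p))" for p
    proof (induction p)
      case (Cons e p)
      have "prepend (e # p) (z, 0) = graded_cons e (prepend p (z, 0))"
        by (rule prepend_simps)
      then show ?case by (simp add: Cons)
    qed (simp add: prepend_simps(1))
    have "inj_on (\<lambda>p. prepend p (z, 0)) \<Lambda>"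
    proof (rule inj_onI)
      fix p q assume "prepend p (z, 0) = prepend q (z, 0)"
      then have len: "length p = length q"
        and eq: "foldr (\<lambda>e. case_nat (Inl e)) p z = foldr (\<lambda>e. case_nat (Inl e)) q z"
        by (auto simp: pre)
      show "p = q"
      proof (rule nth_equalityI[OF len])
        fix i assume "i < length p"
        then show "p ! i = q ! i"
          using fun_cong[OF eq, of i] len by (simp add: foldr_case_nat)
      qed
    qed
    then show "\<exists>x\<in>graded_paths. graded_first x = b \<and> inj_on (\<lambda>p. prepend p x) \<Lambda>"
      using z by (intro bexI[of _ "(z, 0)"]) auto
  qed
qed

end


section \<open>Primitive nonunital rings\<close>

context left_module
begin

lemma smult_zero [simp]: "a \<in> carrier R \<Longrightarrow> a \<odot>\<^bsub>M\<^esub> \<zero>\<^bsub>M\<^esub> = \<zero>\<^bsub>M\<^esub>"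
  using smult_r_distr[of a "\<zero>\<^bsub>M\<^esub>" "\<zero>\<^bsub>M\<^esub>"] smult_closed[of a "\<zero>\<^bsub>M\<^esub>"]
  by (metis M.l_zero M.zero_closed M.add.l_cancel_one')

lemma zero_smult [simp]: "x \<in> carrier M \<Longrightarrow> \<zero> \<odot>\<^bsub>M\<^esub> x = \<zero>\<^bsub>M\<^esub>"
  using smult_l_distr[of \<zero> \<zero> x] smult_closed[of \<zero> x]
  by (metis R.l_zero R.zero_closed M.add.l_cancel_one')

lemma minus_smult: "a \<in> carrier R \<Longrightarrow> x \<in> carrier M \<Longrightarrow> (\<ominus> a) \<odot>\<^bsub>M\<^esub> x = \<ominus>\<^bsub>M\<^esub> (a \<odot>\<^bsub>M\<^esub> x)"
  using smult_l_distr[of "\<ominus> a" a x]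
  by (intro M.minus_equality[symmetric]) (auto simp: R.l_neg smult_closed)

lemma smult_minus: "a \<in> carrier R \<Longrightarrow> x \<in> carrier M \<Longrightarrow> a \<odot>\<^bsub>M\<^esub> (\<ominus>\<^bsub>M\<^esub> x) = \<ominus>\<^bsub>M\<^esub> (a \<odot>\<^bsub>M\<^esub> x)"
  using smult_r_distr[of a "\<ominus>\<^bsub>M\<^esub> x" x]
  by (intro M.minus_equality[symmetric]) (auto simp: M.l_neg smult_closed)

lemma submodule_orbit: "x \<in> carrier M \<Longrightarrow> submodule ((\<lambda>a. a \<odot>\<^bsub>M\<^esub> x) ` carrier R) R M"
proof (intro submodule.intro submodule_axioms.intro M.add.subgroupI)
  assume x: "x \<in> carrier M"
  let ?N = "(\<lambda>a. a \<odot>\<^bsub>M\<^esub> x) ` carrier R"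
  show "?N \<subseteq> carrier M" "?N \<noteq> {}" using x smult_closed by auto
  show "\<ominus>\<^bsub>M\<^esub> y \<in> ?N" if "y \<in> ?N" for y
    using that x by (auto simp: minus_smult[symmetric])
  show "y \<oplus>\<^bsub>M\<^esub> z \<in> ?N" if "y \<in> ?N" "z \<in> ?N" for y z
    using that x by (auto simp: smult_l_distr[symmetric])
  show "b \<odot>\<^bsub>M\<^esub> y \<in> ?N" if "b \<in> carrier R" "y \<in> ?N" for b y
    using that x by (auto simp: smult_assoc[symmetric] m_closed)
qed

lemma submodule_annihilated: "submodule {x \<in> carrier M. \<forall>a\<in>carrier R. a \<odot>\<^bsub>M\<^esub> x = \<zero>\<^bsub>M\<^esub>} R M"
  by (intro submodule.intro submodule_axioms.intro M.add.subgroupI)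
    (auto simp: smult_r_distr smult_minus smult_closed)

text \<open>Without an identity the orbit of \<open>x\<close> could be 0. The vectors killed by all
  of \<open>R\<close> form a submodule, which is proper by faithfulness; so it is 0 and the orbit is
  not.\<close>

lemma simple_generated:
  assumes "simple_module R M" "faithful_module R M" "carrier R \<noteq> {\<zero>}"
    and x: "x \<in> carrier M" "x \<noteq> \<zero>\<^bsub>M\<^esub>"
  shows "(\<lambda>a. a \<odot>\<^bsub>M\<^esub> x) ` carrier R = carrier M"
proof -
  let ?Z = "{x \<in> carrier M. \<forall>a\<in>carrier R. a \<odot>\<^bsub>M\<^esub> x = \<zero>\<^bsub>M\<^esub>}"
  have "\<exists>a\<in>carrier R. a \<noteq> \<zero>"
  proof (rule ccontr)
    assume "\<not> ?thesis"
    then have "carrier R = {\<zero>}" using R.zero_closed by auto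
    with assms(3) show False by simp
  qed
  then obtain a where "a \<in> carrier R" "a \<noteq> \<zero>"
    by blast
  then have "?Z \<noteq> carrier M"
    using assms(2) by (auto simp: faithful_module_def)
  then have "?Z = {\<zero>\<^bsub>M\<^esub>}"
    using assms(1) submodule_annihilated by (auto simp: simple_module_def)
  then obtain a where "a \<in> carrier R" "a \<odot>\<^bsub>M\<^esub> x \<noteq> \<zero>\<^bsub>M\<^esub>"
    using x by blast
  then have "(\<lambda>a. a \<odot>\<^bsub>M\<^esub> x) ` carrier R \<noteq> {\<zero>\<^bsub>M\<^esub>}"
    by auto
  then show ?thesis
    using assms(1) submodule_orbit[OF x(1)] by (auto simp: simple_module_def)
qed

end

text \<open>A nonzero vector \<open>b x\<close> generates the module, so some \<open>c\<close> moves
  it to a vector that \<open>a\<close> does not kill.\<close>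

lemma primitive_ring_prime:
  fixes R (structure)
  assumes "primitive_ring R" and a: "a \<in> carrier R" "a \<noteq> \<zero>" and b: "b \<in> carrier R" "b \<noteq> \<zero>"
  shows "\<exists>c\<in>carrier R. a \<otimes> c \<otimes> b \<noteq> \<zero>"
proof -
  obtain M :: "('a, 'a set) module" where M: "simple_module R M" "faithful_module R M"
    using assms(1) by (auto simp: primitive_ring_def)
  interpret left_module R M using M by (simp add: simple_module_def)
  obtain x where x: "x \<in> carrier M" "b \<odot>\<^bsub>M\<^esub> x \<noteq> \<zero>\<^bsub>M\<^esub>"
    using M(2) b unfolding faithful_module_def by blast
  obtain y where y: "y \<in> carrier M" "a \<odot>\<^bsub>M\<^esub> y \<noteq> \<zero>\<^bsub>M\<^esub>"
    using M(2) a unfolding faithful_module_def by blast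
  obtain c where c: "c \<in> carrier R" "y = c \<odot>\<^bsub>M\<^esub> (b \<odot>\<^bsub>M\<^esub> x)"
    using simple_generated[OF M _ smult_closed[OF b(1) x(1)] x(2)] a y(1) by auto
  then have "(a \<otimes> c \<otimes> b) \<odot>\<^bsub>M\<^esub> x \<noteq> \<zero>\<^bsub>M\<^esub>"
    using y a b x by (simp add: smult_assoc m_closed smult_closed)
  then have "a \<otimes> c \<otimes> b \<noteq> \<zero>"
    using x by auto
  then show ?thesis using c by blast
qed

text \<open>Commutativity makes an element of \<open>e R e\<close> that kills one nonzero vector of \<open>e M\<close> kill all
  of \<open>e M\<close>.\<close>

lemma primitive_ring_commutative_corner:
  fixes R (structure)
  assumes "primitive_ring R" and e: "e \<in> carrier R" "e \<otimes> e = e" "e \<noteq> \<zero>"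
    and comm: "\<And>a b. a \<in> carrier R \<Longrightarrow> b \<in> carrier R \<Longrightarrow>
      e \<otimes> a \<otimes> e \<otimes> b \<otimes> e = e \<otimes> b \<otimes> e \<otimes> a \<otimes> e"
    and t: "t \<in> carrier R" "e \<otimes> t \<otimes> e = t" "t \<noteq> \<zero>"
  shows "\<exists>y\<in>carrier R. y \<otimes> t = e"
proof -
  obtain M :: "('a, 'a set) module" where M: "simple_module R M" "faithful_module R M"
    using assms(1) by (auto simp: primitive_ring_def)
  interpret left_module R M using M by (simp add: simple_module_def)
  note [simp] = m_closed smult_closed e(1) t(1)
  obtain m where "m \<in> carrier M" "e \<odot>\<^bsub>M\<^esub> m \<noteq> \<zero>\<^bsub>M\<^esub>"
    using M(2) e unfolding faithful_module_def by blast
  moreover define x where "x = e \<odot>\<^bsub>M\<^esub> m"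
  ultimately have x: "x \<in> carrier M" "x \<noteq> \<zero>\<^bsub>M\<^esub>" "e \<odot>\<^bsub>M\<^esub> x = x"
    using e by (auto simp: smult_assoc[symmetric])
  have gen: "\<exists>a\<in>carrier R. a \<odot>\<^bsub>M\<^esub> y = z" if "y \<in> carrier M" "y \<noteq> \<zero>\<^bsub>M\<^esub>" "z \<in> carrier M" for y z
    using simple_generated[OF M _ that(1,2)] e that(3) by (metis (no_types, lifting) empty_iff imageE insert_iff)
  have corner: "e \<otimes> s = s \<and> s \<otimes> e = s" if s: "s \<in> carrier R" "e \<otimes> s \<otimes> e = s" for s
  proof -
    have "e \<otimes> s = e \<otimes> e \<otimes> s \<otimes> e" "s \<otimes> e = e \<otimes> s \<otimes> (e \<otimes> e)"
      using s(1) by (subst (1) s(2)[symmetric], simp only: m_assoc m_closed e(1))+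
    then show ?thesis using e s by simp
  qed
  have kill: "s = \<zero>" if s: "s \<in> carrier R" "e \<otimes> s \<otimes> e = s" "s \<odot>\<^bsub>M\<^esub> x = \<zero>\<^bsub>M\<^esub>" for s
  proof -
    have "s \<odot>\<^bsub>M\<^esub> y = \<zero>\<^bsub>M\<^esub>" if y: "y \<in> carrier M" for y
    proof -
      obtain r where r: "r \<in> carrier R" "r \<odot>\<^bsub>M\<^esub> x = e \<odot>\<^bsub>M\<^esub> y"
        using gen[OF x(1,2), of "e \<odot>\<^bsub>M\<^esub> y"] y by auto
      have ey: "e \<odot>\<^bsub>M\<^esub> (e \<odot>\<^bsub>M\<^esub> y) = e \<odot>\<^bsub>M\<^esub> y"
        using smult_assoc[of e e y] e y by simp
      have "s \<odot>\<^bsub>M\<^esub> y = s \<odot>\<^bsub>M\<^esub> (e \<odot>\<^bsub>M\<^esub> y)"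
        using smult_assoc[of s e y] corner[OF s(1,2)] s(1) y by simp
      \<comment> \<open>The vector \<open>e y\<close> equals \<open>e r e x\<close>, and
        \<open>s\<close> can be moved past \<open>e r e\<close> to hit \<open>x\<close>
        first.\<close>
      also have "\<dots> = s \<odot>\<^bsub>M\<^esub> (e \<odot>\<^bsub>M\<^esub> (r \<odot>\<^bsub>M\<^esub> (e \<odot>\<^bsub>M\<^esub> x)))"
        by (simp add: x r ey)
      also have "\<dots> = (s \<otimes> e \<otimes> r \<otimes> e) \<odot>\<^bsub>M\<^esub> x"
        using s(1) r(1) x(1) by (simp add: smult_assoc)
      also have "s \<otimes> e \<otimes> r \<otimes> e = e \<otimes> s \<otimes> e \<otimes> r \<otimes> e"
        using corner[OF s(1,2)] by simp
      also have "\<dots> = e \<otimes> r \<otimes> e \<otimes> s \<otimes> e"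
        by (rule comm[OF s(1) r(1)])
      also have "\<dots> = e \<otimes> r \<otimes> s"
        using s r(1) by (simp add: m_assoc)
      also have "(e \<otimes> r \<otimes> s) \<odot>\<^bsub>M\<^esub> x = \<zero>\<^bsub>M\<^esub>"
        using s r(1) x(1) by (simp add: smult_assoc)
      finally show ?thesis .
    qed
    then show ?thesis
      using M(2) s by (auto simp: faithful_module_def)
  qed
  have "t \<odot>\<^bsub>M\<^esub> x \<noteq> \<zero>\<^bsub>M\<^esub>"
    using kill[OF t(1,2)] t(3) by blast
  then obtain r where r: "r \<in> carrier R" "r \<odot>\<^bsub>M\<^esub> (t \<odot>\<^bsub>M\<^esub> x) = x"
    using gen[of "t \<odot>\<^bsub>M\<^esub> x" x] x by auto
  \<comment> \<open>Since \<open>r t x = x\<close>, this element of the corner kills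
    \<open>x\<close>; so it is 0, and \<open>e r\<close> is a left inverse of
    \<open>t\<close>.\<close>
  define s where "s = e \<otimes> r \<otimes> t \<oplus> \<ominus> e"
  have ee: "e \<otimes> (e \<otimes> r \<otimes> t) \<otimes> e = e \<otimes> r \<otimes> t"
  proof -
    have "e \<otimes> (e \<otimes> r \<otimes> t) \<otimes> e = e \<otimes> e \<otimes> r \<otimes> (t \<otimes> e)"
      using r(1) by (simp add: m_assoc)
    then show ?thesis using e(2) corner[OF t(1,2)] by simp
  qed
  have neg: "e \<otimes> (\<ominus> e) \<otimes> e = \<ominus> e"
  proof (rule R.minus_equality[symmetric])
    have "e \<otimes> (\<ominus> e) \<otimes> e \<oplus> e \<otimes> e \<otimes> e = e \<otimes> (\<ominus> e \<oplus> e) \<otimes> e"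
      by (simp add: l_distr r_distr)
    also have "\<dots> = \<zero>"
    proof -
      have "e \<otimes> \<zero> = \<zero>" "\<zero> \<otimes> e = \<zero>"
        using r_distr[of \<zero> \<zero> e] l_distr[of \<zero> \<zero> e]
        by (metis R.add.l_cancel_one' R.l_zero R.zero_closed e(1) m_closed)+
      then show ?thesis by (simp add: R.l_neg)
    qed
    finally show "e \<otimes> (\<ominus> e) \<otimes> e \<oplus> e = \<zero>" using e by simp
  qed auto
  have "s = \<zero>"
  proof (rule kill)
    show "s \<in> carrier R" using r by (simp add: s_def)
    show "e \<otimes> s \<otimes> e = s"
      using r by (simp add: s_def r_distr l_distr ee neg)
    show "s \<odot>\<^bsub>M\<^esub> x = \<zero>\<^bsub>M\<^esub>"
      using r x by (simp add: s_def smult_l_distr minus_smult smult_assoc M.r_neg)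
  qed
  then have "e \<otimes> r \<otimes> t = e"
    using r by (metis R.add.inv_closed R.add.inv_inv R.minus_equality e(1) m_closed s_def t(1))
  then show ?thesis
    using r by (metis e(1) m_closed)
qed


section \<open>Necessity of the conditions\<close>

context ultragraph
begin

definition coset :: "('v, 'e, 'k::field) leavitt_word \<Rightarrow> ('v, 'e, 'k) leavitt_word set" where
  "coset f = algebra_ideal (leavitt_gens G) (leavitt_relators G) +>\<^bsub>free_algebra (leavitt_gens G)\<^esub> f"

abbreviation F :: "('v, 'e, 'k::field) leavitt_word set" where
  "F \<equiv> carrier (free_algebra (leavitt_gens G))"

lemma in_coset: "g \<in> coset f \<longleftrightarrow> g \<approx> f"
proof -
  have "g \<in> coset f \<longleftrightarrow> (\<exists>i\<in>algebra_ideal (leavitt_gens G) (leavitt_relators G). g = i + f)"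
    by (simp add: coset_def a_r_coset_def')
  also have "\<dots> \<longleftrightarrow> g \<approx> f"
    by (auto simp: cong_def intro: bexI[of _ "g - f"])
  finally show ?thesis .
qed

lemma coset_eq: "coset f = coset g \<longleftrightarrow> f \<approx> g"
proof
  assume "coset f = coset g"
  then show "f \<approx> g" using in_coset[of f f] by (simp add: in_coset)
next
  assume fg: "f \<approx> g"
  have "h \<approx> f \<longleftrightarrow> h \<approx> g" for h
    using cong_trans[OF _ fg] cong_trans[OF _ cong_sym[OF fg]] by blast
  then show "coset f = coset g" by (auto simp: in_coset)
qed

lemma leavitt_carrier: "carrier (leavitt_path_algebra G) = coset ` F"
  by (simp add: leavitt_path_algebra_def carrier_presented_algebra coset_def[abs_def])

lemma leavitt_ops:
  "f \<in> F \<Longrightarrow> g \<in> F \<Longrightarrow> coset f \<oplus>\<^bsub>leavitt_path_algebra G\<^esub> coset g = coset (f + g)"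
  "f \<in> F \<Longrightarrow> g \<in> F \<Longrightarrow> coset f \<otimes>\<^bsub>leavitt_path_algebra G\<^esub> coset g = coset (f * g)"
  "\<zero>\<^bsub>leavitt_path_algebra G\<^esub> = coset 0"
  unfolding leavitt_path_algebra_def coset_def
  using presented_algebra_ops(1,2)[OF leavitt_relators_subset[OF ultragraph], of f g]
    presented_algebra_ops(4)[OF leavitt_relators_subset[OF ultragraph]
      zero_in_free_algebra zero_in_free_algebra]
  by simp_all

declare gen_verts.vertex [simp]

lemma gens_in_F [simp]:
  "A \<in> gen_verts G \<Longrightarrow> gP A \<in> F" "e \<in> edges G \<Longrightarrow> gS e \<in> F" "e \<in> edges G \<Longrightarrow> gT e \<in> F"
  by (auto simp: gP_def gS_def gT_def leavitt_gens_def intro!: word_single_in_free_algebra)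

lemma mult_unital_in_free_algebra:
  assumes "f \<in> carrier (free_algebra Y)" "h \<in> unital_words Y"
  shows "f * h \<in> carrier (free_algebra Y)"
  using assms Poly_Mapping.keys_mult[of f h] by (fastforce simp: in_free_algebra unital_words_def)

interpretation graded: separated_branching G graded_paths graded_first graded_rest graded_cons
  by (rule separated_branching_graded)

lemma graded_base [simp]: "graded.base (z, k) = letter_src G (z 0)"
  by (simp add: graded.base_def )

lemma gP_vertex_nonzero:
  assumes "v \<in> verts G"
  shows "\<not> gP {v} \<approx> (0 :: ('v, 'e, 'k::field) leavitt_word)"
proof
  assume *: "gP {v} \<approx> (0 :: ('v, 'e, 'k) leavitt_word)"
  obtain z where "z \<in> paths" "letter_src G (z 0) = v"
    using verts_letter[OF assms] paths_exist by blast
  then show False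
    using graded.act_cong[OF *, of "(z, 0)" "\<lambda>_. 1"] by simp
qed

lemma graded_run_tail_equiv: "graded.run w x = Some y \<Longrightarrow> tail_equiv (fst x) (fst y)"
proof (induction w arbitrary: x)
  case Nil
  then show ?case by (simp add: tail_equiv_refl)
next
  case (Cons a w)
  then obtain u where u: "graded.step a x = Some u" "graded.run w u = Some y"
    by (auto simp: Option.bind_eq_Some_conv)
  have "tail_equiv (fst x) (fst u)"
    using u(1) tail_equiv_refl tail_equiv_shift[of "fst x" 1] tail_equiv_sym[OF tail_equiv_Cons]
    by (cases x; cases a) (auto split: if_splits)
  then show ?case
    using Cons.IH[OF u(2)] tail_equiv_trans by blast
qed

lemma primitive_downward_directed:
  assumes "primitive_ring (leavitt_path_algebra G :: ('k::field, ('v, 'e, 'k) leavitt_word set) module)"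
  shows "downward_directed G"
  unfolding downward_directed_def
proof (intro ballI)
  let ?L = "leavitt_path_algebra G :: ('k, ('v, 'e, 'k) leavitt_word set) module"
  fix v w assume v: "v \<in> verts G" and w: "w \<in> verts G"
  have P: "(gP {v} :: ('v, 'e, 'k) leavitt_word) \<in> F" "(gP {w} :: ('v, 'e, 'k) leavitt_word) \<in> F"
    using v w by simp_all
  have "\<exists>c\<in>carrier ?L. coset (gP {v}) \<otimes>\<^bsub>?L\<^esub> c \<otimes>\<^bsub>?L\<^esub> coset (gP {w}) \<noteq> \<zero>\<^bsub>?L\<^esub>"
    using P gP_vertex_nonzero v w
    by (intro primitive_ring_prime assms) (auto simp: leavitt_carrier leavitt_ops coset_eq)
  then obtain c :: "('v, 'e, 'k) leavitt_word" where c: "c \<in> F"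
    "coset (gP {v}) \<otimes>\<^bsub>?L\<^esub> coset c \<otimes>\<^bsub>?L\<^esub> coset (gP {w}) \<noteq> \<zero>\<^bsub>?L\<^esub>"
    by (auto simp: leavitt_carrier)
  then have "\<not> gP {v} * c * gP {w} \<approx> 0"
    using P by (simp add: leavitt_ops coset_eq free_algebra_closed)
  then obtain \<phi> y where y: "y \<in> graded_paths" "graded.act (gP {v} * c * gP {w}) \<phi> y \<noteq> 0"
    using graded.act_faithful[of "gP {v} * c * gP {w}"] P c(1) by (auto simp: free_algebra_closed)
  then have base: "graded.base y = v" "graded.act c (graded.act (gP {w}) \<phi>) y \<noteq> 0"
    by (auto simp: graded.act_mult mult.assoc split: if_splits)
  \<comment> \<open>Some word of \<open>c\<close> contributes. It carries \<open>y\<close>, based at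
    \<open>v\<close>, to a point based at \<open>w\<close>, and runs preserve tail
    equivalence.\<close>
  from base(2) obtain x where "graded.ext (graded.act (gP {w}) \<phi>) (graded.run (letters x) y) \<noteq> 0"
    unfolding graded.act_def[of c] by (metis (no_types, lifting) mult_zero_right sum.neutral)
  then obtain u where u: "graded.run (letters x) y = Some u" "graded.base u = w"
    by (cases "graded.run (letters x) y") (auto split: if_splits)
  show "\<exists>u\<in>verts G. reaches G v u \<and> reaches G w u"
    using tail_equiv_reaches[OF _ _ graded_run_tail_equiv[OF u(1)]] graded.run_in[OF y(1) u(1)] y(1)
      base(1) u(2) by (auto simp: graded.base_def)
qed

text \<open>No generator looks at the degree, so every \<open>run\<close> commutes with translations
  of it.\<close>

lemma graded_run_translate:
  "graded.run w (z, k) = map_option (\<lambda>(y, j). (y, j + k)) (graded.run w (z, 0))"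
proof (induction w arbitrary: z k)
  case (Cons a w)
  show ?case
  proof (cases a)
    case (Proj A)
    then show ?thesis using Cons.IH[of z k] by simp
  next
    case (Edge e)
    then show ?thesis
      using Cons.IH[of "\<lambda>i. z (Suc i)" "k - 1"] Cons.IH[of "\<lambda>i. z (Suc i)" "- 1"]
      by (auto simp: option.map_comp fun_eq_iff split_def
          intro!: map_option_cong)
  next
    case (Ghost e)
    then show ?thesis
      using Cons.IH[of "case_nat (Inl e) z" "k + 1"] Cons.IH[of "case_nat (Inl e) z" 1]
      by (auto simp: option.map_comp fun_eq_iff split_def intro!: map_option_cong)
  qed
qed simp

lemma graded_act_edge_prod:
  "graded.act (edge_prod p) \<phi> (z, k) =
     (if \<forall>i<length p. z i = Inl (p ! i) then \<phi> (\<lambda>i. z (i + length p), k - int (length p)) else 0)"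
proof (induction p arbitrary: z k)
  case (Cons e p)
  have "(\<forall>i<length (e # p). z i = Inl ((e # p) ! i)) \<longleftrightarrow>
      z 0 = Inl e \<and> (\<forall>i<length p. z (Suc i) = Inl (p ! i))"
    by (simp add: All_less_Suc2)
  then show ?case
    by (auto simp: graded.act_mult Cons.IH algebra_simps)
qed simp

text \<open>For a vertex \<open>v\<close> from which only one boundary path \<open>z\<close> starts, the elements of the corner
  act on the functions on \<open>{z} \<times> \<int>\<close> as combinations of translations.\<close>

lemma graded_corner_commute:
  fixes a b :: "('v, 'e, 'k::field) leavitt_word"
  assumes v: "v \<in> verts G" and z: "\<And>y. y \<in> paths \<Longrightarrow> letter_src G (y 0) = v \<Longrightarrow> y = z"
    and ab: "a \<in> F" "b \<in> F"
  shows "gP {v} * a * gP {v} * b * gP {v} \<approx> gP {v} * b * gP {v} * a * gP {v}"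
proof -
  let ?e = "gP {v} :: ('v, 'e, 'k) leavitt_word"
  have translate: "\<exists>\<alpha> d. \<forall>\<psi> k. (\<forall>x\<in>graded_paths. graded.base x \<noteq> v \<longrightarrow> \<psi> x = 0) \<longrightarrow>
      graded.act c \<psi> (z, k) = (\<Sum>w\<in>Poly_Mapping.keys c. \<alpha> w * \<psi> (z, k + d w))"
    if zp: "z \<in> paths" for c :: "('v, 'e, 'k) leavitt_word"
  proof -
    \<comment> \<open>A run that ends off \<open>z\<close> ends at a point not based at
      \<open>v\<close>, as \<open>z\<close> is the only path from \<open>v\<close>; there \<psi>
      vanishes, so the coefficient may be set to 0.\<close>
    define \<alpha> where "\<alpha> w = (case graded.run (letters w) (z, 0) of None \<Rightarrow> 0
      | Some u \<Rightarrow> if fst u = z then Poly_Mapping.lookup c w else 0)" for w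
    define d where "d w = (case graded.run (letters w) (z, 0) of None \<Rightarrow> 0 | Some u \<Rightarrow> snd u)" for w
    have "graded.act c \<psi> (z, k) = (\<Sum>w\<in>Poly_Mapping.keys c. \<alpha> w * \<psi> (z, k + d w))"
      if \<psi>: "\<forall>x\<in>graded_paths. graded.base x \<noteq> v \<longrightarrow> \<psi> x = 0" for \<psi> k
      unfolding graded.act_def
    proof (rule sum.cong[OF refl])
      fix w
      show "Poly_Mapping.lookup c w * graded.ext \<psi> (graded.run (letters w) (z, k))
          = \<alpha> w * \<psi> (z, k + d w)"
      proof (cases "graded.run (letters w) (z, 0)")
        case None
        then show ?thesis by (simp add: graded_run_translate[of _ z k] \<alpha>_def)
      next
        case (Some u)
        then have "(fst u, snd u + k) \<in> graded_paths"
          using graded.run_in[OF _ Some] zp by auto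
        then have "\<psi> (fst u, snd u + k) = 0" if "fst u \<noteq> z"
          using \<psi>[rule_format, of "(fst u, snd u + k)"] z[of "fst u"] that by auto
        then show ?thesis
          using Some by (auto simp: graded_run_translate[of _ z k] \<alpha>_def d_def split_def add.commute)
      qed
    qed
    then show ?thesis
      by (intro exI[of _ \<alpha>] exI[of _ d]) simp
  qed
  have "?e * a * ?e * b * ?e - ?e * b * ?e * a * ?e \<approx> 0"
  proof (rule graded.act_faithful)
    show "?e * a * ?e * b * ?e - ?e * b * ?e * a * ?e \<in> F"
      using ab v by (auto intro!: free_algebra_closed)
    fix \<phi> :: "_ \<Rightarrow> 'k" and y assume y: "y \<in> graded_paths"
    show "graded.act (?e * a * ?e * b * ?e - ?e * b * ?e * a * ?e) \<phi> y = 0"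
    proof (cases "graded.base y = v")
      case False
      then show ?thesis by (simp add: mult.assoc) (simp add: graded.act_mult)
    next
      case True
      have "fst y = z"
        by (rule z) (use y True in \<open>cases y; simp\<close>)+
      then obtain k where yk: "y = (z, k)"
        by (cases y) auto
      then have zp: "z \<in> paths" and zv: "letter_src G (z 0) = v"
        using y True by simp_all
      define \<psi> where "\<psi> = graded.act ?e \<phi>"
      have act_comp: "graded.act (f * g) \<chi> = graded.act f (graded.act g \<chi>)"
        for f g :: "('v, 'e, 'k) leavitt_word" and \<chi>
        by (rule HOL.ext) (rule graded.act_mult)
      \<comment> \<open>The left projection is the identity at \<open>y\<close>, and the right one
        is absorbed in \<psi>.\<close>
      have swap: "graded.act (?e * a * ?e * b * ?e) \<phi> y = graded.act a (graded.act ?e (graded.act b \<psi>)) y" for a b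
        using True by (simp only: act_comp \<psi>_def graded.act_gens singleton_iff simp_thms if_True)
      obtain \<alpha> d where a: "\<And>\<psi> k. (\<forall>x\<in>graded_paths. graded.base x \<noteq> v \<longrightarrow> \<psi> x = 0) \<Longrightarrow>
          graded.act a \<psi> (z, k) = (\<Sum>w\<in>Poly_Mapping.keys a. \<alpha> w * \<psi> (z, k + d w))"
        using translate[OF zp, of a] by blast
      obtain \<beta> c where b: "\<And>\<psi> k. (\<forall>x\<in>graded_paths. graded.base x \<noteq> v \<longrightarrow> \<psi> x = 0) \<Longrightarrow>
          graded.act b \<psi> (z, k) = (\<Sum>w\<in>Poly_Mapping.keys b. \<beta> w * \<psi> (z, k + c w))"
        using translate[OF zp, of b] by blast
      have \<psi>: "\<forall>x\<in>graded_paths. graded.base x \<noteq> v \<longrightarrow> \<psi> x = 0"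
        by (simp add: \<psi>_def)
      have "graded.act a (graded.act ?e (graded.act b \<psi>)) y
          = (\<Sum>w\<in>Poly_Mapping.keys a. \<alpha> w * (\<Sum>w'\<in>Poly_Mapping.keys b. \<beta> w' * \<psi> (z, k + d w + c w')))"
        by (simp add: yk a b[OF \<psi>] zv)
      also have "\<dots> = (\<Sum>w'\<in>Poly_Mapping.keys b. \<beta> w' * (\<Sum>w\<in>Poly_Mapping.keys a. \<alpha> w * \<psi> (z, k + c w' + d w)))"
        unfolding sum_distrib_left
        by (subst sum.swap) (simp add: ac_simps)
      also have "\<dots> = graded.act b (graded.act ?e (graded.act a \<psi>)) y"
        by (simp add: yk b a[OF \<psi>] zv)
      finally show ?thesis
        by (simp add: swap)
    qed
  qed
  then show ?thesis
    by (simp add: cong_def)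
qed

lemma primitive_has_exit:
  assumes prim: "primitive_ring (leavitt_path_algebra G :: ('k::field, ('v, 'e, 'k) leavitt_word set) module)"
    and cyc: "cycle G p"
  shows "has_exit G p"
proof (rule ccontr)
  assume no_exit: "\<not> has_exit G p"
  let ?L = "leavitt_path_algebra G :: ('k, ('v, 'e, 'k) leavitt_word set) module"
  define n where "n = length p"
  define v where "v = src G (hd p)"
  \<comment> \<open>The periodic boundary path that repeats \<open>p\<close>.\<close>
  define c where "c i = (Inl (p ! (i mod n)) :: 'e + 'v)" for i
  let ?e = "gP {v} :: ('v, 'e, 'k) leavitt_word"
  have p: "epath G p" "v \<in> rng G (last p)" "set p \<subseteq> edges G" "p \<noteq> []" "n > 0"
    using cyc by (auto simp: cycle_def v_def n_def epath_def)
  have v: "v \<in> verts G"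
    using p rng_subset_verts last_in_set by blast
  \<comment> \<open>Absence of exits leaves one admissible letter after each letter of the cycle, so
    only one boundary path can start at \<open>v\<close>.\<close>
  have next_letter: "b = c (Suc i)" if "b \<in> path_letters G" "letter_src G b \<in> rng G (p ! (i mod n))" for b i
  proof -
    have i: "i mod n < length p" "Suc (i mod n) mod length p = Suc i mod n"
      using p by (auto simp: n_def mod_Suc_eq)
    show ?thesis
    proof (cases b)
      case (Inl e)
      have "\<forall>e\<in>edges G. \<forall>j<length p. src G e \<in> rng G (p ! j) \<longrightarrow> e = p ! (Suc j mod length p)"
        using no_exit by (auto simp: has_exit_def)
      then have "e = p ! (Suc (i mod n) mod length p)"
        using that i(1) Inl by auto
      then show ?thesis using i(2) Inl by (simp add: c_def)
    next
      case (Inr w)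
      then show ?thesis using that no_exit i by (auto simp: has_exit_def)
    qed
  qed
  have unique: "z = c" if z: "z \<in> paths" "letter_src G (z 0) = v" for z
  proof
    fix i show "z i = c i"
    proof (induction i)
      case 0
      \<comment> \<open>The letter before position 0 is the last edge of the cycle, so the induction
        starts by wrapping around.\<close>
      have "last p = p ! ((n - 1) mod n)"
        using p by (simp add: last_conv_nth n_def)
      then have "z 0 = c (Suc (n - 1))"
        using p z pathsD(1)[OF z(1), of 0] by (intro next_letter) auto
      then show ?case using p by (simp add: c_def)
    next
      case (Suc i)
      then have "letter_src G (z (Suc i)) \<in> rng G (p ! (i mod n))"
        using pathsD(2)[OF z(1), of i] by (simp add: follows_def c_def)
      then show ?case
        by (intro next_letter pathsD z)
    qed
  qed
  obtain z where "z \<in> paths" "letter_src G (z 0) = v"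
    using verts_letter[OF v] paths_exist by blast
  then have c: "c \<in> paths" "letter_src G (c 0) = v"
    using unique[of z] by auto
  have eF: "?e \<in> F"
    using v by (simp add: gen_verts.vertex)
  \<comment> \<open>The factors \<open>?e\<close> on both sides put the product into
    \<open>F\<close>, as \<open>edge_prod p\<close> is only known to lie in \<open>U\<close>. On the
    fiber over \<open>c\<close> this element is the identity minus the translation by
    \<open>n\<close>.\<close>
  define t where "t = ?e - ?e * edge_prod p * ?e"
  have "edge_prod p \<in> U"
    using p by (intro edge_prod_U) (simp add: walk_def)
  then have tF: "t \<in> F"
    using eF unfolding t_def by (intro free_algebra_closed mult_unital_in_free_algebra)
  have ee: "?e * ?e \<approx> ?e"
    using P_inter[of "{v}" "{v}"] v by (simp add: gen_verts.vertex)
  have act_t: "graded.act t \<phi> y =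
      (if graded.base y = v then \<phi> (c, snd y) - \<phi> (c, snd y - int n) else 0)"
    if y_in: "y \<in> graded_paths" for \<phi> y
  proof (cases "graded.base y = v")
    case True
    have "fst y = c"
      by (rule unique) (use y_in True in \<open>cases y; simp\<close>)+
    then obtain k where y: "y = (c, k)"
      by (cases y) auto
    have "(\<lambda>i. c (i + length p)) = c"
      by (simp add: c_def n_def fun_eq_iff)
    moreover have "\<forall>i<length p. c i = Inl (p ! i)"
      by (simp add: c_def n_def)
    ultimately show ?thesis
      using c by (simp add: t_def graded.act_mult mult.assoc y)
        (simp add: graded_act_edge_prod n_def)
  next
    case False
    then show ?thesis by (simp add: t_def mult.assoc) (simp add: graded.act_mult)
  qed
  have ete: "?e * t * ?e \<approx> t"
  proof -
    have "?e * t * ?e - t \<approx> 0"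
      using eF tF act_t
      by (intro graded.act_faithful) (auto simp: free_algebra_closed graded.act_mult c)
    then show ?thesis by (simp add: cong_def)
  qed
  have t0: "\<not> t \<approx> 0"
  proof
    assume "t \<approx> 0"
    then show False
      using graded.act_cong[of t 0 "(c, 0)" "\<lambda>x. if x = (c, 0) then 1 else 0"] c p(5)
      by (simp add: act_t)
  qed
  have "\<exists>y\<in>carrier ?L. y \<otimes>\<^bsub>?L\<^esub> coset t = coset ?e"
  proof (rule primitive_ring_commutative_corner[OF prim])
    show "coset ?e \<in> carrier ?L" "coset t \<in> carrier ?L"
      using eF tF by (auto simp: leavitt_carrier)
    show "coset ?e \<otimes>\<^bsub>?L\<^esub> coset ?e = coset ?e"
      using ee eF by (simp add: leavitt_ops coset_eq)
    show "coset ?e \<noteq> \<zero>\<^bsub>?L\<^esub>" "coset t \<noteq> \<zero>\<^bsub>?L\<^esub>"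
      using gP_vertex_nonzero[OF v] t0 by (auto simp: leavitt_ops coset_eq)
    show "coset ?e \<otimes>\<^bsub>?L\<^esub> coset t \<otimes>\<^bsub>?L\<^esub> coset ?e = coset t"
      using ete eF tF by (simp add: leavitt_ops coset_eq free_algebra_closed)
    fix a b assume "a \<in> carrier ?L" "b \<in> carrier ?L"
    then obtain a' b' where "a' \<in> F" "b' \<in> F" "a = coset a'" "b = coset b'"
      by (auto simp: leavitt_carrier)
    then show "coset ?e \<otimes>\<^bsub>?L\<^esub> a \<otimes>\<^bsub>?L\<^esub> coset ?e \<otimes>\<^bsub>?L\<^esub> b \<otimes>\<^bsub>?L\<^esub> coset ?e
        = coset ?e \<otimes>\<^bsub>?L\<^esub> b \<otimes>\<^bsub>?L\<^esub> coset ?e \<otimes>\<^bsub>?L\<^esub> a \<otimes>\<^bsub>?L\<^esub> coset ?e"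
      using eF graded_corner_commute[OF v unique, of a' b']
      by (simp add: leavitt_ops coset_eq free_algebra_closed)
  qed
  then obtain y where y: "y \<in> F" "y * t \<approx> ?e"
    using tF by (auto simp: leavitt_carrier leavitt_ops coset_eq)
  define \<phi> :: "(nat \<Rightarrow> 'e + 'v) \<times> int \<Rightarrow> 'k" where "\<phi> x = (if fst x = c then 1 else 0)" for x
  have "graded.act y (graded.act t \<phi>) (c, 0) = graded.act y (\<lambda>_. 0) (c, 0)"
    using c by (intro graded.act_cong_fun) (auto simp: act_t \<phi>_def)
  then show False
    using graded.act_cong[OF y(2), of "(c, 0)" \<phi>] c by (simp add: graded.act_mult \<phi>_def)
qed

end


section \<open>The module of finitely supported functions\<close>

context branching
begin

definition finite_functions :: "('z \<Rightarrow> 'k::field) set" where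
  "finite_functions = {\<phi>. finite {x. \<phi> x \<noteq> 0} \<and> (\<forall>x. x \<notin> X \<longrightarrow> \<phi> x = 0)}"

text \<open>An element of the algebra is a coset, so a representative has to be chosen;
  \<open>act_cong\<close> makes the choice harmless on \<open>X\<close>, and the junk outside is set
  to 0.\<close>

definition function_module :: "(('v, 'e, 'k::field) leavitt_word set, 'z \<Rightarrow> 'k) module" where
  "function_module = \<lparr>carrier = finite_functions, mult = undefined, one = undefined,
     zero = (\<lambda>_. 0), add = (\<lambda>\<phi> \<psi> x. \<phi> x + \<psi> x),
     smult = (\<lambda>a \<phi> x. if x \<in> X then act (SOME f. f \<in> a) \<phi> x else 0)\<rparr>"

lemma function_module_simps [simp]:
  "carrier function_module = finite_functions" "zero function_module = (\<lambda>_. 0)"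
  "add function_module = (\<lambda>\<phi> \<psi> x. \<phi> x + \<psi> x)"
  by (simp_all add: function_module_def)

lemma function_module_smult:
  "smult function_module (coset f) \<phi> = (\<lambda>x. if x \<in> X then act f \<phi> x else 0)"
proof -
  have "(SOME g. g \<in> coset f) \<in> coset f"
    by (rule someI[of _ f]) (simp add: in_coset)
  then have "act (SOME g. g \<in> coset f) \<phi> x = act f \<phi> x" if "x \<in> X" for x
    using that by (intro act_cong) (simp add: in_coset)
  then show ?thesis
    by (auto simp: function_module_def)
qed

text \<open>Each word acts through an injective partial map, so the preimage of a finite support is
  finite.\<close>

lemma finite_functions_act:
  assumes "\<phi> \<in> finite_functions"
  shows "(\<lambda>x. if x \<in> X then act f \<phi> x else 0) \<in> finite_functions"
proof -
  let ?S = "\<lambda>w. {x \<in> X. ext \<phi> (run (letters w) x) \<noteq> 0}"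
  have "finite (?S w)" for w
  proof (rule finite_imageD)
    have "(\<lambda>x. the (run (letters w) x)) ` ?S w \<subseteq> {x. \<phi> x \<noteq> 0}"
      by (auto simp: ext_def split: option.splits)
    then show "finite ((\<lambda>x. the (run (letters w) x)) ` ?S w)"
      using assms finite_subset by (auto simp: finite_functions_def)
    show "inj_on (\<lambda>x. the (run (letters w) x)) (?S w)"
    proof (rule inj_onI)
      fix x y assume "x \<in> ?S w" "y \<in> ?S w" "the (run (letters w) x) = the (run (letters w) y)"
      then show "x = y"
        using run_inj[of x y "letters w"] by (auto simp: ext_def split: option.splits)
    qed
  qed
  moreover have "{x. (if x \<in> X then act f \<phi> x else 0) \<noteq> 0} \<subseteq> (\<Union>w\<in>Poly_Mapping.keys f. ?S w)"
  proof
    fix x assume "x \<in> {x. (if x \<in> X then act f \<phi> x else 0) \<noteq> 0}"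
    then have "x \<in> X" "act f \<phi> x \<noteq> 0" by (auto split: if_splits)
    then obtain w where "w \<in> Poly_Mapping.keys f" "ext \<phi> (run (letters w) x) \<noteq> 0"
      unfolding act_def by (metis (no_types, lifting) mult_zero_right sum.neutral)
    then show "x \<in> (\<Union>w\<in>Poly_Mapping.keys f. ?S w)"
      using \<open>x \<in> X\<close> by blast
  qed
  ultimately have "finite {x. (if x \<in> X then act f \<phi> x else 0) \<noteq> 0}"
    by (meson finite_UN finite_keys finite_subset)
  then show ?thesis
    by (simp add: finite_functions_def)
qed

lemma finite_functions_closed:
  "(\<lambda>_. 0) \<in> finite_functions"
  "\<phi> \<in> finite_functions \<Longrightarrow> \<psi> \<in> finite_functions \<Longrightarrow> (\<lambda>x. \<phi> x + \<psi> x) \<in> finite_functions"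
  "\<phi> \<in> finite_functions \<Longrightarrow> (\<lambda>x. - \<phi> x) \<in> finite_functions"
proof -
  assume *: "\<phi> \<in> finite_functions" "\<psi> \<in> finite_functions"
  have "{x. \<phi> x + \<psi> x \<noteq> 0} \<subseteq> {x. \<phi> x \<noteq> 0} \<union> {x. \<psi> x \<noteq> 0}" by auto
  moreover have "finite ({x. \<phi> x \<noteq> 0} \<union> {x. \<psi> x \<noteq> 0})"
    using * by (simp add: finite_functions_def)
  ultimately have "finite {x. \<phi> x + \<psi> x \<noteq> 0}"
    by (rule finite_subset)
  with * show "(\<lambda>x. \<phi> x + \<psi> x) \<in> finite_functions"
    by (simp add: finite_functions_def)
qed (auto simp: finite_functions_def)

lemma left_module_function_module:
  "left_module (leavitt_path_algebra G :: ('k::field, ('v, 'e, 'k) leavitt_word set) module)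
     function_module"
proof -
  let ?L = "leavitt_path_algebra G :: ('k, ('v, 'e, 'k) leavitt_word set) module"
  let ?M = "function_module :: (('v, 'e, 'k) leavitt_word set, 'z \<Rightarrow> 'k) module"
  have M: "abelian_group ?M"
  proof (rule abelian_groupI)
    fix \<phi> assume "\<phi> \<in> carrier ?M"
    then show "\<exists>\<psi>\<in>carrier ?M. \<psi> \<oplus>\<^bsub>?M\<^esub> \<phi> = \<zero>\<^bsub>?M\<^esub>"
      by (intro bexI[of _ "\<lambda>x. - \<phi> x"]) (simp_all add: finite_functions_closed)
  qed (simp_all add: finite_functions_closed add_ac)
  show ?thesis
  proof (intro left_module.intro left_module_axioms.intro M
      nonunital_ring_leavitt_path_algebra ultragraph)
    fix a \<phi> assume "a \<in> carrier ?L" and \<phi>: "\<phi> \<in> carrier ?M"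
    then obtain f where f: "f \<in> F" "a = coset f" by (auto simp: leavitt_carrier)
    then show "a \<odot>\<^bsub>?M\<^esub> \<phi> \<in> carrier ?M"
      using \<phi> finite_functions_act[of \<phi> f] by (simp add: function_module_smult)
    show "a \<odot>\<^bsub>?M\<^esub> (\<phi> \<oplus>\<^bsub>?M\<^esub> \<psi>) = a \<odot>\<^bsub>?M\<^esub> \<phi> \<oplus>\<^bsub>?M\<^esub> a \<odot>\<^bsub>?M\<^esub> \<psi>" for \<psi>
      by (auto simp: f function_module_smult act_fun_add)
    fix b assume "b \<in> carrier ?L"
    then obtain g where g: "g \<in> F" "b = coset g" by (auto simp: leavitt_carrier)
    show "(a \<oplus>\<^bsub>?L\<^esub> b) \<odot>\<^bsub>?M\<^esub> \<phi> = a \<odot>\<^bsub>?M\<^esub> \<phi> \<oplus>\<^bsub>?M\<^esub> b \<odot>\<^bsub>?M\<^esub> \<phi>"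
      using f g by (auto simp: leavitt_ops function_module_smult)
    have "act f (\<lambda>x. if x \<in> X then act g \<phi> x else 0) y = act f (act g \<phi>) y" if "y \<in> X" for y
      using that by (intro act_cong_fun) auto
    then show "(a \<otimes>\<^bsub>?L\<^esub> b) \<odot>\<^bsub>?M\<^esub> \<phi> = a \<odot>\<^bsub>?M\<^esub> (b \<odot>\<^bsub>?M\<^esub> \<phi>)"
      using f g by (auto simp: leavitt_ops function_module_smult act_mult)
  qed
qed

end

lemma (in separated_branching) faithful_function_module:
  "faithful_module (leavitt_path_algebra G :: ('k::field, ('a, 'b, 'k) leavitt_word set) module)
     function_module"
  unfolding faithful_module_def
proof (intro conjI left_module_function_module ballI impI)
  let ?L = "leavitt_path_algebra G :: ('k, ('a, 'b, 'k) leavitt_word set) module"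
  let ?M = "function_module :: (('a, 'b, 'k) leavitt_word set, 'c \<Rightarrow> 'k) module"
  fix a assume "a \<in> carrier ?L" and zero: "\<forall>\<phi>\<in>carrier ?M. a \<odot>\<^bsub>?M\<^esub> \<phi> = \<zero>\<^bsub>?M\<^esub>"
  then obtain f where f: "f \<in> F" "a = coset f" by (auto simp: leavitt_carrier)
  have fin: "act f \<phi> y = 0" if "\<phi> \<in> finite_functions" "y \<in> X" for \<phi> y
    using zero[rule_format, of \<phi>] that by (auto simp: f function_module_smult dest: fun_cong[of _ _ y])
  have "act f \<phi> y = 0" if y: "y \<in> X" for \<phi> :: "'c \<Rightarrow> 'k" and y
  proof -
    \<comment> \<open>\<open>act f \<phi> y\<close> only depends on the values of \<open>\<phi>\<close> at finitely many points.\<close>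
    define S where "S = {u. \<exists>w\<in>Poly_Mapping.keys f. run (letters w) y = Some u}"
    have "S \<subseteq> (\<lambda>w. the (run (letters w) y)) ` Poly_Mapping.keys f"
      by (force simp: S_def)
    then have S: "finite S"
      by (rule finite_subset) simp
    have "S \<subseteq> X"
      using run_in[OF y] by (auto simp: S_def)
    have "act f \<phi> y = act f (\<lambda>x. if x \<in> S then \<phi> x else 0) y"
      unfolding act_def by (rule sum.cong) (auto simp: ext_def S_def split: option.split)
    also have "\<dots> = 0"
      using S \<open>S \<subseteq> X\<close> y by (intro fin) (auto simp: finite_functions_def)
    finally show ?thesis .
  qed
  then have "f \<approx> 0"
    by (intro act_faithful f)
  then show "a = \<zero>\<^bsub>?L\<^esub>"
    using f by (simp add: leavitt_ops coset_eq)
qed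


section \<open>Tail equivalence classes\<close>

context ultragraph
begin

definition tail_class :: "(nat \<Rightarrow> 'e + 'v) \<Rightarrow> (nat \<Rightarrow> 'e + 'v) set" where
  "tail_class q = {z \<in> paths. tail_equiv z q}"

abbreviation head :: "(nat \<Rightarrow> 'e + 'v) \<Rightarrow> 'e + 'v" where
  "head z \<equiv> z 0"

abbreviation tail :: "(nat \<Rightarrow> 'e + 'v) \<Rightarrow> nat \<Rightarrow> 'e + 'v" where
  "tail z \<equiv> \<lambda>i. z (Suc i)"

lemma tail_class_shift: "z \<in> tail_class q \<Longrightarrow> (\<lambda>i. z (i + n)) \<in> tail_class q"
  using tail_equiv_trans[OF tail_equiv_sym[OF tail_equiv_shift]] paths_shift
  by (auto simp: tail_class_def)

lemma paths_sink:
  assumes z: "z \<in> paths" and w: "sink G w" and "letter_src G (z 0) = w"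
  shows "z i = Inr w"
proof (induction i)
  case 0
  show ?case
    using pathsD(1)[OF z, of 0] assms by (cases "z 0") (auto simp: sink_def out_edges_def)
next
  case (Suc i)
  then show ?case
    using pathsD(2)[OF z, of i] by (simp add: follows_def)
qed

lemma branching_tail_class:
  "branching G (tail_class q) head tail (\<lambda>e. case_nat (Inl e))"
proof (intro branching.intro branching_axioms.intro ultragraph)
  fix z e assume z: "z \<in> tail_class q"
  then have zp: "z \<in> paths" by (simp add: tail_class_def)
  show "head z \<in> path_letters G"
    by (rule pathsD(1)[OF zp])
  show "tail z \<in> tail_class q \<and> letter_src G (head (tail z)) \<in> rng G e \<and> case_nat (Inl e) (tail z) = z"
    if "head z = Inl e"
    using that pathsD(2)[OF zp, of 0] tail_class_shift[OF z, of 1] case_nat_Suc[of z]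
    by (auto simp: follows_def)
  show "case_nat (Inl e) z \<in> tail_class q \<and> head (case_nat (Inl e) z) = Inl e \<and>
      tail (case_nat (Inl e) z) = z"
    if "e \<in> edges G" "letter_src G (head z) \<in> rng G e"
    using that z paths_Cons[OF _ zp] tail_equiv_trans[OF tail_equiv_Cons, of z q]
    by (auto simp: tail_class_def)
qed

section \<open>Gluing prefixes onto paths\<close>

definition glue :: "nat \<Rightarrow> (nat \<Rightarrow> 'e + 'v) \<Rightarrow> (nat \<Rightarrow> 'e + 'v) \<Rightarrow> nat \<Rightarrow> 'e + 'v" where
  "glue n x y = (\<lambda>i. if i < n then x i else y (i - n))"

lemma glue_shift [simp]: "(\<lambda>i. glue n x y (i + n)) = y"
  by (simp add: glue_def)

lemma glue_inject: "glue n x u = glue n x v \<Longrightarrow> u = v"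
proof -
  assume "glue n x u = glue n x v"
  then have "(\<lambda>i. glue n x u (i + n)) = (\<lambda>i. glue n x v (i + n))" by (simp only:)
  then show "u = v" by (simp only: glue_shift)
qed

lemma glue_self: "glue n x (\<lambda>i. x (i + n)) = x"
  by (auto simp: glue_def)

lemma glue_Suc: "glue n x (case_nat (x n) y) = glue (Suc n) x y"
proof
  fix i
  consider "i < n" | "i = n" | k where "i = Suc (n + k)"
    by (metis less_iff_Suc_add linorder_neqE_nat)
  then show "glue n x (case_nat (x n) y) i = glue (Suc n) x y i"
    by cases (auto simp: glue_def Suc_diff_le)
qed

lemma glue_tail_class:
  assumes x: "x \<in> paths" and y: "y \<in> tail_class q" and "follows (x n) (y 0)"
  shows "glue (Suc n) x y \<in> tail_class q"
proof -
  have yp: "y \<in> paths" using y by (simp add: tail_class_def)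
  have "follows (glue (Suc n) x y i) (glue (Suc n) x y (Suc i))" for i
  proof -
    consider "i < n" | "i = n" | "i > n" by linarith
    then show ?thesis
    proof cases
      case 3
      then have "Suc i - Suc n = Suc (i - Suc n)" by simp
      then show ?thesis using 3 pathsD(2)[OF yp, of "i - Suc n"] by (simp add: glue_def)
    qed (use assms pathsD(2)[OF x] in \<open>simp_all add: glue_def\<close>)
  qed
  then have "glue (Suc n) x y \<in> paths"
    using pathsD(1)[OF x] by (simp add: paths_def glue_def)
  moreover have "tail_equiv (glue (Suc n) x y) y"
    using tail_equiv_shift[of "glue (Suc n) x y" "Suc n"] by (simp only: glue_shift)
  ultimately show ?thesis
    using y tail_equiv_trans by (auto simp: tail_class_def)
qed


subsection \<open>Simplicity\<close>

text \<open>Take a nonzero function of least support in a submodule and a point \<open>x\<close> of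
  its support. Deleting initial letters of \<open>x\<close> keeps it in the submodule, and if the
  support had a second point, deleting letters past a difference would shrink it. So a multiple of a
  delta function lies in the submodule, and deleting and adding letters moves it through the whole
  tail class.\<close>

lemma simple_function_module:
  assumes q: "q \<in> paths"
  shows "simple_module (leavitt_path_algebra G :: ('k::field, ('v, 'e, 'k) leavitt_word set) module)
    (branching.function_module G (tail_class q) head tail (\<lambda>e. case_nat (Inl e)))"
proof -
  interpret branching G "tail_class q" head tail "\<lambda>e. case_nat (Inl e)"
    by (rule branching_tail_class)
  let ?L = "leavitt_path_algebra G :: ('k, ('v, 'e, 'k) leavitt_word set) module"
  let ?M = "function_module :: (('v, 'e, 'k) leavitt_word set, _) module"
  let ?X = "tail_class q"
  have delta_in: "(\<lambda>y. k * delta x y :: 'k) \<in> finite_functions" if "x \<in> ?X" for x k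
    using that by (auto simp: finite_functions_def delta_def)
  have Xp: "x \<in> paths" if "x \<in> ?X" for x
    using that by (simp add: tail_class_def)
  have follows_of_Cons: "follows b (y 0)" if "case_nat b y \<in> ?X" for b y
    using pathsD(2)[OF Xp[OF that], of 0] by simp
  have full: "N = carrier ?M" if N: "submodule N ?L ?M" and N0: "N \<noteq> {\<zero>\<^bsub>?M\<^esub>}" for N
  proof -
    interpret N: submodule N ?L ?M by (rule N)
    have Nsub: "\<phi> \<in> finite_functions" if "\<phi> \<in> N" for \<phi>
      using N.subset that by auto
    have Nact: "(\<lambda>x. if x \<in> ?X then act f \<phi> x else 0) \<in> N" if "f \<in> F" "\<phi> \<in> N" for f \<phi>
      using N.smult_closed[of "coset f" \<phi>] that by (simp add: leavitt_carrier function_module_smult)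
    have Nadd: "(\<lambda>x. \<phi> x + \<psi> x) \<in> N" if "\<phi> \<in> N" "\<psi> \<in> N" for \<phi> \<psi>
      using N.m_closed[OF that] by simp
    have Nzero: "(\<lambda>_. 0) \<in> N"
      using N.one_closed by simp
    have outside: "\<phi> x = 0" if "\<phi> \<in> N" "x \<notin> ?X" for \<phi> x
      using Nsub that by (auto simp: finite_functions_def)
    \<comment> \<open>Deleting an initial edge from the points of the support is the action of
      \<open>gT e\<close>. A sink letter repeats forever, so deleting it is only the restriction by
      \<open>gP {w}\<close>.\<close>
    have pull: "(\<lambda>y. \<phi> (case_nat b y)) \<in> N" if \<phi>: "\<phi> \<in> N" and b: "b \<in> path_letters G" for \<phi> b
    proof (cases b)
      case (Inl e)
      have e: "e \<in> edges G" using b Inl by simp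
      have "\<phi> (case_nat b y) = (if y \<in> ?X then act (gT e) \<phi> y else 0)" for y
      proof (cases "case_nat b y \<in> ?X")
        case True
        then have "tail (case_nat b y) \<in> ?X" "letter_src G (y 0) \<in> rng G e"
          using rest[OF True, of e] follows_of_Cons[OF True] Inl by (auto simp: follows_def)
        then show ?thesis using e Inl by (simp add: base_def)
      next
        case False
        then show ?thesis
          using outside[OF \<phi>] cons[OF e, of y] Inl by (auto simp: base_def)
      qed
      then show ?thesis
        using Nact[of "gT e" \<phi>] e \<phi> by simp
    next
      case (Inr w)
      have w: "sink G w" using b Inr by simp
      have "\<phi> (case_nat b y) = (if y \<in> ?X then act (gP {w}) \<phi> y else 0)" for y
      proof (cases "y \<in> ?X \<and> letter_src G (y 0) = w")
        case True
        have "y i = Inr w" for i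
          using paths_sink[OF Xp w] True by blast
        then have "case_nat b y = y"
          using Inr by (auto simp: fun_eq_iff split: nat.split)
        then show ?thesis using True by (simp add: base_def)
      next
        case False
        have "case_nat b y \<notin> ?X"
        proof
          assume *: "case_nat b y \<in> ?X"
          have "y 0 = Inr w" "y \<in> ?X"
            using follows_of_Cons[OF *] tail_class_shift[OF *, of 1] Inr by (auto simp: follows_def)
          then show False using False by simp
        qed
        then show ?thesis using False outside[OF \<phi>] by (auto simp: base_def)
      qed
      then show ?thesis
        using Nact[of "gP {w}" \<phi>] w \<phi> by (simp add: sink_def)
    qed
    \<comment> \<open>The reverse operation, adding an initial letter, by \<open>gS e\<close> or
      again by \<open>gP {w}\<close>.\<close>
    have push: "(\<lambda>y. if y \<in> ?X \<and> y 0 = b then \<phi> (tail y) else 0) \<in> N"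
      if \<phi>: "\<phi> \<in> N" and b: "b \<in> path_letters G" for \<phi> b
    proof (cases b)
      case (Inl e)
      have "(\<lambda>y. if y \<in> ?X \<and> y 0 = b then \<phi> (tail y) else 0) =
          (\<lambda>x. if x \<in> ?X then act (gS e) \<phi> x else 0)"
        using Inl by auto
      then show ?thesis
        using Nact[of "gS e" \<phi>] Inl b \<phi> by simp
    next
      case (Inr w)
      have w: "sink G w" using b Inr by simp
      have "(if y \<in> ?X \<and> y 0 = b then \<phi> (tail y) else 0) = (if y \<in> ?X then act (gP {w}) \<phi> y else 0)"
        for y
      proof (cases "y \<in> ?X \<and> letter_src G (y 0) = w")
        case True
        then have "y i = Inr w" for i
          using paths_sink[OF Xp w] by blast
        then have "y = (\<lambda>_. Inr w)"
          by (simp add: fun_eq_iff)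
        then show ?thesis using True Inr by (simp add: base_def)
      next
        case False
        then show ?thesis using Inr by (auto simp: base_def)
      qed
      then show ?thesis
        using Nact[of "gP {w}" \<phi>] w \<phi> by (simp add: sink_def)
    qed
    have pull_many: "(\<lambda>y. \<phi> (glue n x y)) \<in> N" if "\<phi> \<in> N" "x \<in> ?X" for \<phi> x n
    proof (induction n)
      case 0
      then show ?case using that by (simp add: glue_def)
    next
      case (Suc n)
      show ?case
        using pull[OF Suc, of "x n"] pathsD(1)[OF Xp[OF that(2)], of n] by (simp add: glue_Suc)
    qed
    \<comment> \<open>The letters of \<open>x\<close> are put back one at a time, the deepest one
      first.\<close>
    have push_many: "(\<lambda>y. k * delta x y) \<in> N"
      if "(\<lambda>y. k * delta (\<lambda>i. x (i + n)) y) \<in> N" "x \<in> ?X" for k x n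
      using that(1)
    proof (induction n)
      case (Suc n)
      have "(if y \<in> ?X \<and> y 0 = x n then k * delta (\<lambda>i. x (i + Suc n)) (tail y) else 0)
          = k * delta (\<lambda>i. x (i + n)) y" for y
      proof (cases "y = (\<lambda>i. x (i + n))")
        case True
        then show ?thesis using tail_class_shift[OF that(2), of n] by (simp add: delta_def)
      next
        case False
        then have "\<not> (y 0 = x n \<and> tail y = (\<lambda>i. x (i + Suc n)))"
          using case_nat_Suc[of y] case_nat_Suc[of "\<lambda>i. x (i + n)"] by auto
        then show ?thesis using False by (auto simp: delta_def)
      qed
      then have "(\<lambda>y. k * delta (\<lambda>i. x (i + n)) y) \<in> N"
        using push[OF Suc.prems, of "x n"] pathsD(1)[OF Xp[OF that(2)], of n] by simp
      then show ?case by (rule Suc.IH)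
    qed simp
    obtain \<phi>0 where "\<phi>0 \<in> N" "\<phi>0 \<noteq> (\<lambda>_. 0)"
      using N0 Nzero by auto
    then obtain \<phi> where \<phi>: "\<phi> \<in> N" "\<phi> \<noteq> (\<lambda>_. 0)"
      and least: "\<And>\<psi>. \<psi> \<in> N \<Longrightarrow> \<psi> \<noteq> (\<lambda>_. 0) \<Longrightarrow> card {x. \<phi> x \<noteq> 0} \<le> card {x. \<psi> x \<noteq> 0}"
      using ex_has_least_nat[of "\<lambda>\<psi>. \<psi> \<in> N \<and> \<psi> \<noteq> (\<lambda>_. 0)" \<phi>0 "\<lambda>\<psi>. card {x. \<psi> x \<noteq> 0}"] by blast
    obtain x where x: "\<phi> x \<noteq> 0" "x \<in> ?X"
      using \<phi> outside[OF \<phi>(1)] by (metis ext)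
    have single: "\<phi> y = 0" if neq: "y \<noteq> x" for y
    proof (rule ccontr)
      assume y: "\<phi> y \<noteq> 0"
      \<comment> \<open>Gluing \<open>Suc n\<close> letters of \<open>x\<close> covers the position
        \<open>n\<close> where \<open>y\<close> differs, so \<open>y\<close> leaves the
        support.\<close>
      obtain n where n: "y n \<noteq> x n" using neq by (auto simp: fun_eq_iff)
      let ?\<psi> = "\<lambda>y. \<phi> (glue (Suc n) x y)"
      have fin: "finite {x. \<phi> x \<noteq> 0}" using Nsub[OF \<phi>(1)] by (simp add: finite_functions_def)
      have "?\<psi> (\<lambda>i. x (i + Suc n)) \<noteq> 0" using x(1) unfolding glue_self .
      then have "?\<psi> \<noteq> (\<lambda>_. 0)" by metis
      then have "card {x. \<phi> x \<noteq> 0} \<le> card {x. ?\<psi> x \<noteq> 0}"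
        by (rule least[OF pull_many[OF \<phi>(1) x(2)]])
      moreover have "inj_on (glue (Suc n) x) {x. ?\<psi> x \<noteq> 0}"
        by (rule inj_onI) (rule glue_inject)
      then have "card (glue (Suc n) x ` {x. ?\<psi> x \<noteq> 0}) = card {x. ?\<psi> x \<noteq> 0}"
        by (rule card_image)
      moreover have "glue (Suc n) x u \<noteq> y" for u
      proof
        assume "glue (Suc n) x u = y"
        then have "glue (Suc n) x u n = y n" by (rule fun_cong)
        then show False using n by (simp add: glue_def)
      qed
      then have "glue (Suc n) x ` {x. ?\<psi> x \<noteq> 0} \<subseteq> {x. \<phi> x \<noteq> 0} - {y}"
        by auto
      then have "card (glue (Suc n) x ` {x. ?\<psi> x \<noteq> 0}) \<le> card ({x. \<phi> x \<noteq> 0} - {y})"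
        by (rule card_mono[rotated]) (simp add: fin)
      moreover have "card ({x. \<phi> x \<noteq> 0} - {y}) < card {x. \<phi> x \<noteq> 0}"
        using y fin by (intro card_Diff1_less) auto
      ultimately show False by linarith
    qed
    have point: "(\<lambda>y. c * delta z y) \<in> N" if z: "z \<in> ?X" for z c
    proof -
      have "tail_equiv z x"
        using z x tail_equiv_trans[OF _ tail_equiv_sym] unfolding tail_class_def by blast
      then obtain m n where mn: "(\<lambda>i. z (i + m)) = (\<lambda>i. x (i + n))"
        by (auto simp: tail_equiv_def)
      have "\<phi> (glue n x y) = \<phi> x * delta (\<lambda>i. x (i + n)) y" for y
      proof (cases "y = (\<lambda>i. x (i + n))")
        case True
        then show ?thesis by (simp add: glue_self delta_def)
      next
        case False
        then have "glue n x y \<noteq> x"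
          using glue_inject[of n x y "\<lambda>i. x (i + n)"] by (auto simp: glue_self)
        then show ?thesis using False single by (simp add: delta_def)
      qed
      then have "(\<lambda>y. \<phi> x * delta (\<lambda>i. z (i + m)) y) \<in> N"
        using pull_many[OF \<phi>(1) x(2), of n] mn by simp
      then have *: "(\<lambda>y. \<phi> x * delta z y) \<in> N"
        by (rule push_many) (rule z)
      \<comment> \<open>Submodules are closed under the algebra only, so the rescaling is done by a
        scaled vertex projection, which acts as a scalar on the delta function at
        \<open>z\<close>.\<close>
      have gP: "(gP {base z} :: ('v, 'e, 'k) leavitt_word) \<in> F"
        using base_in[OF z] by simp
      have P: "scale (c / \<phi> x) (gP {base z}) \<in> F"
        by (rule free_algebra_closed(5)[OF gP gP])
      have "(if y \<in> ?X then act (scale (c / \<phi> x) (gP {base z})) (\<lambda>y. \<phi> x * delta z y) y else 0)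
          = c * delta z y" for y
        using x z by (auto simp: delta_def)
      then show ?thesis
        using Nact[OF P *] by simp
    qed
    have "\<psi> \<in> N" if "finite S" "S \<subseteq> ?X" "\<And>x. x \<notin> S \<Longrightarrow> \<psi> x = 0" for S and \<psi> :: "_ \<Rightarrow> 'k"
      using that
    proof (induction S arbitrary: \<psi> rule: finite_induct)
      case empty
      then have "\<psi> = (\<lambda>_. 0)" by auto
      then show ?case using Nzero by simp
    next
      case (insert z S)
      have "(\<lambda>x. if x = z then 0 else \<psi> x) \<in> N"
        using insert.prems by (intro insert.IH) auto
      then have "(\<lambda>x. \<psi> z * delta z x + (if x = z then 0 else \<psi> x)) \<in> N"
        using point[of z] insert.prems by (intro Nadd) auto
      moreover have "(\<lambda>x. \<psi> z * delta z x + (if x = z then 0 else \<psi> x)) = \<psi>"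
        by (auto simp: delta_def)
      ultimately show ?case by simp
    qed
    then have "\<psi> \<in> N" if "\<psi> \<in> finite_functions" for \<psi>
      using that[unfolded finite_functions_def] by (metis (mono_tags, lifting) mem_Collect_eq subsetI)
    then show ?thesis
      using N.subset by auto
  qed
  have "q \<in> ?X"
    using q tail_equiv_refl by (simp add: tail_class_def)
  then have "(\<lambda>y. 1 * delta q y :: 'k) \<in> carrier ?M"
    using delta_in[of q 1] by simp
  moreover have "(\<lambda>y. 1 * delta q y :: 'k) \<noteq> (\<lambda>_. 0)"
  proof
    assume "(\<lambda>y. 1 * delta q y :: 'k) = (\<lambda>_. 0)"
    from fun_cong[OF this, of q] show False by (simp add: delta_def)
  qed
  ultimately have "carrier ?M \<noteq> {\<zero>\<^bsub>?M\<^esub>}"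
    by auto
  then show ?thesis
    unfolding simple_module_def using left_module_function_module full by blast
qed

end


subsection \<open>Faithfulness\<close>

context ultragraph
begin

lemma period_multiple:
  fixes z :: "nat \<Rightarrow> 'c"
  assumes "\<And>i. z (i + m) = z i"
  shows "z (i + m * k) = z i"
proof (induction k)
  case (Suc k)
  then show ?case using assms[of "i + m * k"] by (simp add: algebra_simps)
qed simp

text \<open>If prefixes of different lengths give the same path, then \<open>z\<close> starts with
  an edge and has the length difference \<open>m\<close> as a period. As \<open>m \<le> N\<close>
  divides N!, also N! is a period, against both alternatives.\<close>

lemma inj_on_prepend_aperiodic:
  fixes \<Lambda> :: "'e list set" and z :: "nat \<Rightarrow> 'e + 'v"
  assumes len: "\<And>p. p \<in> \<Lambda> \<Longrightarrow> length p \<le> N"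
    and z: "(\<exists>w. z 0 = Inr w) \<or> (\<exists>i. z (i + fact N) \<noteq> z i)"
  shows "inj_on (\<lambda>p. foldr (\<lambda>e. case_nat (Inl e)) p z) \<Lambda>"
proof -
  have le: "length q \<le> length p"
    if eq: "foldr (\<lambda>e. case_nat (Inl e)) p z = foldr (\<lambda>e. case_nat (Inl e)) q z" and "q \<in> \<Lambda>" for p q
  proof (rule ccontr)
    assume "\<not> length q \<le> length p"
    then obtain m where m: "length q = length p + m" "m > 0"
      by (metis less_imp_add_positive not_le)
    have at: "z j = (if j + length p < length q then Inl (q ! (j + length p)) else z (j + length p - length q))"
      for j
      using fun_cong[OF eq, of "j + length p"] by (simp add: foldr_case_nat)
    have "z (i + m) = z i" for i
      using at[of "i + m"] m by simp
    moreover have "m dvd fact N"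
      using m len[OF \<open>q \<in> \<Lambda>\<close>] by (intro dvd_fact) auto
    ultimately have "z (i + fact N) = z i" for i
      using period_multiple[of z m i] by (auto elim!: dvdE)
    then show False
      using z at[of 0] m by auto
  qed
  show ?thesis
  proof (rule inj_onI)
    fix p q assume pq: "p \<in> \<Lambda>" "q \<in> \<Lambda>"
      and eq: "foldr (\<lambda>e. case_nat (Inl e)) p z = foldr (\<lambda>e. case_nat (Inl e)) q z"
    have len: "length p = length q"
      using le[OF eq pq(2)] le[OF eq[symmetric] pq(1)] by simp
    show "p = q"
    proof (rule nth_equalityI[OF len])
      fix i assume "i < length p"
      then show "p ! i = q ! i"
        using fun_cong[OF eq, of i] len by (simp add: foldr_case_nat)
    qed
  qed
qed

text \<open>A closed path of minimal length inside a periodic path is a cycle.\<close>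

lemma periodic_exit:
  assumes exits: "\<And>p. cycle G p \<Longrightarrow> has_exit G p"
    and z: "z \<in> paths" "z 0 = Inl e" and period: "\<And>i. z (i + M) = z i" "M > 0"
  shows "\<exists>i b. follows (z i) b \<and> b \<noteq> z (Suc i)"
proof -
  have edge: "\<exists>e\<in>edges G. z i = Inl e" for i
  proof (cases "z i")
    case (Inl e)
    then show ?thesis using pathsD(1)[OF z(1), of i] by auto
  next
    case (Inr w)
    have "z (i + j) = Inr w" for j
    proof (induction j)
      case (Suc j)
      then show ?case using pathsD(2)[OF z(1), of "i + j"] by (simp add: follows_def)
    qed (simp add: Inr)
    \<comment> \<open>\<open>M * i\<close> is at least \<open>i\<close> and a multiple of the
      period, so the sink letter would reappear at position 0.\<close>
    then have "z (i + (M * i - i)) = Inr w" .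
    moreover have "z (M * i) = z 0"
      using period_multiple[of z M 0 i] period(1) by simp
    ultimately show ?thesis using z(2) period(2) by simp
  qed
  define f where "f i = (THE e. z i = Inl e)" for i
  have f: "z i = Inl (f i)" "f i \<in> edges G" for i
    using edge[of i] by (auto simp: f_def)
  have step: "src G (f (Suc i)) \<in> rng G (f i)" for i
    using pathsD(2)[OF z(1), of i] by (simp add: follows_def f)
  \<comment> \<open>Sources are compared, not edges: a cycle may not repeat a source, whereas
    \<open>z\<close> may return to one and leave it by another edge.\<close>
  define P where "P d \<longleftrightarrow> d > 0 \<and> (\<exists>i. src G (f (i + d)) = src G (f i))" for d
  have "P M"
    using period by (auto simp: P_def f_def)
  define d where "d = (LEAST d. P d)"
  have "P d"
    unfolding d_def by (rule LeastI) (rule \<open>P M\<close>)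
  then obtain i where d: "d > 0" "src G (f (i + d)) = src G (f i)"
    by (auto simp: P_def)
  define p where "p = map (\<lambda>k. f (i + k)) [0..<d]"
  have p: "length p = d" "\<And>k. k < d \<Longrightarrow> p ! k = f (i + k)" "p \<noteq> []"
    using d by (auto simp: p_def)
  have "cycle G p"
    unfolding cycle_def
  proof (intro conjI)
    show "epath G p"
      unfolding epath_def using p f step by (auto simp: in_set_conv_nth)
    have "i + d = Suc (i + (d - 1))" using d by simp
    then have "src G (f (i + d)) \<in> rng G (f (i + (d - 1)))"
      using step[of "i + (d - 1)"] by simp
    then show "src G (hd p) \<in> rng G (last p)"
      using p d by (simp add: hd_conv_nth last_conv_nth)
    have "src G (f (i + k)) \<noteq> src G (f (i + l))" if "k < l" "l < d" for k l
    proof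
      assume "src G (f (i + k)) = src G (f (i + l))"
      then have "P (l - k)"
        using that unfolding P_def by (intro conjI exI[of _ "i + k"]) auto
      then have "d \<le> l - k"
        unfolding d_def by (rule Least_le)
      then show False using that by simp
    qed
    then show "distinct (map (src G) p)"
      using p by (auto simp: distinct_conv_nth) (metis linorder_neqE_nat)
  qed
  then have "has_exit G p"
    by (rule exits)
  then consider (edge) e k where "e \<in> edges G" "k < d" "src G e \<in> rng G (p ! k)" "e \<noteq> p ! (Suc k mod d)"
    | (sink) w k where "sink G w" "k < d" "w \<in> rng G (p ! k)"
    using p(1) unfolding has_exit_def by blast
  then show ?thesis
  proof cases
    case edge
    have e: "follows (z (i + k)) (Inl e)"
      using edge p(2) by (simp add: follows_def f)
    show ?thesis
    \<comment> \<open>The edge leaves the closed path \<open>p\<close>, but \<open>z\<close> itself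
      may take it where \<open>p\<close> closes up. Then the first edge of \<open>p\<close> is a
      different letter that could follow.\<close>
    proof (cases "Inl e = z (Suc (i + k))")
      case False
      with e show ?thesis by blast
    next
      case True
      have "Suc k = d"
      proof (rule ccontr)
        assume "Suc k \<noteq> d"
        then have "Suc k < d" using edge by simp
        then show False using edge p(2)[of "Suc k"] True by (simp add: f)
      qed
      then have "e \<noteq> f i" using edge p(2)[of 0] d by simp
      then have "z i \<noteq> z (Suc (i + k))" using True f(1)[of i] by (metis sum.inject(1))
      moreover have "follows (z (i + k)) (z i)"
        using step[of "i + k"] d(2) \<open>Suc k = d\<close> f by (auto simp: follows_def)
      ultimately show ?thesis by blast
    qed
  next
    case sink
    then have "follows (z (i + k)) (Inr w)" "Inr w \<noteq> z (Suc (i + k))"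
      using p(2) by (simp_all add: follows_def f)
    then show ?thesis by blast
  qed
qed

definition cofinal :: "(nat \<Rightarrow> 'e + 'v) \<Rightarrow> bool" where
  "cofinal q \<longleftrightarrow> q \<in> paths \<and> (\<forall>v\<in>verts G. \<exists>z\<in>tail_class q. letter_src G (z 0) = v)"

lemma cofinal_letter:
  assumes q: "cofinal q" and b: "b \<in> path_letters G"
  shows "\<exists>z\<in>tail_class q. z 0 = b"
proof (cases b)
  case (Inl e)
  then have e: "e \<in> edges G" using b by simp
  then obtain v where "v \<in> rng G e" "v \<in> verts G"
    using rng_nonempty rng_subset_verts by blast
  then obtain z where "z \<in> tail_class q" "letter_src G (z 0) \<in> rng G e"
    using q by (auto simp: cofinal_def)
  then have "case_nat (Inl e) z \<in> tail_class q"
    using branching.cons[OF branching_tail_class e] by blast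
  then show ?thesis
    using Inl by (intro bexI[of _ "case_nat (Inl e) z"]) simp_all
next
  case (Inr w)
  then have w: "sink G w" using b by simp
  then obtain z where z: "z \<in> tail_class q" "letter_src G (z 0) = w"
    using q by (auto simp: cofinal_def sink_def)
  then show ?thesis
    using paths_sink[of z w 0] w Inr by (auto simp: tail_class_def)
qed

lemma separated_branching_tail_class:
  assumes exits: "\<And>p. cycle G p \<Longrightarrow> has_exit G p" and q: "cofinal q"
  shows "separated_branching G (tail_class q) head tail (\<lambda>e. case_nat (Inl e))"
proof -
  interpret branching G "tail_class q" head tail "\<lambda>e. case_nat (Inl e)"
    by (rule branching_tail_class)
  show ?thesis
  proof
    fix b and \<Lambda> :: "'e list set" assume b: "b \<in> path_letters G" and \<Lambda>: "finite \<Lambda>"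
    obtain N where N: "\<And>p. p \<in> \<Lambda> \<Longrightarrow> length p \<le> N"
      using finite_nat_set_iff_bounded_le[of "length ` \<Lambda>"] \<Lambda> by auto
    \<comment> \<open>Differences of lengths in \<Lambda> are at most \<open>N\<close>, so the
      positive ones divide N!; it is enough to avoid this one period.\<close>
    let ?M = "fact N :: nat"
    have "\<exists>z\<in>tail_class q. z 0 = b \<and> ((\<exists>w. z 0 = Inr w) \<or> (\<exists>i. z (i + ?M) \<noteq> z i))"
    proof -
      obtain z where z: "z \<in> tail_class q" "z 0 = b"
        using cofinal_letter[OF q b] by blast
      have zp: "z \<in> paths" using z by (simp add: tail_class_def)
      show ?thesis
      proof (cases "(\<exists>w. z 0 = Inr w) \<or> (\<exists>i. z (i + ?M) \<noteq> z i)")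
        case True
        then show ?thesis using z by blast
      next
        case False
        then obtain e where e: "z 0 = Inl e" by (cases "z 0") auto
        have period: "z (i + ?M) = z i" for i using False by blast
        obtain i b' where i: "follows (z i) b'" "b' \<noteq> z (Suc i)"
          using periodic_exit[OF exits zp e period] by auto
        then have "b' \<in> path_letters G" by (simp add: follows_def)
        then obtain y where y: "y \<in> tail_class q" "y 0 = b'"
          using cofinal_letter[OF q] by blast
        \<comment> \<open>Leaving \<open>z\<close> only after a full period destroys that period.\<close>
        let ?x = "glue (Suc (i + ?M)) z y"
        have "?x \<in> tail_class q"
          using i y period[of i] by (intro glue_tail_class zp) auto
        moreover have "?x (Suc i + ?M) \<noteq> ?x (Suc i)"
          using i y by (simp add: glue_def)
        moreover have "?x 0 = b"
          using z by (simp add: glue_def)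
        ultimately show ?thesis by blast
      qed
    qed
    then obtain z where z: "z \<in> tail_class q" "z 0 = b"
      "(\<exists>w. z 0 = Inr w) \<or> (\<exists>i. z (i + ?M) \<noteq> z i)"
      by blast
    have "inj_on (\<lambda>p. prepend p z) \<Lambda>"
      unfolding prepend_def using N z(3) by (rule inj_on_prepend_aperiodic)
    then show "\<exists>x\<in>tail_class q. head x = b \<and> inj_on (\<lambda>p. prepend p x) \<Lambda>"
      using z by blast
  qed
qed


subsection \<open>A path that every vertex reaches\<close>

lemma attach_path:
  assumes "reaches G v (letter_src G (z 0))" "z \<in> tail_class q"
  shows "\<exists>y\<in>tail_class q. letter_src G (y 0) = v"
proof -
  have "\<exists>y\<in>tail_class q. letter_src G (y 0) = src G (hd p)"
    if "epath G p" "letter_src G (z 0) \<in> rng G (last p)" for p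
    using that
  proof (induction p)
    case Nil
    then show ?case by (simp add: epath_def)
  next
    case (Cons e p)
    then have e: "e \<in> edges G" by (simp add: epath_Cons)
    have "\<exists>y\<in>tail_class q. letter_src G (y 0) \<in> rng G e"
    proof (cases "p = []")
      case True
      then show ?thesis using Cons.prems assms by auto
    next
      case False
      then obtain y where "y \<in> tail_class q" "letter_src G (y 0) = src G (hd p)"
        using Cons by (auto simp: epath_Cons)
      then show ?thesis
        using False Cons.prems by (intro bexI[of _ y]) (simp_all add: epath_Cons)
    qed
    then obtain y where "y \<in> tail_class q" "letter_src G (y 0) \<in> rng G e" by blast
    then have "case_nat (Inl e) y \<in> tail_class q"
      using branching.cons[OF branching_tail_class e] by blast
    then show ?case by force
  qed
  then show ?thesis
    using assms by (auto simp: reaches_def)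
qed

lemma sink_reaches:
  assumes "sink G w" "reaches G w u"
  shows "u = w"
proof (rule ccontr)
  assume "u \<noteq> w"
  then obtain p where "epath G p" "src G (hd p) = w"
    using assms(2) by (auto simp: reaches_def)
  then have "hd p \<in> out_edges G w"
    using hd_in_set[of p] by (auto simp: epath_def out_edges_def)
  then show False
    using assms(1) by (simp add: sink_def)
qed

text \<open>A sink reaches only itself, so a common lower bound of \<open>v\<close> and
  \<open>w\<close> is \<open>w\<close>.\<close>

lemma cofinal_sink:
  assumes dir: "downward_directed G" and w: "sink G w"
  shows "cofinal (\<lambda>_. Inr w)"
proof -
  have q: "(\<lambda>_. Inr w) \<in> paths"
    using w by (simp add: paths_def follows_def)
  have "\<exists>z\<in>tail_class (\<lambda>_. Inr w). letter_src G (z 0) = v" if v: "v \<in> verts G" for v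
  proof (rule attach_path)
    obtain u where "reaches G v u" "reaches G w u"
      using dir v w unfolding downward_directed_def sink_def by blast
    then show "reaches G v (letter_src G ((\<lambda>_. Inr w) (0::nat)))"
      using sink_reaches[OF w] by auto
    show "(\<lambda>_. Inr w) \<in> tail_class (\<lambda>_. Inr w)"
      using q tail_equiv_refl by (simp add: tail_class_def)
  qed
  then show ?thesis using q by (simp add: cofinal_def)
qed

text \<open>Without sinks every lower bound of two vertices can be moved along one more edge, so the
  enumerated vertices can be absorbed one after the other by a path of growing length.\<close>

lemma cofinal_no_sink:
  assumes dir: "downward_directed G" and no_sink: "\<And>w. \<not> sink G w" and ne: "verts G \<noteq> {}"
  shows "\<exists>q. cofinal q"
proof -
  define \<nu> where "\<nu> = from_nat_into (verts G)"
  have \<nu>: "\<nu> n \<in> verts G" for n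
    by (simp add: \<nu>_def from_nat_into ne)
  have surj: "\<exists>n. v = \<nu> n" if "v \<in> verts G" for v
    using from_nat_into_surj[OF countable_verts that] by (auto simp: \<nu>_def)
  \<comment> \<open>A state is a finite path with a vertex at which it is to be continued; stage
    \<open>n\<close> makes that vertex reachable from \<open>\<nu> n\<close>. The condition
    \<open>r \<noteq> []\<close> makes the lengths unbounded.\<close>
  define extends where "extends n s t \<longleftrightarrow> (\<exists>r. r \<noteq> [] \<and> fst t = fst s @ r \<and>
    src G (hd r) = snd s \<and> reaches G (\<nu> n) (snd t))" for n :: nat and s t :: "'e list \<times> 'v"
  define ok where "ok s \<longleftrightarrow> snd s \<in> verts G \<and>
    (fst s = [] \<or> epath G (fst s) \<and> snd s \<in> rng G (last (fst s)))" for s :: "'e list \<times> 'v"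
  have "\<exists>f. \<forall>n. ok (f n) \<and> extends n (f n) (f (Suc n))"
  proof (rule dependent_nat_choice)
    show "\<exists>s. ok s"
      using \<nu>[of 0] by (intro exI[of _ "([], \<nu> 0)"]) (simp add: ok_def)
    fix s n assume s: "ok s"
    then obtain u where u: "u \<in> verts G" "reaches G (snd s) u" "reaches G (\<nu> n) u"
      using dir \<nu>[of n] by (auto simp: downward_directed_def ok_def)
    \<comment> \<open>The vertex \<open>u\<close> may be the present endpoint, so one further edge
      is taken to make the path grow.\<close>
    obtain e where e: "e \<in> edges G" "src G e = u"
      using no_sink[of u] u by (auto simp: sink_def out_edges_def)
    obtain u' where u': "u' \<in> rng G e" "u' \<in> verts G"
      using rng_nonempty[OF e(1)] rng_subset_verts[OF e(1)] by blast
    have "reaches G (\<nu> n) u'"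
      using u(3) reaches_edge[OF e(1) u'(1)] e(2) reaches_trans by blast
    moreover obtain r where r: "epath G r" "src G (hd r) = snd s" "u' \<in> rng G (last r)"
    proof (cases "snd s = u")
      case True
      then show ?thesis using that[of "[e]"] e u' by (simp add: epath_Cons)
    next
      case False
      then obtain r where "epath G r" "src G (hd r) = snd s" "u \<in> rng G (last r)"
        using u(2) by (auto simp: reaches_def)
      moreover from this have "r \<noteq> []" by (simp add: epath_def)
      ultimately show ?thesis using that[of "r @ [e]"] e u' by (simp add: epath_append epath_Cons)
    qed
    moreover have "r \<noteq> []" using r(1) by (simp add: epath_def)
    moreover have "epath G (fst s @ r)"
      using s r \<open>r \<noteq> []\<close> by (cases "fst s = []") (auto simp: ok_def epath_append)
    ultimately show "\<exists>t. ok t \<and> extends n s t"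
      using u' by (intro exI[of _ "(fst s @ r, u')"]) (auto simp: ok_def extends_def)
  qed
  then obtain f where f: "\<And>n. ok (f n)" "\<And>n. extends n (f n) (f (Suc n))"
    by blast
  define p where "p n = fst (f n)" for n
  have len: "length (p n) < length (p (Suc n))" for n
    using f(2)[of n] by (auto simp: extends_def p_def)
  then have len_ge: "n \<le> length (p n)" for n
    by (induction n) (auto intro: le_less_trans simp: Suc_le_eq)
  have nth_step: "p (Suc n) ! i = p n ! i" if "i < length (p n)" for n i
    using f(2)[of n] that by (auto simp: extends_def p_def nth_append)
  have nth_le: "p m ! i = p n ! i" if "n \<le> m" "i < length (p n)" for n m i
    using that
  proof (induction m rule: dec_induct)
    case (step m)
    have "length (p n) \<le> length (p m)"
      using lift_Suc_mono_le[of "\<lambda>n. length (p n)"] len step(1) by (meson less_imp_le)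
    then show ?case using step nth_step[of i m] by simp
  qed simp
  \<comment> \<open>\<open>p (Suc i)\<close> has length at least \<open>Suc i\<close>, and later
    paths extend it, so its letter at \<open>i\<close> is final.\<close>
  define q where "q i = (Inl (p (Suc i) ! i) :: 'e + 'v)" for i
  have q: "q i = Inl (p n ! i)" if "i < length (p n)" for i n
    using nth_le[of n "Suc i" i] nth_le[of "Suc i" n i] that len_ge[of "Suc i"]
    by (cases "n \<le> Suc i") (auto simp: q_def)
  have "follows (q i) (q (Suc i)) \<and> q i \<in> path_letters G" for i
  proof -
    have i: "Suc i < length (p (Suc (Suc i)))"
      using len_ge[of "Suc (Suc i)"] by simp
    then have "epath G (p (Suc (Suc i)))"
      using f(1)[of "Suc (Suc i)"] by (auto simp: ok_def p_def)
    then show ?thesis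
      using i q[of i "Suc (Suc i)"] q[OF i] by (auto simp: epath_def follows_def)
  qed
  then have qp: "q \<in> paths"
    by (simp add: paths_def)
  have "\<exists>z\<in>tail_class q. letter_src G (z 0) = v" if v: "v \<in> verts G" for v
  proof -
    obtain n where n: "v = \<nu> n" using surj[OF v] by blast
    \<comment> \<open>\<open>\<nu> n\<close> reaches the source of the edge right after
      \<open>p (Suc n)\<close>, and that edge appears only in
      \<open>p (Suc (Suc n))\<close>.\<close>
    let ?z = "\<lambda>i. q (i + length (p (Suc n)))"
    obtain r where r: "r \<noteq> []" "p (Suc (Suc n)) = p (Suc n) @ r" "src G (hd r) = snd (f (Suc n))"
      using f(2)[of "Suc n"] by (auto simp: extends_def p_def)
    have "q (length (p (Suc n))) = Inl (hd r)"
      using r q[of "length (p (Suc n))" "Suc (Suc n)"] by (simp add: hd_conv_nth nth_append)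
    then have "reaches G v (letter_src G (?z 0))"
      using f(2)[of n] n r by (auto simp: extends_def)
    moreover have "?z \<in> tail_class q"
      using qp tail_equiv_refl by (intro tail_class_shift) (simp add: tail_class_def)
    ultimately show ?thesis by (rule attach_path)
  qed
  then show ?thesis
    using qp by (auto simp: cofinal_def)
qed


section \<open>Sufficiency of the conditions\<close>

lemma primitive_if_directed_exits:
  assumes dir: "downward_directed G" and exits: "\<And>p. cycle G p \<Longrightarrow> has_exit G p"
    and ne: "verts G \<noteq> {}"
  shows "primitive_ring (leavitt_path_algebra G :: ('k::field, ('v, 'e, 'k) leavitt_word set) module)"
proof -
  obtain q where q: "cofinal q"
    using cofinal_sink[OF dir] cofinal_no_sink[OF dir _ ne] by blast
  interpret separated_branching G "tail_class q" head tail "\<lambda>e. case_nat (Inl e)"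
    by (rule separated_branching_tail_class[OF exits q])
  let ?L = "leavitt_path_algebra G :: ('k, ('v, 'e, 'k) leavitt_word set) module"
  obtain v where v: "v \<in> verts G" using ne by blast
  have "coset (gP {v}) \<in> carrier ?L"
    using v by (simp add: leavitt_carrier)
  moreover have "coset (gP {v}) \<noteq> \<zero>\<^bsub>?L\<^esub>"
    using gP_vertex_nonzero[OF v] by (simp add: leavitt_ops coset_eq)
  ultimately have "carrier ?L \<noteq> {\<zero>\<^bsub>?L\<^esub>}" by blast
  moreover have "q \<in> paths" using q by (simp add: cofinal_def)
  ultimately show ?thesis
    using primitive_ringI[OF simple_function_module faithful_function_module] by blast
qed

text \<open>There are no boundary paths, so every element acts as 0 vacuously, and faithfulness of
  this empty system makes it 0.\<close>

lemma leavitt_zero_ring: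
  assumes "verts G = {}"
  shows "carrier (leavitt_path_algebra G :: ('k::field, ('v, 'e, 'k) leavitt_word set) module) =
    {\<zero>\<^bsub>leavitt_path_algebra G\<^esub>}"
proof -
  interpret graded: separated_branching G graded_paths graded_first graded_rest graded_cons
    by (rule separated_branching_graded)
  have "path_letters G = {}"
    using assms src_in_verts by (auto simp: path_letters_def sink_def)
  then have "paths = {}" by (auto simp: paths_def)
  then have "f \<approx> 0" if "f \<in> F" for f :: "('v, 'e, 'k) leavitt_word"
    using that by (intro graded.act_faithful) auto
  then have "coset f = coset 0" if "f \<in> F" for f :: "('v, 'e, 'k) leavitt_word"
    using that by (simp add: coset_eq)
  then show ?thesis
    using zero_in_free_algebra[of "leavitt_gens G"] unfolding leavitt_carrier leavitt_ops by blast
qed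

end

text \<open>The group of order 2, realized on \<open>{}\<close> and \<open>UNIV\<close> under
  symmetric difference, with the zero action.\<close>

lemma primitive_zero_ring:
  fixes R :: "('r, 'a) ring_scheme"
  assumes "nonunital_ring R" "carrier R = {\<zero>\<^bsub>R\<^esub>}"
  shows "primitive_ring R"
proof -
  interpret R: nonunital_ring R by fact
  define M :: "('r, 'r set) module" where
    "M = \<lparr>carrier = {{}, UNIV}, mult = undefined, one = undefined, zero = {},
       add = (\<lambda>A B. (A - B) \<union> (B - A)), smult = (\<lambda>_ _. {})\<rparr>"
  have M: "carrier M = {{}, UNIV}" "zero M = {}" "add M = (\<lambda>A B. (A - B) \<union> (B - A))"
    "smult M = (\<lambda>_ _. {})"
    by (simp_all add: M_def)
  have "abelian_group M"
    by (rule abelian_groupI) (auto simp: M)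
  then have left: "left_module R M"
    by (intro left_module.intro left_module_axioms.intro assms(1)) (auto simp: M)
  have "N = {\<zero>\<^bsub>M\<^esub>} \<or> N = carrier M" if "submodule N R M" for N
  proof -
    interpret submodule N R M by fact
    have "N \<subseteq> {{}, UNIV}" "{} \<in> N"
      using subset one_closed by (simp_all add: M)
    then show ?thesis by (auto simp: M)
  qed
  then have "simple_module R M"
    using left by (auto simp: simple_module_def M)
  moreover have "faithful_module R M"
    using left assms(2) by (auto simp: faithful_module_def)
  ultimately show ?thesis
    by (auto simp: primitive_ring_def)
qed

theorem theorem4p1:
  fixes G :: "('v, 'e) ultragraph_data"
  assumes "ultragraph G"
  shows "primitive_ring (leavitt_path_algebra G :: ('k::field, ('v, 'e, 'k) leavitt_word set) module)
    \<longleftrightarrow> downward_directed G \<and> (\<forall>p. cycle G p \<longrightarrow> has_exit G p)"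
proof -
  interpret ultragraph G by fact
  show ?thesis
  proof (cases "verts G = {}")
    case True
    have "\<not> cycle G p" for p
      using True src_in_verts by (cases p) (auto simp: cycle_def epath_def)
    then show ?thesis
      using True leavitt_zero_ring nonunital_ring_leavitt_path_algebra[OF assms]
      by (auto simp: downward_directed_def intro: primitive_zero_ring)
  next
    case False
    then show ?thesis
      using primitive_downward_directed primitive_has_exit primitive_if_directed_exits by blast
  qed
qed

end
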